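(* Let $K\subset M_3(\mathbb C)$ be a linear subspace of dimension three, and let $Z_K=\mathbb P(K)\cap\Sigma_{3,3}$ (scheme-theoretic intersection). If $Z_K$ is zero dimensional (the empty scheme being allowed), then \[ \operatorname{length}Z_K\le 3 . \] Up to projective change of coordinates on $\mathbb P(K)\simeq\mathbb P^2$, the possibilities for $Z_K$ are: (1) the empty scheme; (2) one reduced point; (3) two reduced points; (4) one curvilinear double point; (5) three noncollinear reduced points; (6) a curvilinear double point together with a reduced point, spanning the plane; (7) a curvilinear scheme of length three supported at one point and spanning $\mathbb P^2$; (8) the planar fat point defined by $\mathfrak m_p^2$. Every type occurs.
   Context: Everything is over $\mathbb C$. $\mathbb P(E)$ is the projective space of one dimensional subspaces of $E$. $\Sigma_{3,3}=\mathbb P^2\times\mathbb P^2\subset\mathbb P(M_3)$ is the Segre variety of rank one matrices with scheme structure given by the $2\times 2$ minors; thus, if $A(s,t,u)$ is the $3\times3$ matrix of linear forms parametrizing $K$, then $Z_K\subset\mathbb P^2$ is the scheme cut out by the $2\times2$ minors of $A(s,t,u)$. A curvilinear scheme of length $m$ at a point is one whose local algebra is isomorphic to $\mathbb C[\epsilon]/(\epsilon^m)$; a double point has $m=2$. $\mathfrak m_p$ is the maximal ideal of the local ring of $\mathbb P^2$ at a point $p$. "Spanning the plane" means not contained (as a scheme) in a line. *)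

theory Defs
  imports
    "HOL-Analysis.Analysis"
    "HOL-Algebra.Algebra"
    "HOL-Algebra.Algebraic_Closure_Type"
    "HOL-Library.Poly_Mapping"
    "HOL-Library.Extended_Nat"
    "HOL-Computational_Algebra.Fraction_Field"
begin

section \<open>Linear subspaces of the space of 3 by 3 matrices\<close>

definition mscale :: "complex \<Rightarrow> complex^3^3 \<Rightarrow> complex^3^3" where
  "mscale c M = (\<chi> i j. c * M $ i $ j)"

global_interpretation mat3: vector_space mscale
  by unfold_locales (simp_all add: mscale_def vec_eq_iff algebra_simps)

text \<open>
  A basis \<open>b\<close> of \<open>K\<close> is the same thing as a choice of homogeneous coordinates on the
  projectivisation of \<open>K\<close>: the point \<open>(s : t : u)\<close> of the plane corresponds to the line
  spanned by \<open>s b\<^sub>1 + t b\<^sub>2 + u b\<^sub>3\<close>.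
\<close>
definition coordinates_on :: "(complex^3^3) set \<Rightarrow> (3 \<Rightarrow> complex^3^3) \<Rightarrow> bool" where
  "coordinates_on K b \<longleftrightarrow>
     inj b \<and> \<not> mat3.dependent (range b) \<and> mat3.span (range b) = K"

section \<open>Polynomials in three variables and the projective plane\<close>

type_synonym poly3 = "(3 \<Rightarrow>\<^sub>0 nat) \<Rightarrow>\<^sub>0 complex"

definition Const :: "complex \<Rightarrow> poly3" where
  "Const c = Poly_Mapping.single 0 c"

definition Var :: "3 \<Rightarrow> poly3" where
  "Var i = Poly_Mapping.single (Poly_Mapping.single i 1) 1"

definition poly3_eval :: "poly3 \<Rightarrow> complex^3 \<Rightarrow> complex" where
  "poly3_eval f v =
     (\<Sum>m\<in>Poly_Mapping.keys f. Poly_Mapping.lookup f m * (\<Prod>i\<in>UNIV. (v $ i) ^ Poly_Mapping.lookup m i))"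

definition homogeneous :: "nat \<Rightarrow> poly3 \<Rightarrow> bool" where
  "homogeneous d f \<longleftrightarrow> (\<forall>m\<in>Poly_Mapping.keys f. (\<Sum>i\<in>UNIV. Poly_Mapping.lookup m i) = d)"

definition P2 :: "(complex^3) set set" where
  "P2 = {L. vec.subspace L \<and> vec.dim L = 1}"

definition vanishes_at :: "poly3 \<Rightarrow> (complex^3) set \<Rightarrow> bool" where
  "vanishes_at f p \<longleftrightarrow> (\<forall>v\<in>p. poly3_eval f v = 0)"

definition zariski_closed :: "(complex^3) set set \<Rightarrow> bool" where
  "zariski_closed V \<longleftrightarrow>
     (\<exists>F. (\<forall>f\<in>F. \<exists>d. homogeneous d f) \<and> V = {p\<in>P2. \<forall>f\<in>F. vanishes_at f p})"

definition irreducible_closed :: "(complex^3) set set \<Rightarrow> bool" where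
  "irreducible_closed V \<longleftrightarrow> zariski_closed V \<and> V \<noteq> {} \<and>
     (\<forall>A B. zariski_closed A \<and> zariski_closed B \<and> V \<subseteq> A \<union> B \<longrightarrow> V \<subseteq> A \<or> V \<subseteq> B)"

text \<open>
  Krull dimension at most zero: there is no strict chain of two irreducible closed subsets.
  The empty set is included.
\<close>
definition zero_dimensional :: "(complex^3) set set \<Rightarrow> bool" where
  "zero_dimensional V \<longleftrightarrow>
     (\<forall>A B. irreducible_closed A \<and> irreducible_closed B \<and> A \<subseteq> B \<and> B \<subseteq> V \<longrightarrow> A = B)"

section \<open>Closed subschemes of the projective plane\<close>

text \<open>
  A closed subscheme is presented by a homogeneous ideal, not necessarily saturated.  Everything
  below depends only on the stalks of the associated ideal sheaf; two ideals define the same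
  subscheme iff all these stalks agree.

  The local ring of the plane at \<open>p\<close> is the ring of fractions of forms of equal degree whose
  denominator does not vanish at \<open>p\<close>, inside the field of rational functions in three variables.
\<close>
definition poly3_ring :: "poly3 ring" where
  "poly3_ring = ring_of_type_algebra"

definition local_ring :: "(complex^3) set \<Rightarrow> poly3 fract ring" where
  "local_ring p = ring_of_type_algebra
     \<lparr>carrier := {Fract f g | f g d. homogeneous d f \<and> homogeneous d g \<and> \<not> vanishes_at g p}\<rparr>"

definition maximal_ideal :: "(complex^3) set \<Rightarrow> poly3 fract set" where
  "maximal_ideal p =
     {Fract f g | f g d. homogeneous d f \<and> homogeneous d g \<and> vanishes_at f p \<and> \<not> vanishes_at g p}"

definition ideal_stalk :: "poly3 set \<Rightarrow> (complex^3) set \<Rightarrow> poly3 fract set" where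
  "ideal_stalk I p =
     {Fract f g | f g d. f \<in> I \<and> homogeneous d f \<and> homogeneous d g \<and> \<not> vanishes_at g p}"

definition local_algebra :: "poly3 set \<Rightarrow> (complex^3) set \<Rightarrow> poly3 fract set ring" where
  "local_algebra I p = local_ring p Quot ideal_stalk I p"

definition scheme_support :: "poly3 set \<Rightarrow> (complex^3) set set" where
  "scheme_support I = {p\<in>P2. \<forall>f\<in>I. vanishes_at f p}"

definition subscheme :: "poly3 set \<Rightarrow> poly3 set \<Rightarrow> bool" where
  "subscheme I J \<longleftrightarrow> (\<forall>p\<in>P2. ideal_stalk J p \<subseteq> ideal_stalk I p)"

definition same_scheme :: "poly3 set \<Rightarrow> poly3 set \<Rightarrow> bool" where
  "same_scheme I J \<longleftrightarrow> (\<forall>p\<in>P2. ideal_stalk I p = ideal_stalk J p)"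

definition spans_plane :: "poly3 set \<Rightarrow> bool" where
  "spans_plane I \<longleftrightarrow>
     \<not> (\<exists>l. l \<noteq> 0 \<and> homogeneous 1 l \<and> subscheme I (genideal poly3_ring {l}))"

text \<open>Length of a commutative ring as a module over itself.\<close>
definition ring_length :: "('a, 'b) ring_scheme \<Rightarrow> enat" where
  "ring_length R =
     (SUP n \<in> {n. \<exists>J. (\<forall>i\<le>n. ideal (J i) R) \<and> (\<forall>i<n. J i \<subset> J (Suc i))}. enat n)"

definition scheme_length :: "poly3 set \<Rightarrow> enat" where
  "scheme_length I =
     (if finite (scheme_support I) then \<Sum>p\<in>scheme_support I. ring_length (local_algebra I p) else \<infinity>)"

section \<open>Local types of points\<close>

definition reduced_at :: "poly3 set \<Rightarrow> (complex^3) set \<Rightarrow> bool" where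
  "reduced_at I p \<longleftrightarrow> ideal_stalk I p = maximal_ideal p"

definition eps_ideal :: "nat \<Rightarrow> complex poly set" where
  "eps_ideal m = genideal ring_of_type_algebra {[:0, 1:] ^ m}"

definition truncated_poly_ring :: "nat \<Rightarrow> complex poly set ring" where
  "truncated_poly_ring m = ring_of_type_algebra Quot eps_ideal m"

text \<open>
  The local algebra is isomorphic to the truncated polynomial ring as an algebra over the complex
  numbers; the last clause says that the ring isomorphism respects constants.
\<close>
definition curvilinear_at :: "nat \<Rightarrow> poly3 set \<Rightarrow> (complex^3) set \<Rightarrow> bool" where
  "curvilinear_at m I p \<longleftrightarrow>
     (\<exists>h \<in> ring_iso (local_algebra I p) (truncated_poly_ring m).
        \<forall>c. h (ideal_stalk I p +>\<^bsub>local_ring p\<^esub> Fract (Const c) 1)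
              = eps_ideal m +>\<^bsub>ring_of_type_algebra\<^esub> [:c:])"

datatype scheme_type =
    Empty
  | One_Reduced
  | Two_Reduced
  | Double
  | Three_Reduced
  | Double_Plus_Reduced
  | Curvilinear_Triple
  | Fat_Point

fun has_type :: "scheme_type \<Rightarrow> poly3 set \<Rightarrow> bool" where
  "has_type Empty I \<longleftrightarrow> scheme_support I = {}"
| "has_type One_Reduced I \<longleftrightarrow> (\<exists>p. scheme_support I = {p} \<and> reduced_at I p)"
| "has_type Two_Reduced I \<longleftrightarrow>
     (\<exists>p q. p \<noteq> q \<and> scheme_support I = {p, q} \<and> reduced_at I p \<and> reduced_at I q)"
| "has_type Double I \<longleftrightarrow> (\<exists>p. scheme_support I = {p} \<and> curvilinear_at 2 I p)"
| "has_type Three_Reduced I \<longleftrightarrow>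
     (\<exists>p q r. p \<noteq> q \<and> p \<noteq> r \<and> q \<noteq> r \<and> scheme_support I = {p, q, r} \<and>
        reduced_at I p \<and> reduced_at I q \<and> reduced_at I r \<and> vec.span (p \<union> q \<union> r) = UNIV)"
| "has_type Double_Plus_Reduced I \<longleftrightarrow>
     (\<exists>p q. p \<noteq> q \<and> scheme_support I = {p, q} \<and> curvilinear_at 2 I p \<and> reduced_at I q \<and> spans_plane I)"
| "has_type Curvilinear_Triple I \<longleftrightarrow>
     (\<exists>p. scheme_support I = {p} \<and> curvilinear_at 3 I p \<and> spans_plane I)"
| "has_type Fat_Point I \<longleftrightarrow>
     (\<exists>p. scheme_support I = {p} \<and>
        ideal_stalk I p = ideal_prod (local_ring p) (maximal_ideal p) (maximal_ideal p))"

section \<open>The scheme of rank one matrices in a net\<close>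

definition linear_form_matrix :: "(3 \<Rightarrow> complex^3^3) \<Rightarrow> 3 \<Rightarrow> 3 \<Rightarrow> poly3" where
  "linear_form_matrix b i j = (\<Sum>k\<in>UNIV. Const (b k $ i $ j) * Var k)"

text \<open>The intersection with the Segre variety, in the coordinates given by \<open>b\<close>.\<close>
definition segre_section :: "(3 \<Rightarrow> complex^3^3) \<Rightarrow> poly3 set" where
  "segre_section b =
     (let A = linear_form_matrix b
      in genideal poly3_ring {A i k * A j l - A i l * A j k | i j k l. i \<noteq> j \<and> k \<noteq> l})"

end

theory Submission
  imports Defs
begin

text \<open>
  A basis \<open>b\<close> turns a point \<open>v\<close> of the plane into the matrix \<open>net b v\<close>, and the section is the
  locus where this matrix has rank one. The ideal of its minors depends only on the matrix of
  linear forms up to invertible row and column operations, so these may be used freely along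
  with changes of coordinates \<open>(s : t : u)\<close>. The proof brings every zero-dimensional section to
  one of eight normal forms.

  Zero-dimensionality is used in one way only (\<open>zero_dimensional_no_curve\<close>): the section
  contains no line and no conic. The line joining two points of the section lies in the section
  as soon as the two rank one matrices share their row space or their column space. Hence two
  points can be moved to the elementary matrices \<open>E11\<close> and \<open>E22\<close>. If there is a third point, the
  three matrices have independent column spaces, independent row spaces, or neither. In the
  first case the matrix has rows \<open>s y1\<close>, \<open>t y2\<close>, \<open>u y3\<close>, so that its minors span \<open>st\<close>, \<open>su\<close>,
  \<open>tu\<close>: the section consists of three noncollinear reduced points. The second case is the
  transpose of the first; in the third all matrices live on a two by two block, where the
  determinant defines a conic. If there are exactly two points, the matrix is \<open>s E11 + t E22 + u
  C\<close>, and the entries of \<open>C\<close> decide whether each point is reduced; at most one of them is not,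
  and that one is a double point whose tangent avoids the other.

  If there is one point, at \<open>E11\<close>, the matrix is \<open>s\<close> bordered by a row \<open>r\<close>, a column \<open>c\<close> and a
  two by two block \<open>D\<close> of forms in \<open>t\<close>, \<open>u\<close>. Clearing the first row and column shows that near
  the point the ideal is generated by the entries of \<open>s D - c r\<close>. If the entries of \<open>D\<close> span all
  forms in \<open>t\<close>, \<open>u\<close>, the point is reduced. If \<open>D = 0\<close>, the entries of \<open>c\<close> and those of \<open>r\<close> are
  independent, for lack of a line in the section, so the products \<open>c_i r_j\<close> span all quadratic
  forms in \<open>t\<close>, \<open>u\<close>, and the point is fat. Otherwise \<open>D = t D0\<close>, and \<open>D0\<close> is compared with the
  matrix \<open>N\<close> of rank at most one formed by the coefficients of \<open>u^2\<close> in \<open>c r\<close>. If \<open>N\<close> is not a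
  multiple of \<open>D0\<close>, then \<open>t\<close> and \<open>u^2\<close> generate the ideal and the point is double. If \<open>N = 0\<close>,
  the line \<open>t = 0\<close> lies in the section. If \<open>N\<close> is a nonzero multiple of \<open>D0\<close>, the matrix can be
  simplified until its minors span \<open>st - u^2\<close>, \<open>tu\<close>, \<open>t^2\<close>, which is the curvilinear triple
  point, or \<open>st - u^2\<close> alone, which is a conic.

  The stalks of these normal forms are described by jets of forms: vanishing at the point,
  vanishing to order two along the arc \<open>(1 : 0 : \<epsilon>)\<close>, to order three along the arc \<open>(1 : \<epsilon>^2 :
  \<epsilon>)\<close>, or to order two in all directions. The predicate \<open>standard g \<tau> b\<close> says that the stalks of
  the section are those prescribed for the type \<open>\<tau>\<close> once the coordinates are changed by \<open>g\<close>.
  From this description one reads off that the section has type \<open>\<tau>\<close> and length at most three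
  (\<open>standard_has_type\<close>, \<open>standard_length\<close>) and that it has no other type (\<open>type_unique\<close>). Two
  sections of the same type therefore acquire the same stalks in suitable coordinates.
\<close>

(* The coefficients of power series share the dollar sign with the components of vectors. *)
no_notation fps_nth (infixl "$" 75)

section \<open>Evaluating polynomials in algebras\<close>

text \<open>
  Values at points, restrictions to arcs and linear substitutions are all evaluations of a
  polynomial in some commutative algebra over the complex numbers, and share their calculation
  rules.
\<close>
locale coefficient_hom =
  fixes \<kappa> :: "complex \<Rightarrow> 'a::comm_ring_1"
  assumes \<kappa>_add: "\<kappa> (a + b) = \<kappa> a + \<kappa> b"
    and \<kappa>_mult: "\<kappa> (a * b) = \<kappa> a * \<kappa> b"
    and \<kappa>_one: "\<kappa> 1 = 1"
begin

lemma \<kappa>_zero: "\<kappa> 0 = 0"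
  using \<kappa>_add[of 0 0] by simp

definition evaluate :: "(3 \<Rightarrow> 'a) \<Rightarrow> poly3 \<Rightarrow> 'a" where
  "evaluate \<sigma> f = (\<Sum>m\<in>Poly_Mapping.keys f.
     \<kappa> (Poly_Mapping.lookup f m) * (\<Prod>i\<in>UNIV. \<sigma> i ^ Poly_Mapping.lookup m i))"

lemma evaluate_superset:
  assumes "finite S" "Poly_Mapping.keys f \<subseteq> S"
  shows "evaluate \<sigma> f =
    (\<Sum>m\<in>S. \<kappa> (Poly_Mapping.lookup f m) * (\<Prod>i\<in>UNIV. \<sigma> i ^ Poly_Mapping.lookup m i))"
  unfolding evaluate_def using assms
  by (intro sum.mono_neutral_left) (auto simp: in_keys_iff \<kappa>_zero)

lemma evaluate_add: "evaluate \<sigma> (f + g) = evaluate \<sigma> f + evaluate \<sigma> g"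
proof -
  let ?S = "Poly_Mapping.keys f \<union> Poly_Mapping.keys g"
  have "Poly_Mapping.keys (f + g) \<subseteq> ?S" by (rule Poly_Mapping.keys_add)
  then show ?thesis
    by (simp add: evaluate_superset[of ?S] lookup_add \<kappa>_add distrib_right sum.distrib)
qed

lemma evaluate_zero: "evaluate \<sigma> 0 = 0"
  by (simp add: evaluate_def)

lemma evaluate_single:
  "evaluate \<sigma> (Poly_Mapping.single m c) = \<kappa> c * (\<Prod>i\<in>UNIV. \<sigma> i ^ Poly_Mapping.lookup m i)"
  by (simp add: evaluate_superset[of "{m}"])

lemma evaluate_sum: "evaluate \<sigma> (\<Sum>x\<in>S. F x) = (\<Sum>x\<in>S. evaluate \<sigma> (F x))"
  by (induction S rule: infinite_finite_induct) (auto simp: evaluate_zero evaluate_add)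

end

lemma poly3_sum_of_terms:
  fixes f :: poly3
  shows "f = (\<Sum>m\<in>Poly_Mapping.keys f. Poly_Mapping.single m (Poly_Mapping.lookup f m))"
proof (rule poly_mapping_eqI)
  fix k
  have "Poly_Mapping.lookup (\<Sum>m\<in>Poly_Mapping.keys f. Poly_Mapping.single m (Poly_Mapping.lookup f m)) k
    = (\<Sum>m\<in>Poly_Mapping.keys f. if m = k then Poly_Mapping.lookup f m else 0)"
    unfolding lookup_sum by (rule sum.cong) (auto simp: lookup_single when_def)
  also have "\<dots> = Poly_Mapping.lookup f k"
    by (auto simp: in_keys_iff)
  finally show "Poly_Mapping.lookup f k =
    Poly_Mapping.lookup (\<Sum>m\<in>Poly_Mapping.keys f. Poly_Mapping.single m (Poly_Mapping.lookup f m)) k" ..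
qed

context coefficient_hom
begin

lemma evaluate_mult: "evaluate \<sigma> (f * g) = evaluate \<sigma> f * evaluate \<sigma> g"
proof -
  have single: "evaluate \<sigma> (Poly_Mapping.single m c * Poly_Mapping.single n d)
    = evaluate \<sigma> (Poly_Mapping.single m c) * evaluate \<sigma> (Poly_Mapping.single n d)" for m n c d
    by (simp add: mult_single evaluate_single \<kappa>_mult lookup_add power_add prod.distrib algebra_simps)
  have right: "evaluate \<sigma> (Poly_Mapping.single m c * g) = evaluate \<sigma> (Poly_Mapping.single m c) * evaluate \<sigma> g"
    for m c
    by (subst (1 2) poly3_sum_of_terms[of g]) (simp add: sum_distrib_left evaluate_sum single)
  show ?thesis
    by (subst (1 2) poly3_sum_of_terms[of f]) (simp add: sum_distrib_right evaluate_sum right)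
qed

lemma evaluate_Const: "evaluate \<sigma> (Const c) = \<kappa> c"
  by (simp add: Const_def evaluate_single)

lemma evaluate_one: "evaluate \<sigma> 1 = 1"
  using evaluate_Const[of \<sigma> 1] by (simp add: Const_def \<kappa>_one)

lemma evaluate_Var: "evaluate \<sigma> (Var i) = \<sigma> i"
proof -
  have "(\<Prod>j\<in>UNIV. \<sigma> j ^ Poly_Mapping.lookup (Poly_Mapping.single i 1) j) = (\<Prod>j\<in>UNIV. if j = i then \<sigma> i else 1)"
    by (rule prod.cong) (auto simp: lookup_single when_def)
  then show ?thesis
    by (simp add: Var_def evaluate_single \<kappa>_one)
qed

lemma evaluate_uminus: "evaluate \<sigma> (- f) = - evaluate \<sigma> f"
  using evaluate_add[of \<sigma> f "-f"] by (simp add: evaluate_zero add_eq_0_iff)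

lemma evaluate_diff: "evaluate \<sigma> (f - g) = evaluate \<sigma> f - evaluate \<sigma> g"
  using evaluate_add[of \<sigma> f "-g"] by (simp add: evaluate_uminus)

lemma evaluate_power: "evaluate \<sigma> (f ^ n) = evaluate \<sigma> f ^ n"
  by (induction n) (auto simp: evaluate_one evaluate_mult)

lemma evaluate_prod: "evaluate \<sigma> (\<Prod>x\<in>S. F x) = (\<Prod>x\<in>S. evaluate \<sigma> (F x))"
  by (induction S rule: infinite_finite_induct) (auto simp: evaluate_one evaluate_mult)

lemmas evaluate_simps = evaluate_add evaluate_mult evaluate_diff evaluate_uminus evaluate_zero
  evaluate_one evaluate_Const evaluate_Var evaluate_power evaluate_sum evaluate_prod

end

lemma Const_add: "Const (a + b) = Const a + Const b"
  by (simp add: Const_def single_add)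

lemma Const_mult: "Const (a * b) = Const a * Const b"
  by (simp add: Const_def mult_single)

lemma Const_0: "Const 0 = 0"
  by (simp add: Const_def)

lemma Const_1: "Const 1 = 1"
  by (simp add: Const_def)

lemma Const_uminus: "Const (- a) = - Const a"
  by (simp add: Const_def single_uminus)

lemma Const_diff: "Const (a - b) = Const a - Const b"
  by (simp add: Const_def single_diff)

global_interpretation point: coefficient_hom "\<lambda>c. c :: complex"
  by unfold_locales auto

global_interpretation curve: coefficient_hom "\<lambda>c. [:c:]"
  by unfold_locales auto

global_interpretation substitution: coefficient_hom Const
  by unfold_locales (auto simp: Const_add Const_mult Const_1)

abbreviation along :: "(3 \<Rightarrow> complex poly) \<Rightarrow> poly3 \<Rightarrow> complex poly" where
  "along \<equiv> curve.evaluate"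

abbreviation subst :: "(3 \<Rightarrow> poly3) \<Rightarrow> poly3 \<Rightarrow> poly3" where
  "subst \<equiv> substitution.evaluate"

lemma poly3_eval_conv: "poly3_eval f v = point.evaluate (($) v) f"
  by (simp add: poly3_eval_def point.evaluate_def)

lemma poly3_eval_simps [simp]:
  "poly3_eval (f + g) v = poly3_eval f v + poly3_eval g v"
  "poly3_eval (f * g) v = poly3_eval f v * poly3_eval g v"
  "poly3_eval (f - g) v = poly3_eval f v - poly3_eval g v"
  "poly3_eval (- f) v = - poly3_eval f v"
  "poly3_eval 0 v = 0"
  "poly3_eval 1 v = 1"
  "poly3_eval (Const c) v = c"
  "poly3_eval (Var i) v = v $ i"
  "poly3_eval (f ^ n) v = poly3_eval f v ^ n"
  "poly3_eval (\<Sum>x\<in>S. F x) v = (\<Sum>x\<in>S. poly3_eval (F x) v)"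
  by (simp_all add: poly3_eval_conv point.evaluate_simps)

lemma poly_along: "poly (along \<gamma> f) x = poly3_eval f (\<chi> i. poly (\<gamma> i) x)"
  by (simp add: poly3_eval_def curve.evaluate_def poly_sum poly_prod)

lemma along_subst: "along \<gamma> (subst \<sigma> f) = along (\<lambda>i. along \<gamma> (\<sigma> i)) f"
  by (simp add: substitution.evaluate_def curve.evaluate_simps) (simp add: curve.evaluate_def)

lemma eval_subst: "poly3_eval (subst \<sigma> f) v = poly3_eval f (\<chi> i. poly3_eval (\<sigma> i) v)"
  by (simp add: substitution.evaluate_def poly3_eval_conv point.evaluate_simps) (simp add: point.evaluate_def)

lemma subst_subst: "subst \<sigma> (subst \<tau> f) = subst (\<lambda>i. subst \<sigma> (\<tau> i)) f"
  by (subst (2) substitution.evaluate_def)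
     (simp add: substitution.evaluate_simps, simp add: substitution.evaluate_def)

lemma single_as_product:
  "Poly_Mapping.single m c = Const c * (\<Prod>i\<in>UNIV. Var i ^ Poly_Mapping.lookup m i)"
proof -
  have pw: "Var i ^ n = Poly_Mapping.single (Poly_Mapping.single i n) 1" for i n
    by (induction n) (auto simp: Var_def mult_single single_add[symmetric])
  have "(\<Prod>i\<in>S. Var i ^ Poly_Mapping.lookup m i)
      = Poly_Mapping.single (\<Sum>i\<in>S. Poly_Mapping.single i (Poly_Mapping.lookup m i)) 1"
    if "finite S" for S
    using that by (induction S) (auto simp: pw mult_single)
  moreover have "(\<Sum>i\<in>UNIV. Poly_Mapping.single i (Poly_Mapping.lookup m i)) = m"
    by (rule poly_mapping_eqI) (simp add: lookup_sum lookup_single when_def)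
  ultimately show ?thesis
    by (simp add: Const_def mult_single)
qed

lemma subst_Var: "subst Var f = f"
  by (subst (2) poly3_sum_of_terms) (simp add: single_as_product substitution.evaluate_def)

section \<open>Homogeneous polynomials\<close>

lemma homogeneous_0 [simp]: "homogeneous d 0"
  by (simp add: homogeneous_def)

lemma homogeneous_Const [simp]: "homogeneous 0 (Const c)"
  by (auto simp: homogeneous_def Const_def)

lemma homogeneous_1 [simp]: "homogeneous 0 1"
  by (auto simp: homogeneous_def)

lemma homogeneous_Var [simp]: "homogeneous 1 (Var i)" "homogeneous (Suc 0) (Var i)"
  by (auto simp: homogeneous_def Var_def lookup_single when_def)

lemma homogeneous_add:
  assumes "homogeneous d f" "homogeneous d g"
  shows "homogeneous d (f + g)"
  using assms Poly_Mapping.keys_add[of f g] by (auto simp: homogeneous_def)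

lemma homogeneous_uminus: "homogeneous d f \<Longrightarrow> homogeneous d (- f)"
  by (auto simp: homogeneous_def)

lemma homogeneous_diff: "homogeneous d f \<Longrightarrow> homogeneous d g \<Longrightarrow> homogeneous d (f - g)"
  using homogeneous_add[of d f "- g"] homogeneous_uminus[of d g] by simp

lemma homogeneous_sum: "(\<And>x. x \<in> S \<Longrightarrow> homogeneous d (F x)) \<Longrightarrow> homogeneous d (\<Sum>x\<in>S. F x)"
  by (induction S rule: infinite_finite_induct) (auto intro: homogeneous_add)

lemma homogeneous_mult:
  assumes "homogeneous d f" "homogeneous e g"
  shows "homogeneous (d + e) (f * g)"
  using assms Poly_Mapping.keys_mult[of f g]
  by (fastforce simp: homogeneous_def lookup_add sum.distrib)

lemma homogeneous_mult_Const: "homogeneous d f \<Longrightarrow> homogeneous d (Const c * f)"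
  using homogeneous_mult[of 0 "Const c" d f] by simp

lemma homogeneous_power: "homogeneous d f \<Longrightarrow> homogeneous (n * d) (f ^ n)"
  by (induction n) (auto intro: homogeneous_mult)

lemma homogeneous_prod:
  "(\<And>x. x \<in> S \<Longrightarrow> homogeneous (d x) (F x)) \<Longrightarrow> homogeneous (\<Sum>x\<in>S. d x) (\<Prod>x\<in>S. F x)"
  by (induction S rule: infinite_finite_induct) (auto intro: homogeneous_mult)

lemma homogeneous_subst:
  assumes "homogeneous d f" "\<And>i. homogeneous 1 (\<sigma> i)"
  shows "homogeneous d (subst \<sigma> f)"
  unfolding substitution.evaluate_def
proof (rule homogeneous_sum)
  fix m assume "m \<in> Poly_Mapping.keys f"
  then have d: "d = (\<Sum>i\<in>UNIV. Poly_Mapping.lookup m i)"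
    using assms(1) by (auto simp: homogeneous_def)
  have "homogeneous (Poly_Mapping.lookup m i) (\<sigma> i ^ Poly_Mapping.lookup m i)" for i
    using homogeneous_power[OF assms(2)[of i], of "Poly_Mapping.lookup m i"] by simp
  then show "homogeneous d (Const (Poly_Mapping.lookup f m) * (\<Prod>i\<in>UNIV. \<sigma> i ^ Poly_Mapping.lookup m i))"
    unfolding d by (intro homogeneous_mult_Const homogeneous_prod)
qed

lemma eval_scale:
  assumes "homogeneous d f"
  shows "poly3_eval f (c *s v) = c ^ d * poly3_eval f v"
proof -
  have "(\<Prod>i\<in>UNIV. ((c *s v) $ i) ^ Poly_Mapping.lookup m i)
      = c ^ d * (\<Prod>i\<in>UNIV. (v $ i) ^ Poly_Mapping.lookup m i)" if "m \<in> Poly_Mapping.keys f" for m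
  proof -
    have "(\<Prod>i\<in>UNIV. c ^ Poly_Mapping.lookup m i) = c ^ d"
      using assms that by (auto simp: homogeneous_def simp flip: power_sum)
    then show ?thesis
      by (simp add: power_mult_distrib prod.distrib)
  qed
  then show ?thesis
    unfolding poly3_eval_def sum_distrib_left by (intro sum.cong) (auto simp: algebra_simps)
qed

section \<open>Ideals of polynomials and linear changes of coordinates\<close>

definition poly_ideal :: "poly3 set \<Rightarrow> bool" where
  "poly_ideal J \<longleftrightarrow> 0 \<in> J \<and> (\<forall>f\<in>J. \<forall>g\<in>J. f + g \<in> J) \<and> (\<forall>f\<in>J. \<forall>h. h * f \<in> J)"

lemma poly_ideal_zero: "poly_ideal J \<Longrightarrow> 0 \<in> J"
  and poly_ideal_add: "poly_ideal J \<Longrightarrow> f \<in> J \<Longrightarrow> g \<in> J \<Longrightarrow> f + g \<in> J"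
  and poly_ideal_mult: "poly_ideal J \<Longrightarrow> f \<in> J \<Longrightarrow> h * f \<in> J"
  by (auto simp: poly_ideal_def)

lemma poly_ideal_uminus: "poly_ideal J \<Longrightarrow> f \<in> J \<Longrightarrow> - f \<in> J"
  using poly_ideal_mult[of J f "- 1"] by simp

lemma poly_ideal_diff: "poly_ideal J \<Longrightarrow> f \<in> J \<Longrightarrow> g \<in> J \<Longrightarrow> f - g \<in> J"
  using poly_ideal_add[of J f "- g"] poly_ideal_uminus[of J g] by simp

lemma poly_ideal_sum: "poly_ideal J \<Longrightarrow> (\<And>x. x \<in> S \<Longrightarrow> F x \<in> J) \<Longrightarrow> (\<Sum>x\<in>S. F x) \<in> J"
  by (induction S rule: infinite_finite_induct) (auto simp: poly_ideal_zero poly_ideal_add)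

lemma ideal_poly3_ring_iff: "ideal J poly3_ring \<longleftrightarrow> poly_ideal J"
proof
  assume "ideal J poly3_ring"
  then interpret ideal J poly3_ring .
  show "poly_ideal J"
    using additive_subgroup.zero_closed[OF additive_subgroup_axioms] additive_subgroup.a_closed[OF additive_subgroup_axioms] I_l_closed
    by (auto simp: poly_ideal_def poly3_ring_def ring_of_type_algebra_def)
next
  assume J: "poly_ideal J"
  have "cring poly3_ring"
    unfolding poly3_ring_def by (rule cring_from_type_algebra)
  then interpret cring poly3_ring .
  have "subgroup J (add_monoid poly3_ring)"
  proof (rule add.subgroupI)
    fix a assume "a \<in> J"
    then have "- a \<in> J" using J poly_ideal_uminus by blast
    moreover have "\<ominus>\<^bsub>poly3_ring\<^esub> a = - a"
      by (rule minus_equality) (auto simp: poly3_ring_def ring_of_type_algebra_def)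
    ultimately show "\<ominus>\<^bsub>poly3_ring\<^esub> a \<in> J" by simp
  qed (use J in \<open>auto simp: poly_ideal_def poly3_ring_def ring_of_type_algebra_def\<close>)
  then show "ideal J poly3_ring"
    using J by (intro idealI ring_axioms)
      (auto simp: poly_ideal_def poly3_ring_def ring_of_type_algebra_def mult.commute)
qed

lemma poly_ideal_genideal: "poly_ideal (genideal poly3_ring S)"
proof -
  have "cring poly3_ring"
    unfolding poly3_ring_def by (rule cring_from_type_algebra)
  then interpret cring poly3_ring .
  show ?thesis
    unfolding ideal_poly3_ring_iff[symmetric]
    by (rule genideal_ideal) (auto simp: poly3_ring_def ring_of_type_algebra_def)
qed

lemma in_genideal: "f \<in> S \<Longrightarrow> f \<in> genideal poly3_ring S"
  by (auto simp: genideal_def)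

lemma genideal_subset: "poly_ideal J \<Longrightarrow> S \<subseteq> J \<Longrightarrow> genideal poly3_ring S \<subseteq> J"
  by (auto simp: genideal_def ideal_poly3_ring_iff)

text \<open>
  The substitution is dual to the action on points: the value of \<open>change g f\<close> at \<open>v\<close> is the
  value of \<open>f\<close> at \<open>g v\<close>, so \<open>change\<close> reverses products.
\<close>
definition change :: "complex^3^3 \<Rightarrow> poly3 \<Rightarrow> poly3" where
  "change g = subst (\<lambda>k. \<Sum>j\<in>UNIV. Const (g $ k $ j) * Var j)"

lemma change_simps [simp]:
  "change g (f + h) = change g f + change g h"
  "change g (f * h) = change g f * change g h"
  "change g (f - h) = change g f - change g h"
  "change g 0 = 0" "change g 1 = 1"
  "change g (Const c) = Const c"
  by (simp_all add: change_def substitution.evaluate_simps)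

lemma eval_change [simp]: "poly3_eval (change g f) v = poly3_eval f (g *v v)"
  by (simp add: change_def eval_subst matrix_vector_mult_def)

lemma Const_sum: "Const (\<Sum>x\<in>S. F x) = (\<Sum>x\<in>S. Const (F x))"
  by (induction S rule: infinite_finite_induct) (auto simp: Const_0 Const_add)

lemma change_change: "change g (change h f) = change (h ** g) f"
proof -
  have "(\<Sum>j\<in>UNIV. Const (h $ k $ j) * (\<Sum>i\<in>UNIV. Const (g $ j $ i) * Var i))
      = (\<Sum>i\<in>UNIV. Const ((h ** g) $ k $ i) * Var i)" for k
    by (simp add: matrix_matrix_mult_def Const_sum sum_distrib_left sum_distrib_right Const_mult mult.assoc)
       (rule sum.swap)
  then show ?thesis
    by (simp add: change_def subst_subst substitution.evaluate_simps)
qed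

lemma change_id [simp]: "change (mat 1) f = f"
proof -
  have "(\<Sum>j\<in>UNIV. Const (mat 1 $ k $ j) * Var j) = Var k" for k :: 3
    by (simp add: mat_def if_distrib[of Const] if_distrib[of "\<lambda>x. x * _"] Const_0 Const_1 cong: if_cong)
  then show ?thesis
    by (simp add: change_def subst_Var)
qed

lemma homogeneous_change: "homogeneous d f \<Longrightarrow> homogeneous d (change g f)"
  unfolding change_def by (rule homogeneous_subst) (auto intro!: homogeneous_sum homogeneous_mult_Const)

section \<open>Stalks of a homogeneous ideal\<close>

text \<open>
  For a form \<open>f\<close> this means that \<open>f / g\<close> lies in the stalk at \<open>v\<close> whenever \<open>g\<close> is a form of the
  same degree with \<open>g(v) \<noteq> 0\<close>. Stalks can thus be computed with polynomials instead of
  fractions: the polynomials locally in an ideal form an ideal, from which forms that do not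
  vanish at \<open>v\<close> can be cancelled.
\<close>
definition locally_in :: "poly3 set \<Rightarrow> complex^3 \<Rightarrow> poly3 \<Rightarrow> bool" where
  "locally_in I v f \<longleftrightarrow> (\<exists>h d. homogeneous d h \<and> poly3_eval h v \<noteq> 0 \<and> h * f \<in> I)"

lemma locally_inI: "homogeneous d h \<Longrightarrow> poly3_eval h v \<noteq> 0 \<Longrightarrow> h * f \<in> I \<Longrightarrow> locally_in I v f"
  by (auto simp: locally_in_def)

lemma locally_in_member: "f \<in> I \<Longrightarrow> locally_in I v f"
  by (rule locally_inI[of 0 1]) auto

lemma locally_in_mult: "poly_ideal I \<Longrightarrow> locally_in I v f \<Longrightarrow> locally_in I v (h * f)"
  unfolding locally_in_def by (metis mult.left_commute poly_ideal_mult)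

lemma locally_in_add:
  assumes I: "poly_ideal I" and "locally_in I v f" "locally_in I v g"
  shows "locally_in I v (f + g)"
proof -
  obtain h d k e where h: "homogeneous d h" "poly3_eval h v \<noteq> 0" "h * f \<in> I"
    and k: "homogeneous e k" "poly3_eval k v \<noteq> 0" "k * g \<in> I"
    using assms by (auto simp: locally_in_def)
  have "(h * k) * (f + g) = k * (h * f) + h * (k * g)"
    by (simp add: algebra_simps)
  also have "\<dots> \<in> I"
    using I h k by (simp add: poly_ideal_add poly_ideal_mult)
  finally show ?thesis
    using h k by (intro locally_inI[of "d + e" "h * k"]) (auto intro: homogeneous_mult)
qed

lemma poly_ideal_locally_in: "poly_ideal I \<Longrightarrow> poly_ideal {f. locally_in I v f}"
  by (subst poly_ideal_def) (auto simp: locally_in_add locally_in_mult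
           intro: locally_in_member poly_ideal_zero)

lemma locally_in_cancel:
  assumes "poly_ideal I" "homogeneous d g" "poly3_eval g v \<noteq> 0" "locally_in I v (g * f)"
  shows "locally_in I v f"
proof -
  obtain h e where "homogeneous e h" "poly3_eval h v \<noteq> 0" "h * (g * f) \<in> I"
    using assms by (auto simp: locally_in_def)
  then show ?thesis
    using assms by (intro locally_inI[of "e + d" "h * g"]) (auto intro: homogeneous_mult simp: mult.assoc)
qed

lemma locally_in_scale:
  assumes "c \<noteq> 0"
  shows "locally_in I (c *s v) f \<longleftrightarrow> locally_in I v f"
  unfolding locally_in_def using assms by (auto simp: eval_scale)

lemma locally_in_eval:
  assumes "\<And>f. f \<in> I \<Longrightarrow> poly3_eval f v = 0" "locally_in I v f"
  shows "poly3_eval f v = 0"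
  using assms unfolding locally_in_def by (metis mult_eq_0_iff poly3_eval_simps(2))

definition line_through :: "complex^3 \<Rightarrow> (complex^3) set" where
  "line_through v = range (\<lambda>c. c *s v)"

lemma line_through_span: "line_through v = vec.span {v}"
  by (auto simp: line_through_def vec.span_singleton)

lemma P2_iff: "p \<in> P2 \<longleftrightarrow> (\<exists>v. v \<noteq> 0 \<and> p = line_through v)"
proof
  assume "p \<in> P2"
  then have p: "vec.subspace p" "vec.dim p = 1" by (auto simp: P2_def)
  obtain B where B: "B \<subseteq> p" "vec.independent B" "p \<subseteq> vec.span B" "card B = vec.dim p"
    using vec.basis_exists by metis
  then obtain v where v: "B = {v}" using p card_1_singletonE by metis
  then have "v \<noteq> 0" using B(2) by (auto simp: vec.dependent_single)
  moreover have "p = vec.span {v}"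
    using B v p by (metis vec.span_minimal subset_antisym)
  ultimately show "\<exists>v. v \<noteq> 0 \<and> p = line_through v" by (auto simp: line_through_span)
next
  assume "\<exists>v. v \<noteq> 0 \<and> p = line_through v"
  then obtain v where v: "v \<noteq> 0" "p = vec.span {v}" by (auto simp: line_through_span)
  have "vec.dim {v} = 1" using v(1) vec.dim_eq_card_independent[of "{v}"] by (simp add: vec.dependent_single)
  then show "p \<in> P2" using v by (simp add: P2_def)
qed

lemma line_through_in_P2: "v \<noteq> 0 \<Longrightarrow> line_through v \<in> P2"
  by (auto simp: P2_iff)

lemma in_line_through_self: "v \<in> line_through v"
  unfolding line_through_def by (rule range_eqI[of _ _ 1]) simp

lemma line_through_scale: "c \<noteq> 0 \<Longrightarrow> line_through (c *s v) = line_through v"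
proof -
  assume c: "c \<noteq> 0"
  have "d *s v \<in> range (\<lambda>d. d *s (c *s v))" for d
    using c by (intro range_eqI[of _ _ "d / c"]) (simp add: vec.scale_scale)
  then show ?thesis
    by (auto simp: line_through_def vec.scale_scale)
qed

lemma line_through_eq_iff:
  assumes "v \<noteq> 0" "w \<noteq> 0"
  shows "line_through v = line_through w \<longleftrightarrow> (\<exists>c. v = c *s w)"
proof
  assume "line_through v = line_through w"
  then show "\<exists>c. v = c *s w" using in_line_through_self[of v] by (auto simp: line_through_def)
next
  assume "\<exists>c. v = c *s w"
  then show "line_through v = line_through w" using assms by (metis line_through_scale vec.scale_zero_left)
qed

lemma vanishes_at_iff:
  assumes "homogeneous d f"
  shows "vanishes_at f (line_through v) \<longleftrightarrow> poly3_eval f v = 0"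
  unfolding vanishes_at_def
  using assms in_line_through_self[of v] by (auto simp: line_through_def eval_scale)

lemma not_vanishing_nonzero: "poly3_eval g v \<noteq> 0 \<Longrightarrow> g \<noteq> 0"
  by auto

definition regular :: "complex^3 \<Rightarrow> poly3 fract set" where
  "regular v = {Fract f g | f g d. homogeneous d f \<and> homogeneous d g \<and> poly3_eval g v \<noteq> 0}"

lemma carrier_local_ring: "carrier (local_ring (line_through v)) = regular v"
  unfolding local_ring_def regular_def using vanishes_at_iff by auto blast+

lemma maximal_ideal_iff:
  "maximal_ideal (line_through v) =
    {Fract f g | f g d. homogeneous d f \<and> homogeneous d g \<and> poly3_eval f v = 0 \<and> poly3_eval g v \<noteq> 0}"
  unfolding maximal_ideal_def using vanishes_at_iff by auto blast+

lemma ideal_stalk_iff: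
  assumes I: "poly_ideal I"
  shows "ideal_stalk I (line_through v) =
    {Fract f g | f g d. homogeneous d f \<and> homogeneous d g \<and> poly3_eval g v \<noteq> 0 \<and> locally_in I v f}"
    (is "_ = ?R")
proof (intro equalityI subsetI)
  fix z assume "z \<in> ideal_stalk I (line_through v)"
  then obtain f g d where "z = Fract f g" "f \<in> I" "homogeneous d f" "homogeneous d g"
    "\<not> vanishes_at g (line_through v)"
    by (auto simp: ideal_stalk_def)
  then show "z \<in> ?R" using vanishes_at_iff locally_in_member by blast
next
  fix z assume "z \<in> ?R"
  then obtain f g d where z: "z = Fract f g"
    and fg: "homogeneous d f" "homogeneous d g" "poly3_eval g v \<noteq> 0" "locally_in I v f"
    by auto
  then obtain h e where h: "homogeneous e h" "poly3_eval h v \<noteq> 0" "h * f \<in> I"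
    by (auto simp: locally_in_def)
  have "Fract f g = Fract (h * f) (h * g)"
    using fg h by (subst eq_fract) (auto simp: not_vanishing_nonzero)
  moreover have "\<not> vanishes_at (h * g) (line_through v)"
    using fg h homogeneous_mult[OF h(1) fg(2)] by (simp add: vanishes_at_iff)
  ultimately show "z \<in> ideal_stalk I (line_through v)"
    unfolding z ideal_stalk_def using h fg homogeneous_mult by blast
qed

text \<open>
  Equality of fractions only multiplies numerators by forms that do not vanish at \<open>v\<close>, and those
  can be cancelled; so membership in the stalk can be tested on any representative.
\<close>
lemma Fract_in_stalk_iff:
  assumes I: "poly_ideal I" and fg: "homogeneous d f" "homogeneous d g" "poly3_eval g v \<noteq> 0"
  shows "Fract f g \<in> ideal_stalk I (line_through v) \<longleftrightarrow> locally_in I v f"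
proof
  assume "Fract f g \<in> ideal_stalk I (line_through v)"
  then obtain f' g' d' where *: "Fract f g = Fract f' g'" "homogeneous d' f'" "homogeneous d' g'"
    "poly3_eval g' v \<noteq> 0" "locally_in I v f'"
    by (auto simp: ideal_stalk_iff[OF I])
  then have "f * g' = f' * g"
    using fg by (subst (asm) eq_fract) (auto simp: not_vanishing_nonzero)
  then have "locally_in I v (g' * f)"
    using locally_in_mult[OF I *(5), of g] by (simp add: mult.commute)
  then show "locally_in I v f" using locally_in_cancel[OF I *(3,4)] by simp
next
  assume "locally_in I v f"
  then show "Fract f g \<in> ideal_stalk I (line_through v)"
    using fg by (auto simp: ideal_stalk_iff[OF I])
qed

section \<open>The minors of a net of matrices\<close>

definition net :: "(3 \<Rightarrow> complex^3^3) \<Rightarrow> complex^3 \<Rightarrow> complex^3^3" where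
  "net b v = (\<Sum>k\<in>UNIV. mscale (v $ k) (b k))"

lemma net_nth: "net b v $ i $ j = (\<Sum>k\<in>UNIV. v $ k * b k $ i $ j)"
  by (simp add: net_def mscale_def)

lemma net_add: "net b (v + w) = net b v + net b w"
  by (simp add: vec_eq_iff net_nth sum.distrib distrib_right)

lemma net_scale: "net b (c *s v) = mscale c (net b v)"
  by (simp add: vec_eq_iff net_nth mscale_def sum_distrib_left mult.assoc)

lemma net_axis: "net b (axis k 1) = b k"
  by (simp add: vec_eq_iff net_nth axis_def if_distrib[of "\<lambda>x. x * _"] cong: if_cong)

definition reparametrize :: "complex^3^3 \<Rightarrow> (3 \<Rightarrow> complex^3^3) \<Rightarrow> 3 \<Rightarrow> complex^3^3" where
  "reparametrize g b j = net b (column j g)"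

lemma net_reparametrize: "net (reparametrize g b) v = net b (g *v v)"
  by (simp add: vec_eq_iff net_nth reparametrize_def matrix_vector_mult_def column_def
      sum_distrib_left sum_distrib_right)
     (intro allI, subst sum.swap, intro sum.cong refl, simp add: mult_ac)

lemma eval_linear_form_matrix [simp]: "poly3_eval (linear_form_matrix b i j) v = net b v $ i $ j"
  by (simp add: linear_form_matrix_def net_nth mult.commute)

lemma homogeneous_linear_form_matrix: "homogeneous 1 (linear_form_matrix b i j)"
  unfolding linear_form_matrix_def by (intro homogeneous_sum homogeneous_mult_Const) simp

lemma change_linear_form_matrix:
  "change g (linear_form_matrix b i j) = linear_form_matrix (reparametrize g b) i j"
proof -
  have "change g (linear_form_matrix b i j)
      = (\<Sum>k\<in>UNIV. Const (b k $ i $ j) * (\<Sum>l\<in>UNIV. Const (g $ k $ l) * Var l))"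
    by (simp add: change_def linear_form_matrix_def substitution.evaluate_simps)
  also have "\<dots> = (\<Sum>l\<in>UNIV. \<Sum>k\<in>UNIV. Const (g $ k $ l * b k $ i $ j) * Var l)"
    by (simp add: sum_distrib_left Const_mult mult_ac, rule sum.swap)
  also have "\<dots> = linear_form_matrix (reparametrize g b) i j"
    by (simp add: linear_form_matrix_def reparametrize_def net_nth column_def Const_sum sum_distrib_right)
  finally show ?thesis .
qed

definition minor :: "(3 \<Rightarrow> 3 \<Rightarrow> 'a::comm_ring_1) \<Rightarrow> 3 \<Rightarrow> 3 \<Rightarrow> 3 \<Rightarrow> 3 \<Rightarrow> 'a" where
  "minor A i j k l = A i k * A j l - A i l * A j k"

lemma minor_same: "minor A i i k l = 0" "minor A i j k k = 0"
  by (simp_all add: minor_def mult.commute)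

lemma poly_ideal_segre: "poly_ideal (segre_section b)"
  by (simp add: segre_section_def Let_def poly_ideal_genideal)

lemma minor_in_segre: "minor (linear_form_matrix b) i j k l \<in> segre_section b"
proof (cases "i \<noteq> j \<and> k \<noteq> l")
  case True
  then show ?thesis
    unfolding segre_section_def Let_def minor_def by (intro in_genideal) blast
next
  case False
  then show ?thesis using poly_ideal_zero[OF poly_ideal_segre] minor_same by metis
qed

lemma segre_subset:
  assumes "poly_ideal J" "\<And>i j k l. minor (linear_form_matrix b) i j k l \<in> J"
  shows "segre_section b \<subseteq> J"
  unfolding segre_section_def Let_def
  using assms by (intro genideal_subset) (auto simp: minor_def)

lemma homogeneous_minor: "homogeneous 2 (minor (linear_form_matrix b) i j k l)"
  unfolding minor_def using homogeneous_mult[OF homogeneous_linear_form_matrix homogeneous_linear_form_matrix]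
  by (intro homogeneous_diff) (auto simp: numeral_2_eq_2)

text \<open>
  The matrix of linear forms in the new coordinates is the image of the old one under the
  substitution, and so are its minors.
\<close>
lemma change_segre: "f \<in> segre_section b \<Longrightarrow> change g f \<in> segre_section (reparametrize g b)"
proof -
  let ?J = "{f. change g f \<in> segre_section (reparametrize g b)}"
  note I = poly_ideal_segre[of "reparametrize g b"]
  have "poly_ideal ?J"
    using I by (auto simp: poly_ideal_def)
  moreover have "minor (linear_form_matrix b) i j k l \<in> ?J" for i j k l
    using minor_in_segre[of "reparametrize g b" i j k l]
    by (simp add: minor_def change_linear_form_matrix)
  ultimately show "f \<in> segre_section b \<Longrightarrow> change g f \<in> segre_section (reparametrize g b)"
    using segre_subset by blast
qed

lemma reparametrize_reparametrize: "reparametrize g (reparametrize h b) = reparametrize (h ** g) b"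
  by (rule ext) (simp add: reparametrize_def net_reparametrize column_def matrix_matrix_mult_def
      matrix_vector_mult_def)

lemma reparametrize_id [simp]: "reparametrize (mat 1) b = b"
proof
  fix j
  have "column j (mat 1 :: complex^3^3) = axis j 1"
    by (simp add: column_def mat_def axis_def vec_eq_iff)
  then show "reparametrize (mat 1) b j = b j" by (simp add: reparametrize_def net_axis)
qed

lemma change_in_segre_iff:
  assumes g: "invertible g"
  shows "change g f \<in> segre_section (reparametrize g b) \<longleftrightarrow> f \<in> segre_section b"
proof
  obtain h where h: "g ** h = mat 1" using g invertible_right_inverse by blast
  assume "change g f \<in> segre_section (reparametrize g b)"
  from change_segre[OF this, of h] show "f \<in> segre_section b"
    by (simp add: change_change reparametrize_reparametrize h)
qed (rule change_segre)

lemma change_surj: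
  assumes g: "invertible g"
  obtains h where "invertible h" "g ** h = mat 1" "h ** g = mat 1" "\<And>f. change g (change h f) = f"
    "\<And>f. change h (change g f) = f"
  using g unfolding invertible_def by (metis change_change change_id)

lemma locally_in_change:
  assumes g: "invertible g"
  shows "locally_in (segre_section (reparametrize g b)) v (change g f)
    \<longleftrightarrow> locally_in (segre_section b) (g *v v) f"
proof -
  obtain h where h: "\<And>f. change g (change h f) = f" using change_surj[OF g] by metis
  have "(\<exists>k d. homogeneous d k \<and> poly3_eval k v \<noteq> 0 \<and> k * change g f \<in> segre_section (reparametrize g b))
    \<longleftrightarrow> (\<exists>k d. homogeneous d (change g k) \<and> poly3_eval (change g k) v \<noteq> 0 \<and>
          change g k * change g f \<in> segre_section (reparametrize g b))"
    using h by metis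
  also have "\<dots> \<longleftrightarrow> (\<exists>k d. homogeneous d k \<and> poly3_eval k (g *v v) \<noteq> 0 \<and> k * f \<in> segre_section b)"
  proof -
    have "homogeneous d (change g k) \<longleftrightarrow> homogeneous d k" for d k
      using homogeneous_change change_surj[OF g] by metis
    then show ?thesis
      using change_in_segre_iff[OF g, of _ b] by (simp flip: change_simps(2))
  qed
  finally show ?thesis by (simp add: locally_in_def)
qed

definition rank_le_one :: "complex^3^3 \<Rightarrow> bool" where
  "rank_le_one M \<longleftrightarrow> (\<forall>i j k l. minor (\<lambda>i j. M $ i $ j) i j k l = 0)"

lemma segre_vanishes_iff:
  "(\<forall>f\<in>segre_section b. poly3_eval f v = 0) \<longleftrightarrow> rank_le_one (net b v)"
proof
  assume *: "\<forall>f\<in>segre_section b. poly3_eval f v = 0"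
  have "poly3_eval (minor (linear_form_matrix b) i j k l) v = 0" for i j k l
    using * minor_in_segre by blast
  then show "rank_le_one (net b v)" by (simp add: rank_le_one_def minor_def)
next
  assume "rank_le_one (net b v)"
  then have "segre_section b \<subseteq> {f. poly3_eval f v = 0}"
    by (intro segre_subset) (auto simp: poly_ideal_def rank_le_one_def minor_def)
  then show "\<forall>f\<in>segre_section b. poly3_eval f v = 0" by blast
qed

lemma rank_le_one_scale: "rank_le_one M \<Longrightarrow> rank_le_one (mscale c M)"
proof -
  have "minor (\<lambda>i j. mscale c M $ i $ j) i j k l = c * c * minor (\<lambda>i j. M $ i $ j) i j k l" for i j k l
    by (simp add: minor_def mscale_def algebra_simps)
  then show "rank_le_one M \<Longrightarrow> rank_le_one (mscale c M)" by (simp add: rank_le_one_def)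
qed

lemma line_in_support_iff:
  assumes "v \<noteq> 0"
  shows "line_through v \<in> scheme_support (segre_section b) \<longleftrightarrow> rank_le_one (net b v)"
proof -
  have "(\<forall>f\<in>segre_section b. vanishes_at f (line_through v)) \<longleftrightarrow> (\<forall>w\<in>line_through v. rank_le_one (net b w))"
    unfolding segre_vanishes_iff[symmetric] vanishes_at_def by blast
  also have "\<dots> \<longleftrightarrow> rank_le_one (net b v)"
    using in_line_through_self[of v] rank_le_one_scale[of "net b v"]
    by (metis (no_types, lifting) imageE line_through_def net_scale)
  finally show ?thesis
    using assms by (auto simp: scheme_support_def line_through_in_P2)
qed

lemma support_segre:
  "scheme_support (segre_section b) = {line_through v | v. v \<noteq> 0 \<and> rank_le_one (net b v)}"
  using line_in_support_iff by (auto simp: scheme_support_def P2_iff)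

lemma locally_in_outside_support:
  assumes "\<not> rank_le_one (net b v)"
  shows "locally_in (segre_section b) v 1"
proof -
  obtain i j k l where "minor (\<lambda>i j. net b v $ i $ j) i j k l \<noteq> 0"
    using assms by (auto simp: rank_le_one_def)
  then have "poly3_eval (minor (linear_form_matrix b) i j k l) v \<noteq> 0"
    by (simp add: minor_def)
  then show ?thesis
    using homogeneous_minor minor_in_segre by (intro locally_inI) auto
qed

lemma locally_in_one_iff: "locally_in (segre_section b) v 1 \<longleftrightarrow> \<not> rank_le_one (net b v)"
  using locally_in_outside_support locally_in_eval[of "segre_section b" v 1] segre_vanishes_iff[of b v]
  by auto

section \<open>Local rings and their quotients\<close>

lemma regularI: "homogeneous d f \<Longrightarrow> homogeneous d g \<Longrightarrow> poly3_eval g v \<noteq> 0 \<Longrightarrow> Fract f g \<in> regular v"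
  by (auto simp: regular_def)

lemma regularE:
  assumes "z \<in> regular v"
  obtains f g d where "z = Fract f g" "homogeneous d f" "homogeneous d g" "poly3_eval g v \<noteq> 0"
  using assms by (auto simp: regular_def)

lemma regular_Const: "Fract (Const c) 1 \<in> regular v"
  by (rule regularI[of 0]) auto

lemma regular_0: "0 \<in> regular v" and regular_1: "1 \<in> regular v"
  using regular_Const[of 0 v] regular_Const[of 1 v]
  by (simp_all add: Const_0 Const_1 Zero_fract_def One_fract_def)

lemma regular_mult:
  assumes "z \<in> regular v" "w \<in> regular v"
  shows "z * w \<in> regular v"
proof -
  obtain f g d f' g' d' where "z = Fract f g" "w = Fract f' g'" "homogeneous d f" "homogeneous d g"
    "poly3_eval g v \<noteq> 0" "homogeneous d' f'" "homogeneous d' g'" "poly3_eval g' v \<noteq> 0"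
    using assms by (metis regularE)
  then show ?thesis
    by (auto intro!: regularI[of "d + d'"] homogeneous_mult)
qed

lemma regular_add:
  assumes "z \<in> regular v" "w \<in> regular v"
  shows "z + w \<in> regular v"
proof -
  obtain f g d f' g' d' where *: "z = Fract f g" "w = Fract f' g'" "homogeneous d f" "homogeneous d g"
    "poly3_eval g v \<noteq> 0" "homogeneous d' f'" "homogeneous d' g'" "poly3_eval g' v \<noteq> 0"
    using assms by (metis regularE)
  have "homogeneous (d + d') (f * g')" "homogeneous (d + d') (f' * g)" "homogeneous (d + d') (g * g')"
    using * homogeneous_mult[of d' f' d g] homogeneous_mult[of d f d' g'] homogeneous_mult[of d g d' g']
    by (auto simp: add.commute)
  then show ?thesis
    using * by (auto simp: not_vanishing_nonzero intro!: regularI[of "d + d'"] homogeneous_add)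
qed

lemma Fract_Const_uminus_1: "Fract (Const (- 1)) 1 = - 1"
  by (simp add: Const_uminus Const_1 One_fract_def)

lemma regular_uminus: "z \<in> regular v \<Longrightarrow> - z \<in> regular v"
  using regular_mult[OF regular_Const[of "- 1" v], of z] by (simp add: Fract_Const_uminus_1)

lemma regular_diff: "z \<in> regular v \<Longrightarrow> w \<in> regular v \<Longrightarrow> z - w \<in> regular v"
  using regular_add[of z v "- w"] regular_uminus[of w v] by simp

lemma regular_sum: "(\<And>x. x \<in> S \<Longrightarrow> F x \<in> regular v) \<Longrightarrow> (\<Sum>x\<in>S. F x) \<in> regular v"
  by (induction S rule: infinite_finite_induct) (auto simp: regular_0 regular_add)

lemma regular_power: "z \<in> regular v \<Longrightarrow> z ^ n \<in> regular v"
  by (induction n) (auto simp: regular_1 regular_mult)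

lemma local_ring_simps [simp]:
  "carrier (local_ring (line_through v)) = regular v"
  "z \<otimes>\<^bsub>local_ring p\<^esub> w = z * w" "z \<oplus>\<^bsub>local_ring p\<^esub> w = z + w"
  "\<one>\<^bsub>local_ring p\<^esub> = 1" "\<zero>\<^bsub>local_ring p\<^esub> = 0"
  by (simp_all add: carrier_local_ring) (simp_all add: local_ring_def ring_of_type_algebra_def)

lemma cring_local_ring: "cring (local_ring (line_through v))"
proof -
  interpret F: cring "ring_of_type_algebra :: poly3 fract ring"
    by (rule cring_from_type_algebra)
  have minus: "\<ominus>\<^bsub>ring_of_type_algebra\<^esub> z = - z" for z :: "poly3 fract"
    by (rule F.minus_equality) (auto simp: ring_of_type_algebra_def)
  have "subring (regular v) (ring_of_type_algebra :: poly3 fract ring)"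
    by (rule F.subringI)
       (auto simp: minus regular_uminus,
        auto simp: ring_of_type_algebra_def regular_1 regular_mult regular_add)
  then have "cring ((ring_of_type_algebra :: poly3 fract ring)\<lparr>carrier := regular v\<rparr>)"
    using F.subcring_iff F.subcringI' by (auto simp: ring_of_type_algebra_def)
  moreover have "(ring_of_type_algebra :: poly3 fract ring)\<lparr>carrier := regular v\<rparr> = local_ring (line_through v)"
    using carrier_local_ring[of v] by (simp add: local_ring_def)
  ultimately show ?thesis by simp
qed

context
  fixes I :: "poly3 set" and v :: "complex^3"
  assumes I: "poly_ideal I"
begin

abbreviation (input) stalk where "stalk \<equiv> ideal_stalk I (line_through v)"

lemma stalk_regular: "z \<in> stalk \<Longrightarrow> z \<in> regular v"
  by (auto simp: ideal_stalk_iff[OF I] regular_def)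

lemma stalk_mult:
  assumes "z \<in> stalk" "w \<in> regular v"
  shows "w * z \<in> stalk"
proof -
  obtain f g d f' g' d' where "z = Fract f g" "w = Fract f' g'" "homogeneous d f" "homogeneous d g"
    "poly3_eval g v \<noteq> 0" "homogeneous d' f'" "homogeneous d' g'" "poly3_eval g' v \<noteq> 0" "locally_in I v f"
    using assms unfolding ideal_stalk_iff[OF I] regular_def by blast
  then show ?thesis
    using Fract_in_stalk_iff[OF I, of "d' + d" "f' * f" "g' * g" v]
    by (simp add: homogeneous_mult locally_in_mult[OF I])
qed

lemma stalk_add:
  assumes "z \<in> stalk" "w \<in> stalk"
  shows "z + w \<in> stalk"
proof -
  obtain f g d f' g' d' where *: "z = Fract f g" "w = Fract f' g'" "homogeneous d f" "homogeneous d g"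
    "poly3_eval g v \<noteq> 0" "homogeneous d' f'" "homogeneous d' g'" "poly3_eval g' v \<noteq> 0"
    "locally_in I v f" "locally_in I v f'"
    using assms unfolding ideal_stalk_iff[OF I] by blast
  have "homogeneous (d + d') (f * g')" "homogeneous (d + d') (f' * g)" "homogeneous (d + d') (g * g')"
    using * homogeneous_mult[of d' f' d g] homogeneous_mult[of d f d' g'] homogeneous_mult[of d g d' g']
    by (auto simp: add.commute)
  moreover have "locally_in I v (f * g')" "locally_in I v (f' * g)"
    using * locally_in_mult[OF I] by (metis mult.commute)+
  ultimately show ?thesis
    using * Fract_in_stalk_iff[OF I, of "d + d'" "f * g' + f' * g" "g * g'" v]
    by (simp add: not_vanishing_nonzero homogeneous_add locally_in_add[OF I])
qed

lemma stalk_zero: "0 \<in> stalk"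
  using Fract_in_stalk_iff[OF I, of 0 0 1 v] locally_in_member[OF poly_ideal_zero[OF I]]
  by (simp add: Zero_fract_def)

lemma stalk_uminus: "z \<in> stalk \<Longrightarrow> - z \<in> stalk"
  using stalk_mult[of z "- 1"] regular_uminus[OF regular_1] by simp

lemma ideal_stalk: "ideal stalk (local_ring (line_through v))"
proof -
  interpret cring "local_ring (line_through v)" by (rule cring_local_ring)
  have "\<ominus>\<^bsub>local_ring (line_through v)\<^esub> z = - z" if "z \<in> regular v" for z
    by (rule minus_equality) (use that regular_uminus in auto)
  then have "subgroup stalk (add_monoid (local_ring (line_through v)))"
    using stalk_zero
    by (intro add.subgroupI) (auto simp: stalk_regular stalk_add stalk_uminus)
  then show ?thesis
    using stalk_mult by (intro idealI ring_axioms) (auto simp: mult.commute)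
qed

abbreviation (input) residue where "residue z \<equiv> stalk +>\<^bsub>local_ring (line_through v)\<^esub> z"

lemma residue_eq_iff:
  assumes "z \<in> regular v" "w \<in> regular v"
  shows "residue z = residue w \<longleftrightarrow> z - w \<in> stalk"
proof -
  interpret cring "local_ring (line_through v)" by (rule cring_local_ring)
  have "\<ominus>\<^bsub>local_ring (line_through v)\<^esub> w = - w"
    by (rule minus_equality) (use assms regular_uminus in auto)
  then have "z \<ominus>\<^bsub>local_ring (line_through v)\<^esub> w = z - w"
    by (simp add: a_minus_def)
  then show ?thesis
    using quotient_eq_iff_same_a_r_cos[OF ideal_stalk, of z w] assms by simp
qed

lemma local_algebra_simps:
  shows "carrier (local_algebra I (line_through v)) = residue ` regular v"
    and "\<zero>\<^bsub>local_algebra I (line_through v)\<^esub> = residue 0"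
    and "\<one>\<^bsub>local_algebra I (line_through v)\<^esub> = residue 1"
    and "z \<in> regular v \<Longrightarrow> w \<in> regular v \<Longrightarrow>
      residue z \<oplus>\<^bsub>local_algebra I (line_through v)\<^esub> residue w = residue (z + w)"
    and "z \<in> regular v \<Longrightarrow> w \<in> regular v \<Longrightarrow>
      residue z \<otimes>\<^bsub>local_algebra I (line_through v)\<^esub> residue w = residue (z * w)"
proof -
  interpret ideal stalk "local_ring (line_through v)" by (rule ideal_stalk)
  show "carrier (local_algebra I (line_through v)) = residue ` regular v"
    by (auto simp: local_algebra_def FactRing_def A_RCOSETS_def')
  show "\<zero>\<^bsub>local_algebra I (line_through v)\<^esub> = residue 0"
    using a_rcos_const[of 0] stalk_zero by (simp add: local_algebra_def FactRing_def)
  show "\<one>\<^bsub>local_algebra I (line_through v)\<^esub> = residue 1"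
    by (simp add: local_algebra_def FactRing_def)
  show "residue z \<oplus>\<^bsub>local_algebra I (line_through v)\<^esub> residue w = residue (z + w)"
    if "z \<in> regular v" "w \<in> regular v"
    using a_rcos_sum[of z w] that by (simp add: local_algebra_def FactRing_def)
  show "residue z \<otimes>\<^bsub>local_algebra I (line_through v)\<^esub> residue w = residue (z * w)"
    if "z \<in> regular v" "w \<in> regular v"
    using rcoset_mult_add[of z w] that by (simp add: local_algebra_def FactRing_def)
qed

text \<open>
  The residues \<open>E k\<close> with \<open>k \<in> M\<close> span the local algebra over the complex numbers, so the
  coefficient vectors give a surjection from a space of dimension \<open>card M\<close>. The preimages of a
  strict chain of ideals form a strict chain of linear subspaces, because ideals are stable
  under multiplication by constants.
\<close>
lemma ring_length_local_algebra_le: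
  fixes E :: "3 \<Rightarrow> poly3 fract" and M :: "3 set"
  assumes E: "\<And>k. E k \<in> regular v"
    and spanning: "\<And>z. z \<in> regular v \<Longrightarrow> \<exists>c::complex^3. (\<forall>k. k \<notin> M \<longrightarrow> c $ k = 0) \<and>
          z - (\<Sum>k\<in>UNIV. Fract (Const (c $ k)) 1 * E k) \<in> stalk"
  shows "ring_length (local_algebra I (line_through v)) \<le> enat (card M)"
  unfolding ring_length_def
proof (rule SUP_least, clarify)
  let ?R = "local_algebra I (line_through v)"
  fix n J assume J: "\<forall>i\<le>n. ideal (J i) ?R" "\<forall>i<n. J i \<subset> J (Suc i)"
  define comb where "comb c = (\<Sum>k\<in>UNIV. Fract (Const (c $ k)) 1 * E k)" for c :: "complex^3"
  define S where "S i = {c. (\<forall>k. k \<notin> M \<longrightarrow> c $ k = 0) \<and> residue (comb c) \<in> J i}" for i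
  have comb: "comb c \<in> regular v" for c
    unfolding comb_def by (intro regular_sum regular_mult regular_Const E)
  have comb_add: "comb (c + d) = comb c + comb d" for c d
  proof -
    have "Fract (Const (a + b)) 1 = Fract (Const a) 1 + Fract (Const b) 1" for a b
      by (simp add: Const_add)
    then show ?thesis by (simp only: comb_def vector_add_component distrib_right sum.distrib)
  qed
  have comb_scale: "comb (a *s c) = Fract (Const a) 1 * comb c" for a c
  proof -
    have "Fract (Const (a * b)) 1 = Fract (Const a) 1 * Fract (Const b) 1" for b
      by (simp add: Const_mult)
    then show ?thesis by (simp only: comb_def vector_smult_component sum_distrib_left mult.assoc)
  qed
  have subspace: "vec.subspace (S i)" if "i \<le> n" for i
  proof -
    interpret ideal "J i" ?R using J that by blast
    have "comb 0 = 0" using comb_scale[of 0 0] by (simp add: Const_0 Zero_fract_def[symmetric])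
    then have "0 \<in> S i"
      using additive_subgroup.zero_closed[OF additive_subgroup_axioms]
      by (simp add: S_def local_algebra_simps(2))
    moreover have "c + d \<in> S i" if "c \<in> S i" "d \<in> S i" for c d
    proof -
      have "residue (comb c) \<in> J i" "residue (comb d) \<in> J i"
        using that unfolding S_def by blast+
      then have "residue (comb c + comb d) \<in> J i"
        by (rule additive_subgroup.a_closed[OF additive_subgroup_axioms,
              of "residue (comb c)" "residue (comb d)", unfolded local_algebra_simps(4)[OF comb comb]])
      then show ?thesis using that by (simp add: S_def comb_add)
    qed
    moreover have "a *s c \<in> S i" if "c \<in> S i" for a c
    proof -
      have "residue (comb c) \<in> J i"
        using that unfolding S_def by blast
      moreover have "residue (Fract (Const a) 1) \<in> carrier ?R"
        unfolding local_algebra_simps(1) by (rule imageI) (rule regular_Const)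
      ultimately have "residue (Fract (Const a) 1 * comb c) \<in> J i"
        by (rule I_l_closed[of "residue (comb c)" "residue (Fract (Const a) 1)",
              unfolded local_algebra_simps(5)[OF regular_Const comb]])
      then show ?thesis using that by (simp add: S_def comb_scale)
    qed
    ultimately show ?thesis by (intro vec.subspaceI)
  qed
  have psubset: "S i \<subset> S (Suc i)" if "i < n" for i
  proof -
    have step: "J i \<subset> J (Suc i)" using J(2) that by simp
    then have "J i \<subseteq> J (Suc i)" by (rule psubset_imp_subset)
    then have sub: "S i \<subseteq> S (Suc i)" unfolding S_def by blast
    from step obtain x where x: "x \<in> J (Suc i)" "x \<notin> J i" by blast
    have "ideal (J (Suc i)) ?R" using J(1) that by simp
    then have "J (Suc i) \<subseteq> carrier ?R"
      by (intro additive_subgroup.a_subset ideal.axioms(1))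
    then have "x \<in> carrier ?R" using x(1) by (rule subsetD)
    then obtain z where z: "z \<in> regular v" "x = residue z"
      unfolding local_algebra_simps(1) by blast
    obtain c where c: "\<forall>k. k \<notin> M \<longrightarrow> c $ k = 0" "z - comb c \<in> stalk"
      using spanning[OF z(1)] unfolding comb_def by blast
    have "x = residue (comb c)"
      unfolding z(2) by (rule iffD2[OF residue_eq_iff[OF z(1) comb] c(2)])
    then have "c \<in> S (Suc i)" "c \<notin> S i"
      using c(1) x unfolding S_def by simp_all
    then show ?thesis using sub by blast
  qed
  have "i \<le> vec.dim (S i)" if "i \<le> n" for i
    using that
  proof (induction i)
    case (Suc i)
    have "vec.dim (S i) < vec.dim (S (Suc i))"
    proof (rule vec.dim_psubset)
      have span: "vec.span (S i) = S i" "vec.span (S (Suc i)) = S (Suc i)"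
        using subspace[of i] subspace[of "Suc i"] Suc.prems vec.span_eq_iff by auto
      show "vec.span (S i) \<subset> vec.span (S (Suc i))"
        unfolding span using psubset[of i] Suc.prems by simp
    qed
    then show ?case using Suc by simp
  qed simp
  then have "n \<le> vec.dim (S n)" by simp
  also have "\<dots> \<le> vec.dim {c::complex^3. \<forall>k. k \<notin> M \<longrightarrow> c $ k = 0}"
    by (intro vec.dim_subset) (auto simp: S_def)
  also have "\<dots> = card M" by (rule dim_substandard_cart)
  finally show "enat n \<le> enat (card M)" by simp
qed

end

section \<open>Curvilinear points\<close>

abbreviation epsilon :: "complex poly"  ("\<epsilon>") where "\<epsilon> \<equiv> [:0, 1:]"

lemma eps_ideal_iff: "eps_ideal m = {P. \<epsilon> ^ m dvd P}"
proof -
  interpret cring "ring_of_type_algebra :: complex poly ring" by (rule cring_from_type_algebra)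
  show ?thesis
    unfolding eps_ideal_def
    by (subst cgenideal_eq_genideal[symmetric])
       (auto simp: cgenideal_def ring_of_type_algebra_def dvd_def mult.commute)
qed

abbreviation truncation :: "nat \<Rightarrow> complex poly \<Rightarrow> complex poly set" where
  "truncation m P \<equiv> a_r_coset ring_of_type_algebra (eps_ideal m) P"

lemma ideal_eps: "ideal (eps_ideal m) ring_of_type_algebra"
proof -
  interpret cring "ring_of_type_algebra :: complex poly ring" by (rule cring_from_type_algebra)
  show ?thesis unfolding eps_ideal_def by (rule genideal_ideal) (simp add: ring_of_type_algebra_def)
qed

lemma truncation_eq_iff: "truncation m P = truncation m Q \<longleftrightarrow> \<epsilon> ^ m dvd P - Q"
proof -
  interpret cring "ring_of_type_algebra :: complex poly ring" by (rule cring_from_type_algebra)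
  have "\<ominus>\<^bsub>ring_of_type_algebra\<^esub> Q = - Q"
    by (rule minus_equality) (auto simp: ring_of_type_algebra_def)
  then have "P \<ominus>\<^bsub>ring_of_type_algebra\<^esub> Q = P - Q"
    by (simp add: a_minus_def) (simp add: ring_of_type_algebra_def)
  then show ?thesis
    using quotient_eq_iff_same_a_r_cos[OF ideal_eps, of P Q m]
    by (simp add: ring_of_type_algebra_def eps_ideal_iff)
qed

lemma truncated_poly_ring_simps:
  shows "carrier (truncated_poly_ring m) = range (truncation m)"
    and "\<zero>\<^bsub>truncated_poly_ring m\<^esub> = truncation m 0"
    and "\<one>\<^bsub>truncated_poly_ring m\<^esub> = truncation m 1"
    and "truncation m P \<oplus>\<^bsub>truncated_poly_ring m\<^esub> truncation m Q = truncation m (P + Q)"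
    and "truncation m P \<otimes>\<^bsub>truncated_poly_ring m\<^esub> truncation m Q = truncation m (P * Q)"
proof -
  interpret ideal "eps_ideal m" "ring_of_type_algebra :: complex poly ring" by (rule ideal_eps)
  note simps = ring_of_type_algebra_def[where 'a = "complex poly"]
  have 0: "0 \<in> eps_ideal m" by (simp add: eps_ideal_iff)
  show "carrier (truncated_poly_ring m) = range (truncation m)"
    by (auto simp: truncated_poly_ring_def FactRing_def A_RCOSETS_def') (auto simp: simps)
  show "\<zero>\<^bsub>truncated_poly_ring m\<^esub> = truncation m 0"
    using a_rcos_const[OF 0] by (simp add: truncated_poly_ring_def FactRing_def)
  show "\<one>\<^bsub>truncated_poly_ring m\<^esub> = truncation m 1"
    by (simp add: truncated_poly_ring_def FactRing_def) (simp add: simps)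
  show "truncation m P \<oplus>\<^bsub>truncated_poly_ring m\<^esub> truncation m Q = truncation m (P + Q)"
    using a_rcos_sum[of P Q] by (simp add: truncated_poly_ring_def FactRing_def simps)
  show "truncation m P \<otimes>\<^bsub>truncated_poly_ring m\<^esub> truncation m Q = truncation m (P * Q)"
    using rcoset_mult_add[of P Q] by (simp add: truncated_poly_ring_def FactRing_def simps)
qed

text \<open>
  The graph of a surjective algebra homomorphism from the local ring to the polynomials modulo
  \<open>\<epsilon> ^ m\<close> whose kernel is the stalk. A relation with polynomial values avoids cosets on both
  sides, and determines \<open>P\<close> only modulo \<open>\<epsilon> ^ m\<close>.
\<close>
definition jet_presentation where
  "jet_presentation m I v R \<longleftrightarrow>
     (\<forall>z\<in>regular v. \<exists>P. R z P) \<and>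
     (\<forall>P. \<exists>z\<in>regular v. R z P) \<and>
     (\<forall>z\<in>regular v. \<forall>w\<in>regular v. \<forall>P Q. R z P \<longrightarrow> R w Q \<longrightarrow> R (z + w) (P + Q) \<and> R (z * w) (P * Q)) \<and>
     (\<forall>c. R (Fract (Const c) 1) [:c:]) \<and>
     (\<forall>z\<in>regular v. \<forall>P. R z P \<longrightarrow> (z \<in> ideal_stalk I (line_through v) \<longleftrightarrow> \<epsilon> ^ m dvd P))"

lemma jet_presentation_unique:
  assumes R: "jet_presentation m I v R" and I: "poly_ideal I"
    and z: "z \<in> regular v" "R z P" "R z Q"
  shows "\<epsilon> ^ m dvd P - Q"
proof -
  have c: "R (Fract (Const (- 1)) 1) [:- 1:]" using R by (simp add: jet_presentation_def)
  have "R (Fract (Const (- 1)) 1 * z) ([:- 1:] * Q)"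
    using R z c regular_Const unfolding jet_presentation_def by blast
  then have "R (z + Fract (Const (- 1)) 1 * z) (P + [:- 1:] * Q)"
    using R z regular_mult[OF regular_Const z(1)] unfolding jet_presentation_def by blast
  then have "R 0 (P - Q)" by (simp add: Fract_Const_uminus_1)
  then show ?thesis
    using R regular_0 stalk_zero[OF I] unfolding jet_presentation_def by blast
qed

text \<open>
  From left to right the relation is read off from the isomorphism of quotients; from right to
  left the relation induces a homomorphism of rings, and the isomorphism theorem applies.
\<close>
lemma curvilinear_at_iff:
  assumes I: "poly_ideal I"
  shows "curvilinear_at m I (line_through v) \<longleftrightarrow> (\<exists>R. jet_presentation m I v R)"
proof
  let ?A = "local_algebra I (line_through v)" and ?T = "truncated_poly_ring m"
  let ?res = "\<lambda>z. ideal_stalk I (line_through v) +>\<^bsub>local_ring (line_through v)\<^esub> z"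
  assume "curvilinear_at m I (line_through v)"
  then obtain h where h: "h \<in> ring_hom ?A ?T" "bij_betw h (carrier ?A) (carrier ?T)"
    and c: "\<And>c. h (?res (Fract (Const c) 1)) = truncation m [:c:]"
    by (auto simp: curvilinear_at_def ring_iso_def)
  define R where "R z P \<longleftrightarrow> h (?res z) = truncation m P" for z P
  have res: "?res z \<in> carrier ?A" if "z \<in> regular v" for z
    using that by (auto simp: local_algebra_simps(1)[OF I])
  have "\<exists>P. R z P" if "z \<in> regular v" for z
    using ring_hom_closed[OF h(1) res[OF that]] by (auto simp: R_def truncated_poly_ring_simps(1))
  moreover have "\<exists>z\<in>regular v. R z P" for P
  proof -
    have "truncation m P \<in> h ` carrier ?A"
      using h(2) by (auto simp: bij_betw_def truncated_poly_ring_simps(1))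
    then show ?thesis by (auto simp: R_def local_algebra_simps(1)[OF I])
  qed
  moreover have "R (z + w) (P + Q)" "R (z * w) (P * Q)"
    if "z \<in> regular v" "w \<in> regular v" "R z P" "R w Q" for z w P Q
    using ring_hom_add[OF h(1) res[OF that(1)] res[OF that(2)]]
      ring_hom_mult[OF h(1) res[OF that(1)] res[OF that(2)]] that
    by (auto simp: R_def local_algebra_simps[OF I] truncated_poly_ring_simps)
  moreover have "z \<in> ideal_stalk I (line_through v) \<longleftrightarrow> \<epsilon> ^ m dvd P" if "z \<in> regular v" "R z P" for z P
  proof -
    have 0: "h (?res 0) = truncation m 0"
      using c[of 0] by (simp add: Const_0 Zero_fract_def)
    have "z \<in> ideal_stalk I (line_through v) \<longleftrightarrow> ?res z = ?res 0"
      using residue_eq_iff[OF I that(1) regular_0] by simp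
    also have "\<dots> \<longleftrightarrow> h (?res z) = h (?res 0)"
      using h(2) res[OF that(1)] res[OF regular_0] by (metis bij_betw_def inj_on_def)
    also have "\<dots> \<longleftrightarrow> \<epsilon> ^ m dvd P"
      using that 0 truncation_eq_iff[of m P 0] by (simp add: R_def)
    finally show ?thesis .
  qed
  ultimately have "jet_presentation m I v R"
    using c by (auto simp: jet_presentation_def R_def)
  then show "\<exists>R. jet_presentation m I v R" by (rule exI[of _ R])
next
  let ?O = "local_ring (line_through v)" and ?T = "truncated_poly_ring m"
  assume "\<exists>R. jet_presentation m I v R"
  then obtain R where R: "jet_presentation m I v R" ..
  define H where "H z = truncation m (SOME P. R z P)" for z
  have H: "H z = truncation m P" if "z \<in> regular v" "R z P" for z P
    unfolding H_def truncation_eq_iff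
    using jet_presentation_unique[OF R I that(1) _ that(2)] someI[of "R z" P] that(2) by blast
  have ex: "\<exists>P. R z P" if "z \<in> regular v" for z
    using R that by (simp add: jet_presentation_def)
  have ops: "R (z + w) (P + Q)" "R (z * w) (P * Q)"
    if "z \<in> regular v" "w \<in> regular v" "R z P" "R w Q" for z w P Q
    using R that by (simp_all add: jet_presentation_def)
  have constants: "R (Fract (Const c) 1) [:c:]" for c
    using R by (simp add: jet_presentation_def)
  interpret O: cring ?O by (rule cring_local_ring)
  have T: "ring ?T"
    unfolding truncated_poly_ring_def by (rule ideal.quotient_is_ring[OF ideal_eps])
  interpret hom: ring_hom_ring ?O ?T H
  proof (rule ring_hom_ringI[OF O.ring_axioms T])
    fix z assume "z \<in> carrier ?O"
    then show "H z \<in> carrier ?T" by (simp add: H_def truncated_poly_ring_simps(1))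
  next
    fix z w assume zw: "z \<in> carrier ?O" "w \<in> carrier ?O"
    then have zw': "z \<in> regular v" "w \<in> regular v" by simp_all
    obtain P where "R z P" using ex[OF zw'(1)] by (rule exE)
    moreover obtain Q where "R w Q" using ex[OF zw'(2)] by (rule exE)
    ultimately show "H (z \<otimes>\<^bsub>?O\<^esub> w) = H z \<otimes>\<^bsub>?T\<^esub> H w" "H (z \<oplus>\<^bsub>?O\<^esub> w) = H z \<oplus>\<^bsub>?T\<^esub> H w"
      using zw' ops[of z w P Q] H[of z P] H[of w Q] H[of "z * w" "P * Q"] H[of "z + w" "P + Q"]
      by (simp_all add: truncated_poly_ring_simps regular_add regular_mult)
  next
    show "H \<one>\<^bsub>?O\<^esub> = \<one>\<^bsub>?T\<^esub>"
      using H[OF regular_Const constants, of 1]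
      by (simp add: Const_1 One_fract_def truncated_poly_ring_simps one_pCons)
  qed
  have kernel: "a_kernel ?O ?T H = ideal_stalk I (line_through v)"
  proof -
    have "H z = \<zero>\<^bsub>?T\<^esub> \<longleftrightarrow> z \<in> ideal_stalk I (line_through v)" if "z \<in> regular v" for z
    proof -
      obtain P where P: "R z P" using ex[OF \<open>z \<in> regular v\<close>] by (rule exE)
      have "H z = \<zero>\<^bsub>?T\<^esub> \<longleftrightarrow> \<epsilon> ^ m dvd P"
        using H[OF that P] truncation_eq_iff[of m P 0] by (simp add: truncated_poly_ring_simps)
      then show ?thesis using R that P by (simp add: jet_presentation_def)
    qed
    then show ?thesis
      using stalk_regular[OF I] unfolding a_kernel_def' local_ring_simps by blast
  qed
  have surj: "H ` carrier ?O = carrier ?T"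
  proof
    show "carrier ?T \<subseteq> H ` carrier ?O"
    proof
      fix x assume "x \<in> carrier ?T"
      then obtain P where P: "x = truncation m P" by (auto simp: truncated_poly_ring_simps(1))
      have "\<exists>z\<in>regular v. R z P" using R by (simp add: jet_presentation_def)
      then obtain z where z: "z \<in> regular v" "R z P" by (rule bexE)
      then show "x \<in> H ` carrier ?O"
        unfolding P H[OF z, symmetric] local_ring_simps by (intro imageI)
    qed
  qed (use hom.hom_closed in blast)
  have "(\<lambda>Y. the_elem (H ` Y)) \<in> ring_iso (local_algebra I (line_through v)) ?T"
    using hom.FactRing_iso_set[OF surj] by (simp add: kernel local_algebra_def)
  moreover have "the_elem (H ` (ideal_stalk I (line_through v) +>\<^bsub>?O\<^esub> Fract (Const c) 1)) = truncation m [:c:]" for c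
    using hom.the_elem_simp[of "Fract (Const c) 1"] regular_Const H[OF regular_Const constants]
    by (simp add: kernel)
  ultimately show "curvilinear_at m I (line_through v)"
    unfolding curvilinear_at_def by (intro bexI[of _ "\<lambda>Y. the_elem (H ` Y)"]) auto
qed

section \<open>Jets along arcs\<close>

lemma eval_dvd_epsilon: "poly P 0 = 0 \<longleftrightarrow> \<epsilon> dvd P"
  using poly_eq_0_iff_dvd[of P 0] by simp

text \<open>
  After scaling, the constant term of \<open>Q\<close> is one, and the inverse is a partial sum of the
  geometric series.
\<close>
lemma inverse_mod_power:
  assumes "poly Q 0 \<noteq> 0"
  shows "\<exists>S. \<epsilon> ^ m dvd Q * S - 1"
proof -
  let ?c = "poly Q 0"
  \<comment> \<open>A multiple of \<open>\<epsilon>\<close>, so that its \<open>m\<close>-th power vanishes.\<close>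
  define Y where "Y = 1 - Polynomial.smult (1 / ?c) Q"
  have "poly Y 0 = 0" using assms by (simp add: Y_def)
  then have "\<epsilon> ^ m dvd Y ^ m" by (intro dvd_power_same) (simp add: eval_dvd_epsilon)
  moreover have "Q * Polynomial.smult (1 / ?c) (\<Sum>i<m. Y ^ i) = (1 - Y) * (\<Sum>i<m. Y ^ i)"
    by (simp add: Y_def)
  then have "Q * Polynomial.smult (1 / ?c) (\<Sum>i<m. Y ^ i) = 1 - Y ^ m"
    by (simp only: one_diff_power_eq)
  ultimately have "\<epsilon> ^ m dvd Q * Polynomial.smult (1 / ?c) (\<Sum>i<m. Y ^ i) - 1" by simp
  then show ?thesis by blast
qed

lemma cancel_mod_power:
  assumes "poly Q 0 \<noteq> 0" "\<epsilon> ^ m dvd Q * P"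
  shows "\<epsilon> ^ m dvd P"
proof -
  obtain S where "\<epsilon> ^ m dvd Q * S - 1" using inverse_mod_power[OF assms(1)] by blast
  from dvd_diff[OF dvd_mult[OF assms(2), of S] dvd_mult[OF this, of P]]
  have "\<epsilon> ^ m dvd S * (Q * P) - P * (Q * S - 1)" .
  then show ?thesis by (simp add: algebra_simps)
qed

lemma cut_power:
  fixes P :: "complex poly"
  shows "\<epsilon> ^ m dvd P - (\<Sum>i<m. [:Polynomial.coeff P i:] * \<epsilon> ^ i)"
proof (induction m arbitrary: P)
  case (Suc m)
  obtain a Q where P: "P = pCons a Q" by (cases P)
  have "(\<Sum>i<Suc m. [:Polynomial.coeff P i:] * \<epsilon> ^ i) = [:a:] + \<epsilon> * (\<Sum>i<m. [:Polynomial.coeff Q i:] * \<epsilon> ^ i)"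
    unfolding sum.lessThan_Suc_shift by (simp add: P sum_distrib_left mult_ac)
  moreover have "P = [:a:] + \<epsilon> * Q" by (simp add: P)
  ultimately have "P - (\<Sum>i<Suc m. [:Polynomial.coeff P i:] * \<epsilon> ^ i) = \<epsilon> * (Q - (\<Sum>i<m. [:Polynomial.coeff Q i:] * \<epsilon> ^ i))"
    by (simp only: right_diff_distrib) (simp only: add_diff_add diff_self add_0)
  then show ?case using Suc.IH[of Q] by (simp del: mult_pCons_left)
qed simp

lemma epsilon_square_dvd_iff: "\<epsilon> ^ 2 dvd P \<longleftrightarrow> Polynomial.coeff P 0 = 0 \<and> Polynomial.coeff P 1 = 0"
proof
  assume "\<epsilon> ^ 2 dvd P"
  then obtain Q where "P = \<epsilon> * (\<epsilon> * Q)" by (auto simp: power2_eq_square mult.assoc elim!: dvdE)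
  then show "Polynomial.coeff P 0 = 0 \<and> Polynomial.coeff P 1 = 0" by simp
next
  assume "Polynomial.coeff P 0 = 0 \<and> Polynomial.coeff P 1 = 0"
  then show "\<epsilon> ^ 2 dvd P" using cut_power[of 2 P] by (simp add: numeral_2_eq_2)
qed

lemma epsilon_cube_dvd_iff: "\<epsilon> ^ 3 dvd P \<longleftrightarrow> Polynomial.coeff P 0 = 0 \<and> Polynomial.coeff P 1 = 0 \<and> Polynomial.coeff P 2 = 0"
proof
  assume "\<epsilon> ^ 3 dvd P"
  then obtain Q where "P = \<epsilon> * (\<epsilon> * (\<epsilon> * Q))" by (auto simp: power3_eq_cube mult.assoc elim!: dvdE)
  then show "Polynomial.coeff P 0 = 0 \<and> Polynomial.coeff P 1 = 0 \<and> Polynomial.coeff P 2 = 0" by (simp add: numeral_2_eq_2)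
next
  assume "Polynomial.coeff P 0 = 0 \<and> Polynomial.coeff P 1 = 0 \<and> Polynomial.coeff P 2 = 0"
  then show "\<epsilon> ^ 3 dvd P" using cut_power[of 3 P] by (simp add: numeral_3_eq_3 numeral_2_eq_2)
qed

lemmas along_simps [simp] = curve.evaluate_simps

text \<open>
  The Taylor expansion of a rational function along the arc \<open>\<gamma>\<close>, stated without inverting power
  series.
\<close>
definition expands :: "nat \<Rightarrow> (3 \<Rightarrow> complex poly) \<Rightarrow> poly3 fract \<Rightarrow> complex poly \<Rightarrow> bool" where
  "expands m \<gamma> z P \<longleftrightarrow> (\<exists>f k d. z = Fract f k \<and> homogeneous d f \<and> homogeneous d k \<and>
     poly (along \<gamma> k) 0 \<noteq> 0 \<and> \<epsilon> ^ m dvd along \<gamma> k * P - along \<gamma> f)"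

text \<open>
  Expansion along an arc is a homomorphism because the denominators are invertible modulo \<open>\<epsilon> ^
  m\<close>. It is surjective as soon as some quotient \<open>b / a\<close> of linear forms restricts to the
  parameter of the arc, since polynomials in this quotient realize all polynomials in \<open>\<epsilon>\<close>.
\<close>
lemma jet_presentation_expands:
  fixes v :: "complex^3"
  assumes I: "poly_ideal I"
    and v: "\<And>i. poly (\<gamma> i) 0 = v $ i"
    and unit: "homogeneous 1 a" "along \<gamma> a = 1"
    and parameter: "homogeneous 1 b" "along \<gamma> b = \<epsilon>"
    and loc: "\<And>d f. homogeneous d f \<Longrightarrow> locally_in I v f \<longleftrightarrow> \<epsilon> ^ m dvd along \<gamma> f"
  shows "jet_presentation m I v (expands m \<gamma>)"
proof -
  have start: "poly (along \<gamma> f) 0 = poly3_eval f v" for f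
  proof -
    have "(\<chi> i. poly (\<gamma> i) 0) = v" by (simp add: v vec_eq_iff)
    then show ?thesis by (simp add: poly_along)
  qed
  have total: "\<exists>P. expands m \<gamma> z P" if "z \<in> regular v" for z
  proof -
    obtain f k d where z: "z = Fract f k" "homogeneous d f" "homogeneous d k" "poly3_eval k v \<noteq> 0"
      using \<open>z \<in> regular v\<close> by (rule regularE)
    then obtain S where "\<epsilon> ^ m dvd along \<gamma> k * S - 1" using inverse_mod_power start by metis
    then have "\<epsilon> ^ m dvd along \<gamma> f * (along \<gamma> k * S - 1)" by (rule dvd_mult)
    then have "\<epsilon> ^ m dvd along \<gamma> k * (S * along \<gamma> f) - along \<gamma> f" by (simp add: algebra_simps)
    moreover have "poly (along \<gamma> k) 0 \<noteq> 0" using z start by simp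
    ultimately show ?thesis using z(1-3) unfolding expands_def by (intro exI conjI)
  qed
  have const_jet: "expands m \<gamma> (Fract (Const c) 1) [:c:]" for c
    unfolding expands_def by (intro exI[of _ "Const c"] exI[of _ 1] exI[of _ 0]) simp
  have ops: "expands m \<gamma> (z + w) (P + Q) \<and> expands m \<gamma> (z * w) (P * Q)"
    if zw: "expands m \<gamma> z P" "expands m \<gamma> w Q" for z w P Q
  proof -
    obtain f k d where z: "z = Fract f k" "homogeneous d f" "homogeneous d k"
      "poly (along \<gamma> k) 0 \<noteq> 0" "\<epsilon> ^ m dvd along \<gamma> k * P - along \<gamma> f"
      using zw(1) by (auto simp: expands_def)
    obtain f' k' d' where w: "w = Fract f' k'" "homogeneous d' f'" "homogeneous d' k'"
      "poly (along \<gamma> k') 0 \<noteq> 0" "\<epsilon> ^ m dvd along \<gamma> k' * Q - along \<gamma> f'"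
      using zw(2) by (auto simp: expands_def)
    have nz: "k \<noteq> 0" "k' \<noteq> 0" using z(4) w(4) by auto
    have hom: "homogeneous (d + d') (f * k')" "homogeneous (d + d') (f' * k)"
      "homogeneous (d + d') (k * k')" "homogeneous (d + d') (f * f')"
      using homogeneous_mult[OF z(2) w(3)] homogeneous_mult[OF w(2) z(3)] homogeneous_mult[OF z(3) w(3)]
        homogeneous_mult[OF z(2) w(2)] by (simp_all add: add.commute)
    have "\<epsilon> ^ m dvd along \<gamma> k' * (along \<gamma> k * P - along \<gamma> f) + along \<gamma> k * (along \<gamma> k' * Q - along \<gamma> f')"
      using z w by (intro dvd_add dvd_mult)
    then have "\<epsilon> ^ m dvd along \<gamma> (k * k') * (P + Q) - along \<gamma> (f * k' + f' * k)"
      by (simp add: algebra_simps)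
    moreover have "z + w = Fract (f * k' + f' * k) (k * k')" using z w nz by simp
    moreover have "poly (along \<gamma> (k * k')) 0 \<noteq> 0" using z w by simp
    ultimately have "expands m \<gamma> (z + w) (P + Q)"
      using homogeneous_add[OF hom(1,2)] hom(3) unfolding expands_def by (intro exI conjI)
    moreover have "expands m \<gamma> (z * w) (P * Q)"
    proof -
      have "\<epsilon> ^ m dvd along \<gamma> k' * Q * (along \<gamma> k * P - along \<gamma> f) + along \<gamma> f * (along \<gamma> k' * Q - along \<gamma> f')"
        using z w by (intro dvd_add dvd_mult)
      then have "\<epsilon> ^ m dvd along \<gamma> (k * k') * (P * Q) - along \<gamma> (f * f')"
        by (simp add: algebra_simps)
      moreover have "z * w = Fract (f * f') (k * k')" using z w by simp
      moreover have "poly (along \<gamma> (k * k')) 0 \<noteq> 0" using z w by simp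
      ultimately show ?thesis using hom(3,4) unfolding expands_def by (intro exI conjI)
    qed
    ultimately show ?thesis ..
  qed
  have surj: "\<exists>z\<in>regular v. expands m \<gamma> z P" for P
  proof (induction P rule: pCons_induct)
    case 0
    show ?case using const_jet[of 0] regular_Const[of 0 v] by (intro bexI[of _ "Fract (Const 0) 1"]) simp_all
  next
    case (pCons c P)
    then obtain z where z: "z \<in> regular v" "expands m \<gamma> z P" by blast
    have b: "expands m \<gamma> (Fract b a) \<epsilon>"
      unfolding expands_def using unit parameter by (intro exI[of _ b] exI[of _ a] exI[of _ 1]) simp
    have br: "Fract b a \<in> regular v"
      using unit parameter start[of a] by (intro regularI[of 1]) auto
    have "expands m \<gamma> (Fract (Const c) 1 + Fract b a * z) ([:c:] + \<epsilon> * P)"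
      by (rule conjunct1[OF ops[OF const_jet conjunct2[OF ops[OF b z(2)]]]])
    moreover have "Fract (Const c) 1 + Fract b a * z \<in> regular v"
      by (intro regular_add regular_mult regular_Const br z)
    moreover have "[:c:] + \<epsilon> * P = pCons c P" by simp
    ultimately show ?case by (intro bexI[of _ "Fract (Const c) 1 + Fract b a * z"]) simp_all
  qed
  have kernel: "z \<in> ideal_stalk I (line_through v) \<longleftrightarrow> \<epsilon> ^ m dvd P" if z: "expands m \<gamma> z P" for z P
  proof -
    obtain f k d where z: "z = Fract f k" "homogeneous d f" "homogeneous d k"
      "poly (along \<gamma> k) 0 \<noteq> 0" "\<epsilon> ^ m dvd along \<gamma> k * P - along \<gamma> f"
      using z by (auto simp: expands_def)
    have "z \<in> ideal_stalk I (line_through v) \<longleftrightarrow> \<epsilon> ^ m dvd along \<gamma> f"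
      unfolding z(1) loc[OF z(2), symmetric]
      using z(4) start by (intro Fract_in_stalk_iff[OF I z(2,3)]) simp
    also have "\<dots> \<longleftrightarrow> \<epsilon> ^ m dvd along \<gamma> k * P"
    proof
      assume "\<epsilon> ^ m dvd along \<gamma> f"
      from dvd_add[OF z(5) this] show "\<epsilon> ^ m dvd along \<gamma> k * P" by simp
    next
      assume "\<epsilon> ^ m dvd along \<gamma> k * P"
      from dvd_diff[OF this z(5)] show "\<epsilon> ^ m dvd along \<gamma> f" by simp
    qed
    also have "\<dots> \<longleftrightarrow> \<epsilon> ^ m dvd P"
      by (rule iffI[OF cancel_mod_power[OF z(4)] dvd_mult])
    finally show ?thesis .
  qed
  show ?thesis
    unfolding jet_presentation_def
  proof (intro conjI)
    show "\<forall>z\<in>regular v. \<exists>P. expands m \<gamma> z P" using total by (rule ballI)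
    show "\<forall>P. \<exists>z\<in>regular v. expands m \<gamma> z P" using surj by (rule allI)
    show "\<forall>z\<in>regular v. \<forall>w\<in>regular v. \<forall>P Q. expands m \<gamma> z P \<longrightarrow> expands m \<gamma> w Q \<longrightarrow>
        expands m \<gamma> (z + w) (P + Q) \<and> expands m \<gamma> (z * w) (P * Q)"
      by (intro ballI allI impI ops)
    show "\<forall>c. expands m \<gamma> (Fract (Const c) 1) [:c:]" using const_jet by (rule allI)
    show "\<forall>z\<in>regular v. \<forall>P. expands m \<gamma> z P \<longrightarrow>
        (z \<in> ideal_stalk I (line_through v) \<longleftrightarrow> \<epsilon> ^ m dvd P)"
      by (intro ballI allI impI kernel)
  qed
qed

section \<open>Local normal forms\<close>

text \<open>
  The arc \<open>(1 : \<epsilon> : 0)\<close> for \<open>k = 2\<close> and \<open>(1 : 0 : \<epsilon>)\<close> for \<open>k = 3\<close>.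
\<close>
definition tangent_arc :: "3 \<Rightarrow> 3 \<Rightarrow> complex poly" where
  "tangent_arc k i = (if i = 1 then 1 else if i = k then \<epsilon> else 0)"

text \<open>
  The arc \<open>(1 : \<epsilon>^2 : \<epsilon>)\<close>, a smooth branch of the conic \<open>st = u^2\<close>. Its jet of order three is
  not contained in a line.
\<close>
definition parabola :: "3 \<Rightarrow> complex poly" where
  "parabola i = (if i = 1 then 1 else if i = 2 then \<epsilon> ^ 2 else \<epsilon>)"

definition reduced_jet :: "3 \<Rightarrow> poly3 \<Rightarrow> bool" where
  "reduced_jet k f \<longleftrightarrow> poly3_eval f (axis k 1) = 0"

definition double_jet :: "poly3 \<Rightarrow> bool" where
  "double_jet f \<longleftrightarrow> \<epsilon> ^ 2 dvd along (tangent_arc 3) f"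

definition triple_jet :: "poly3 \<Rightarrow> bool" where
  "triple_jet f \<longleftrightarrow> \<epsilon> ^ 3 dvd along parabola f"

definition fat_jet :: "poly3 \<Rightarrow> bool" where
  "fat_jet f \<longleftrightarrow> \<epsilon> ^ 2 dvd along (tangent_arc 2) f \<and> \<epsilon> ^ 2 dvd along (tangent_arc 3) f"

text \<open>
  The forms in the stalk at the \<open>k\<close>-th coordinate point for the normal form of each type.
  Outside the support every form belongs to the stalk.
\<close>
fun normal_stalk :: "scheme_type \<Rightarrow> 3 \<Rightarrow> poly3 \<Rightarrow> bool" where
  "normal_stalk Empty k f \<longleftrightarrow> True"
| "normal_stalk One_Reduced k f \<longleftrightarrow> (k = 1 \<longrightarrow> reduced_jet 1 f)"
| "normal_stalk Two_Reduced k f \<longleftrightarrow> (k = 1 \<or> k = 2 \<longrightarrow> reduced_jet k f)"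
| "normal_stalk Three_Reduced k f \<longleftrightarrow> reduced_jet k f"
| "normal_stalk Double k f \<longleftrightarrow> (k = 1 \<longrightarrow> double_jet f)"
| "normal_stalk Double_Plus_Reduced k f \<longleftrightarrow> (k = 1 \<longrightarrow> double_jet f) \<and> (k = 2 \<longrightarrow> reduced_jet 2 f)"
| "normal_stalk Curvilinear_Triple k f \<longleftrightarrow> (k = 1 \<longrightarrow> triple_jet f)"
| "normal_stalk Fat_Point k f \<longleftrightarrow> (k = 1 \<longrightarrow> fat_jet f)"

text \<open>
  The coordinate change \<open>g\<close> is part of the description, so that statements about the given net
  and about the net in normal coordinates are instances of the same notion.
\<close>
definition standard :: "complex^3^3 \<Rightarrow> scheme_type \<Rightarrow> (3 \<Rightarrow> complex^3^3) \<Rightarrow> bool" where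
  "standard g \<tau> b \<longleftrightarrow>
     (\<forall>k d f. homogeneous d f \<longrightarrow>
        (locally_in (segre_section b) (g *v axis k 1) f \<longleftrightarrow> normal_stalk \<tau> k (change g f))) \<and>
     (\<forall>v. v \<noteq> 0 \<longrightarrow> (\<forall>k. v \<notin> line_through (g *v axis k 1)) \<longrightarrow> locally_in (segre_section b) v 1)"

lemma standard_reparametrize:
  assumes g: "invertible g" and std: "standard (mat 1) \<tau> (reparametrize g b)"
  shows "standard g \<tau> b"
  unfolding standard_def
proof (intro conjI allI impI)
  fix k d f assume f: "homogeneous d f"
  have "locally_in (segre_section b) (g *v axis k 1) f
      \<longleftrightarrow> locally_in (segre_section (reparametrize g b)) (axis k 1) (change g f)"
    using locally_in_change[OF g] by simp
  also have "\<dots> \<longleftrightarrow> normal_stalk \<tau> k (change g f)"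
    using std homogeneous_change[OF f, of g] by (simp add: standard_def)
  finally show "locally_in (segre_section b) (g *v axis k 1) f \<longleftrightarrow> normal_stalk \<tau> k (change g f)" .
next
  fix v :: "complex^3" assume v: "v \<noteq> 0" "\<forall>k. v \<notin> line_through (g *v axis k 1)"
  obtain h where h: "g ** h = mat 1" "h ** g = mat 1" using change_surj[OF g] by metis
  let ?w = "h *v v"
  have gw: "g *v ?w = v" by (simp add: matrix_vector_mul_assoc h)
  then have "?w \<noteq> 0" using v by auto
  moreover have "?w \<notin> line_through (axis k 1)" for k
  proof
    assume "?w \<in> line_through (axis k 1)"
    then obtain c where "?w = c *s axis k 1" by (auto simp: line_through_def)
    then have "v = c *s (g *v axis k 1)" using gw by (metis vector_scalar_commute)
    then show False using v(2) by (auto simp: line_through_def)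
  qed
  ultimately have "locally_in (segre_section (reparametrize g b)) ?w 1"
    using std by (simp add: standard_def)
  then show "locally_in (segre_section b) v 1"
    using locally_in_change[OF g, of b ?w 1] gw by simp
qed

lemma standard_same_scheme:
  assumes "standard (mat 1) \<tau> b" "standard (mat 1) \<tau> b'"
  shows "same_scheme (segre_section b) (segre_section b')"
  unfolding same_scheme_def
proof
  fix p :: "(complex^3) set" assume "p \<in> P2"
  then obtain v where v: "v \<noteq> 0" "p = line_through v" by (auto simp: P2_iff)
  have "locally_in (segre_section b) v f \<longleftrightarrow> locally_in (segre_section b') v f" if f: "homogeneous d f" for d f
  proof (cases "\<exists>k. v \<in> line_through (axis k 1)")
    case True
    then obtain k c where "v = c *s axis k 1" by (auto simp: line_through_def)
    moreover from this have "c \<noteq> 0" using v(1) by auto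
    ultimately show ?thesis using assms f by (simp add: locally_in_scale standard_def)
  next
    case False
    then have "locally_in (segre_section b) v 1" "locally_in (segre_section b') v 1"
      using assms v by (simp_all add: standard_def)
    then show ?thesis
      using locally_in_mult[OF poly_ideal_segre, of _ v 1 f] by simp
  qed
  then show "ideal_stalk (segre_section b) p = ideal_stalk (segre_section b') p"
    unfolding v(2) ideal_stalk_iff[OF poly_ideal_segre] by blast
qed

lemma prod_UNIV_3:
  fixes f :: "3 \<Rightarrow> 'a::comm_monoid_mult"
  shows "(\<Prod>i\<in>UNIV. f i) = f 1 * (f 2 * f 3)"
  unfolding UNIV_3 by simp

text \<open>
  A monomial other than a power of the first variable is divisible by one of the other two. In
  degree zero the cofactors must vanish, which truncated subtraction in the degree \<open>d - 1\<close> does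
  not express.
\<close>
lemma homogeneous_decomposition:
  assumes "homogeneous d f"
  obtains \<alpha> A B where "f = Const \<alpha> * Var 1 ^ d + Var 2 * A + Var 3 * B"
    "homogeneous (d - 1) A" "homogeneous (d - 1) B" "d = 0 \<Longrightarrow> A = 0 \<and> B = 0"
proof -
  define Q where "Q f \<longleftrightarrow> (\<exists>\<alpha> A B. f = Const \<alpha> * Var 1 ^ d + Var 2 * A + Var 3 * B \<and>
    homogeneous (d - 1) A \<and> homogeneous (d - 1) B \<and> (d = 0 \<longrightarrow> A = 0 \<and> B = 0))" for f
  have add: "Q (f + g)" if Q: "Q f" "Q g" for f g
  proof -
    obtain \<alpha> A B where f: "f = Const \<alpha> * Var 1 ^ d + Var 2 * A + Var 3 * B"
      "homogeneous (d - 1) A" "homogeneous (d - 1) B" "d = 0 \<longrightarrow> A = 0 \<and> B = 0"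
      using Q(1) unfolding Q_def by blast
    obtain \<beta> A' B' where g: "g = Const \<beta> * Var 1 ^ d + Var 2 * A' + Var 3 * B'"
      "homogeneous (d - 1) A'" "homogeneous (d - 1) B'" "d = 0 \<longrightarrow> A' = 0 \<and> B' = 0"
      using Q(2) unfolding Q_def by blast
    have "f + g = Const (\<alpha> + \<beta>) * Var 1 ^ d + Var 2 * (A + A') + Var 3 * (B + B')"
      unfolding f(1) g(1) Const_add by (simp add: algebra_simps)
    then show ?thesis
      unfolding Q_def using f(2-) g(2-)
      by (intro exI[of _ "\<alpha> + \<beta>"] exI[of _ "A + A'"] exI[of _ "B + B'"]) (simp add: homogeneous_add)
  qed
  have single: "Q (Poly_Mapping.single m c)" if m: "(\<Sum>i\<in>UNIV. Poly_Mapping.lookup m i) = d" for m c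
  proof -
    define p q r where "p = Poly_Mapping.lookup m 1" "q = Poly_Mapping.lookup m 2" "r = Poly_Mapping.lookup m 3"
    have d: "d = p + q + r" using m by (simp add: sum_3 p_q_r_def)
    have s: "Poly_Mapping.single m c = Const c * (Var 1 ^ p * Var 2 ^ q * Var 3 ^ r)"
      unfolding single_as_product prod_UNIV_3 by (simp add: p_q_r_def mult.assoc)
    have mono: "homogeneous (i + j + l) (Const c * (Var 1 ^ i * Var 2 ^ j * Var 3 ^ l))" for i j l
    proof -
      have "homogeneous n (Var k ^ n)" for n k
        using homogeneous_power[OF homogeneous_Var(1), of n k] by simp
      then show ?thesis by (intro homogeneous_mult_Const homogeneous_mult)
    qed
    consider (q) q' where "q = Suc q'" | (r) r' where "q = 0" "r = Suc r'" | (p) "q = 0" "r = 0"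
      using not0_implies_Suc[of q] not0_implies_Suc[of r] by blast
    then show ?thesis
    proof cases
      case q
      have "Poly_Mapping.single m c
          = Const 0 * Var 1 ^ d + Var 2 * (Const c * (Var 1 ^ p * Var 2 ^ q' * Var 3 ^ r)) + Var 3 * 0"
        unfolding s q by (simp add: Const_0 mult_ac)
      moreover have "d - 1 = p + q' + r" "d \<noteq> 0" using d q by simp_all
      ultimately show ?thesis
        unfolding Q_def using mono[of p q' r]
        by (intro exI[of _ 0] exI[of _ "Const c * (Var 1 ^ p * Var 2 ^ q' * Var 3 ^ r)"] exI[of _ 0] conjI)
           simp_all
    next
      case r
      have "Poly_Mapping.single m c
          = Const 0 * Var 1 ^ d + Var 2 * 0 + Var 3 * (Const c * (Var 1 ^ p * Var 2 ^ 0 * Var 3 ^ r'))"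
        unfolding s r by (simp add: Const_0 mult_ac)
      moreover have "d - 1 = p + 0 + r'" "d \<noteq> 0" using d r by simp_all
      ultimately show ?thesis
        unfolding Q_def using mono[of p 0 r']
        by (intro exI[of _ 0] exI[of _ 0] exI[of _ "Const c * (Var 1 ^ p * Var 2 ^ 0 * Var 3 ^ r')"] conjI)
           simp_all
    next
      case p
      have "Poly_Mapping.single m c = Const c * Var 1 ^ d + Var 2 * 0 + Var 3 * 0"
        unfolding s p d by simp
      then show ?thesis
        unfolding Q_def by (intro exI[of _ c] exI[of _ 0] conjI) simp_all
    qed
  qed
  have "Q (\<Sum>m\<in>S. Poly_Mapping.single m (Poly_Mapping.lookup f m))" if "S \<subseteq> Poly_Mapping.keys f" for S
    using finite_subset[OF that finite_keys] that
  proof (induction S rule: finite_induct)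
    case empty
    show ?case unfolding Q_def by (intro exI[of _ 0]) (simp add: Const_0)
  next
    case (insert m S)
    then show ?case
      using assms by (simp add: add single homogeneous_def)
  qed
  from this[OF order_refl] have "Q f" by (simp only: poly3_sum_of_terms[of f, symmetric])
  then obtain \<alpha> A B where "f = Const \<alpha> * Var 1 ^ d + Var 2 * A + Var 3 * B"
    "homogeneous (d - 1) A" "homogeneous (d - 1) B" "d = 0 \<longrightarrow> A = 0 \<and> B = 0"
    unfolding Q_def by (elim exE conjE)
  then show thesis using that by blast
qed

section \<open>Telling the local types apart\<close>

lemma ex_nonvanishing_form:
  assumes "v \<noteq> 0"
  obtains k where "homogeneous d k" "poly3_eval k v \<noteq> 0"
proof -
  obtain i where "v $ i \<noteq> 0" using assms by (auto simp: vec_eq_iff)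
  moreover have "homogeneous d (Var i ^ d)"
    using homogeneous_power[OF homogeneous_Var(1), of d i] by simp
  ultimately show thesis using that[of "Var i ^ d"] by simp
qed

lemma reduced_at_iff:
  assumes I: "poly_ideal I" and v: "v \<noteq> 0"
  shows "reduced_at I (line_through v) \<longleftrightarrow>
    (\<forall>d f. homogeneous d f \<longrightarrow> (locally_in I v f \<longleftrightarrow> poly3_eval f v = 0))"
proof
  assume *: "reduced_at I (line_through v)"
  show "\<forall>d f. homogeneous d f \<longrightarrow> (locally_in I v f \<longleftrightarrow> poly3_eval f v = 0)"
  proof (intro allI impI)
    fix d f assume f: "homogeneous d f"
    obtain k where k: "homogeneous d k" "poly3_eval k v \<noteq> 0" using ex_nonvanishing_form[OF v] .
    have "locally_in I v f \<longleftrightarrow> Fract f k \<in> maximal_ideal (line_through v)"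
      using Fract_in_stalk_iff[OF I f k] * by (simp add: reduced_at_def)
    also have "\<dots> \<longleftrightarrow> poly3_eval f v = 0"
    proof
      assume "Fract f k \<in> maximal_ideal (line_through v)"
      then obtain f' k' d' where *: "Fract f k = Fract f' k'" "poly3_eval f' v = 0" "poly3_eval k' v \<noteq> 0"
        by (auto simp: maximal_ideal_iff)
      then have "f * k' = f' * k" using k by (subst (asm) eq_fract) (auto simp: not_vanishing_nonzero)
      then have "poly3_eval (f * k') v = poly3_eval (f' * k) v" by simp
      then show "poly3_eval f v = 0" using * by simp
    qed (use f k in \<open>auto simp: maximal_ideal_iff\<close>)
    finally show "locally_in I v f \<longleftrightarrow> poly3_eval f v = 0" .
  qed
next
  assume "\<forall>d f. homogeneous d f \<longrightarrow> (locally_in I v f \<longleftrightarrow> poly3_eval f v = 0)"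
  then show "reduced_at I (line_through v)"
    unfolding reduced_at_def ideal_stalk_iff[OF I] maximal_ideal_iff by blast
qed

lemma
  assumes "jet_presentation m I v R"
  shows jet_presentation_total: "z \<in> regular v \<Longrightarrow> \<exists>P. R z P"
    and jet_presentation_surj: "\<exists>z\<in>regular v. R z P"
    and jet_presentation_add: "z \<in> regular v \<Longrightarrow> w \<in> regular v \<Longrightarrow> R z P \<Longrightarrow> R w Q \<Longrightarrow> R (z + w) (P + Q)"
    and jet_presentation_mult: "z \<in> regular v \<Longrightarrow> w \<in> regular v \<Longrightarrow> R z P \<Longrightarrow> R w Q \<Longrightarrow> R (z * w) (P * Q)"
    and jet_presentation_Const: "R (Fract (Const c) 1) [:c:]"
    and jet_presentation_kernel: "z \<in> regular v \<Longrightarrow> R z P \<Longrightarrow>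
      z \<in> ideal_stalk I (line_through v) \<longleftrightarrow> \<epsilon> ^ m dvd P"
  using assms by (simp_all add: jet_presentation_def)

lemma jet_presentation_power:
  assumes R: "jet_presentation m I v R" and z: "z \<in> regular v" "R z P"
  shows "R (z ^ n) (P ^ n)"
proof (induction n)
  case 0
  show ?case using jet_presentation_Const[OF R, of 1] by (simp add: Const_1 One_fract_def one_pCons)
next
  case (Suc n)
  show ?case
    unfolding power_Suc by (rule jet_presentation_mult[OF R z(1) regular_power[OF z(1)] z(2) Suc])
qed

lemma Fract_power: "Fract f k ^ n = Fract (f ^ n) (k ^ n)"
  by (induction n) (simp_all add: One_fract_def)

text \<open>
  A single relation controls all powers of \<open>f\<close>; nilpotency of residues is what distinguishes the
  types below.
\<close>
lemma jet_presentation_locally_in_power: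
  assumes R: "jet_presentation m I v R" and I: "poly_ideal I"
    and fk: "homogeneous d f" "homogeneous d k" "poly3_eval k v \<noteq> 0" and P: "R (Fract f k) P"
  shows "locally_in I v (f ^ n) \<longleftrightarrow> \<epsilon> ^ m dvd P ^ n"
proof -
  have reg: "Fract f k \<in> regular v" using fk by (rule regularI)
  have "poly3_eval (k ^ n) v \<noteq> 0" using fk(3) by simp
  then have "locally_in I v (f ^ n) \<longleftrightarrow> Fract f k ^ n \<in> ideal_stalk I (line_through v)"
    unfolding Fract_power
    by (rule Fract_in_stalk_iff[OF I homogeneous_power[OF fk(1)] homogeneous_power[OF fk(2)], symmetric])
  also have "\<dots> \<longleftrightarrow> \<epsilon> ^ m dvd P ^ n"
    by (rule jet_presentation_kernel[OF R regular_power[OF reg] jet_presentation_power[OF R reg P]])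
  finally show ?thesis .
qed

text \<open>
  The numerator of a preimage of \<open>\<epsilon>\<close>. Such a form does not exist at points where a smaller power
  of the maximal ideal lies in the stalk.
\<close>
lemma curvilinear_parameter:
  assumes "curvilinear_at (Suc m) I (line_through v)" and I: "poly_ideal I"
  obtains d f where "homogeneous d f" "locally_in I v (f ^ Suc m)" "\<not> locally_in I v (f ^ m)"
proof -
  obtain R where R: "jet_presentation (Suc m) I v R"
    using assms by (auto simp: curvilinear_at_iff)
  obtain z where z: "z \<in> regular v" "R z \<epsilon>" using jet_presentation_surj[OF R] by blast
  obtain f k d where f: "z = Fract f k" "homogeneous d f" "homogeneous d k" "poly3_eval k v \<noteq> 0"
    using z(1) by (rule regularE)
  have power: "locally_in I v (f ^ n) \<longleftrightarrow> \<epsilon> ^ Suc m dvd \<epsilon> ^ n" for n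
    using jet_presentation_locally_in_power[OF R I f(2,3,4)] z(2) f(1) by blast
  have "\<not> \<epsilon> ^ Suc m dvd \<epsilon> ^ m"
  proof
    assume "\<epsilon> ^ Suc m dvd \<epsilon> ^ m"
    then have "Polynomial.degree (\<epsilon> ^ Suc m) \<le> Polynomial.degree (\<epsilon> ^ m)"
      by (rule dvd_imp_degree_le) simp
    then show False by (simp add: degree_power_eq del: power_Suc)
  qed
  then have "\<not> locally_in I v (f ^ m)" unfolding power .
  moreover have "locally_in I v (f ^ Suc m)" unfolding power by (rule dvd_refl)
  ultimately show thesis using f(2) by (intro that)
qed

lemma vanishes_if_power_divisible:
  assumes "\<epsilon> ^ 2 dvd P ^ n"
  shows "poly P 0 = 0"
proof -
  have "\<epsilon> dvd \<epsilon> ^ 2" by (rule dvd_power) simp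
  then have "\<epsilon> dvd P ^ n" using assms by (rule dvd_trans)
  then have "poly (P ^ n) 0 = 0" unfolding eval_dvd_epsilon .
  then show ?thesis by simp
qed

lemma dvd_epsilon_square_product:
  "poly P 0 = 0 \<Longrightarrow> poly Q 0 = 0 \<Longrightarrow> \<epsilon> ^ 2 dvd P * Q"
  unfolding power2_eq_square eval_dvd_epsilon by (rule mult_dvd_mono)

text \<open>
  The nilpotent elements of \<open>\<complex>[\<epsilon>]/(\<epsilon>^2)\<close> are multiples of \<open>\<epsilon>\<close> and have square zero.
\<close>
lemma curvilinear_two_nilpotent:
  assumes "curvilinear_at 2 I (line_through v)" and I: "poly_ideal I" and v: "v \<noteq> 0"
    and f: "homogeneous d f" "locally_in I v (f ^ n)"
  shows "locally_in I v (f ^ 2)"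
proof -
  obtain R where R: "jet_presentation 2 I v R"
    using assms by (auto simp: curvilinear_at_iff)
  obtain k where k: "homogeneous d k" "poly3_eval k v \<noteq> 0" using ex_nonvanishing_form[OF v] .
  obtain P where P: "R (Fract f k) P"
    using jet_presentation_total[OF R regularI[OF f(1) k]] by blast
  note iff = jet_presentation_locally_in_power[OF R I f(1) k P]
  have "poly P 0 = 0" using f(2) unfolding iff by (rule vanishes_if_power_divisible)
  then show ?thesis unfolding iff power2_eq_square[of P] by (intro dvd_epsilon_square_product)
qed

text \<open>
  The nilpotent elements of \<open>\<complex>[\<epsilon>]/(\<epsilon>^2)\<close> form a space of dimension one; the coefficients come
  from the linear terms of the two expansions.
\<close>
lemma curvilinear_two_dependent:
  assumes "curvilinear_at 2 I (line_through v)" and I: "poly_ideal I" and v: "v \<noteq> 0"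
    and f: "homogeneous d f" "locally_in I v (f ^ n)" and g: "homogeneous d g" "locally_in I v (g ^ n)"
  obtains a b where "a \<noteq> 0 \<or> b \<noteq> 0" "locally_in I v (Const a * f + Const b * g)"
proof -
  obtain R where R: "jet_presentation 2 I v R"
    using assms by (auto simp: curvilinear_at_iff)
  obtain k where k: "homogeneous d k" "poly3_eval k v \<noteq> 0" using ex_nonvanishing_form[OF v] .
  have reg: "Fract f k \<in> regular v" "Fract g k \<in> regular v"
    using regularI[OF f(1) k] regularI[OF g(1) k] .
  obtain P where P: "R (Fract f k) P" using jet_presentation_total[OF R reg(1)] by blast
  obtain Q where Q: "R (Fract g k) Q" using jet_presentation_total[OF R reg(2)] by blast
  have "poly P 0 = 0"
    using f(2) unfolding jet_presentation_locally_in_power[OF R I f(1) k P] by (rule vanishes_if_power_divisible)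
  moreover have "poly Q 0 = 0"
    using g(2) unfolding jet_presentation_locally_in_power[OF R I g(1) k Q] by (rule vanishes_if_power_divisible)
  ultimately have PQ: "Polynomial.coeff P 0 = 0" "Polynomial.coeff Q 0 = 0" by (simp_all add: poly_0_coeff_0)
  have member: "locally_in I v (Const a * f + Const b * g)"
    if "a * Polynomial.coeff P 1 + b * Polynomial.coeff Q 1 = 0" for a b
  proof -
    let ?z = "Fract (Const a) 1 * Fract f k + Fract (Const b) 1 * Fract g k"
    have z: "?z \<in> regular v" by (intro regular_add regular_mult regular_Const reg)
    have "R ?z ([:a:] * P + [:b:] * Q)"
      by (intro jet_presentation_add[OF R] jet_presentation_mult[OF R] regular_mult regular_Const reg
          jet_presentation_Const[OF R] P Q)
    moreover have "\<epsilon> ^ 2 dvd [:a:] * P + [:b:] * Q"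
      unfolding epsilon_square_dvd_iff using PQ that by simp
    ultimately have "?z \<in> ideal_stalk I (line_through v)"
      using jet_presentation_kernel[OF R z] by blast
    moreover have "?z = Fract (Const a * f + Const b * g) k"
    proof -
      have "k \<noteq> 0" using k by auto
      then have "Fract (Const a * f) k + Fract (Const b * g) k = Fract (k * (Const a * f + Const b * g)) (k * k)"
        by (simp add: algebra_simps)
      also have "\<dots> = Fract (Const a * f + Const b * g) k"
        using \<open>k \<noteq> 0\<close> by (subst eq_fract) (simp_all add: algebra_simps)
      finally show ?thesis by simp
    qed
    moreover have "homogeneous d (Const a * f + Const b * g)"
      by (intro homogeneous_add homogeneous_mult_Const f g)
    ultimately show ?thesis using Fract_in_stalk_iff[OF I _ k] by metis
  qed
  show thesis
  proof (cases "Polynomial.coeff P 1 = 0 \<and> Polynomial.coeff Q 1 = 0")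
    case True
    then show thesis using that[of 1 0] member[of 1 0] by simp
  next
    case False
    then show thesis
      using that[of "Polynomial.coeff Q 1" "- Polynomial.coeff P 1"]
        member[of "Polynomial.coeff Q 1" "- Polynomial.coeff P 1"] by auto
  qed
qed

text \<open>
  Along any arc through the point a product of two functions that vanish there vanishes to order
  two.
\<close>
lemma square_of_maximal_ideal_tangent:
  fixes v :: "complex^3"
  assumes "Fract f k \<in> ideal_prod (local_ring (line_through v)) (maximal_ideal (line_through v)) (maximal_ideal (line_through v))"
    and k: "poly3_eval k v \<noteq> 0" and \<gamma>: "\<And>i. poly (\<gamma> i) 0 = v $ i"
  shows "\<epsilon> ^ 2 dvd along \<gamma> f"
proof -
  have start: "poly (along \<gamma> f) 0 = poly3_eval f v" for f
  proof -
    have "(\<chi> i. poly (\<gamma> i) 0) = v" by (simp add: \<gamma> vec_eq_iff)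
    then show ?thesis by (simp add: poly_along)
  qed
  have "\<exists>f k. z = Fract f k \<and> poly3_eval k v \<noteq> 0 \<and> \<epsilon> ^ 2 dvd along \<gamma> f"
    if "z \<in> ideal_prod (local_ring (line_through v)) (maximal_ideal (line_through v)) (maximal_ideal (line_through v))" for z
    using that
  proof (induction rule: ideal_prod.induct)
    case (prod i j)
    then obtain f k f' k' where "i = Fract f k" "j = Fract f' k'" "poly3_eval k v \<noteq> 0" "poly3_eval k' v \<noteq> 0"
      "poly3_eval f v = 0" "poly3_eval f' v = 0"
      unfolding maximal_ideal_iff by blast
    then show ?case
      by (intro exI[of _ "f * f'"] exI[of _ "k * k'"]) (simp add: dvd_epsilon_square_product start)
  next
    case (sum s1 s2)
    then obtain f k f' k' where *: "s1 = Fract f k" "s2 = Fract f' k'" "poly3_eval k v \<noteq> 0" "poly3_eval k' v \<noteq> 0"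
      "\<epsilon> ^ 2 dvd along \<gamma> f" "\<epsilon> ^ 2 dvd along \<gamma> f'"
      by blast
    have "s1 + s2 = Fract (f * k' + f' * k) (k * k')" using * not_vanishing_nonzero by simp
    moreover have "\<epsilon> ^ 2 dvd along \<gamma> (f * k' + f' * k)"
      using * by (simp only: along_simps) (intro dvd_add dvd_mult2)
    ultimately show ?case using * by (intro exI[of _ "f * k' + f' * k"] exI[of _ "k * k'"]) simp
  qed
  then obtain f' k' where *: "Fract f k = Fract f' k'" "poly3_eval k' v \<noteq> 0" "\<epsilon> ^ 2 dvd along \<gamma> f'"
    using assms(1) by blast
  then have "f * k' = f' * k" using k by (subst (asm) eq_fract) (auto simp: not_vanishing_nonzero)
  then have "along \<gamma> (f * k') = along \<gamma> (f' * k)" by simp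
  then have "\<epsilon> ^ 2 dvd along \<gamma> k' * along \<gamma> f" using * by (simp add: mult.commute)
  then show ?thesis using cancel_mod_power[of "along \<gamma> k'" 2 "along \<gamma> f"] * start by simp
qed

section \<open>Standard schemes\<close>

text \<open>
  The inverse \<open>h\<close> is a parameter of the locale: it defines the linear forms that become the
  coordinates after the change by \<open>g\<close>.
\<close>
locale standard_net =
  fixes g h :: "complex^3^3" and \<tau> :: scheme_type and b :: "3 \<Rightarrow> complex^3^3"
  assumes inverse_right: "g ** h = mat 1" and standard: "standard g \<tau> b"
begin

abbreviation "I \<equiv> segre_section b"

abbreviation point_at :: "3 \<Rightarrow> complex^3" where "point_at k \<equiv> g *v axis k 1"

definition coordinate :: "3 \<Rightarrow> poly3" where "coordinate k = change h (Var k)"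

lemma inverse_left: "h ** g = mat 1"
  using inverse_right matrix_left_right_inverse by blast

lemma change_coordinate [simp]: "change g (coordinate k) = Var k"
  by (simp add: coordinate_def change_change inverse_left)

lemma homogeneous_coordinate [simp]: "homogeneous 1 (coordinate k)" "homogeneous (Suc 0) (coordinate k)"
  unfolding coordinate_def by (auto intro!: homogeneous_change)

lemma eval_coordinate: "poly3_eval (coordinate j) (point_at k) = (if j = k then 1 else 0)"
  using eval_change[of g "coordinate j" "axis k 1"] by (auto simp: axis_def)

lemma point_at_nonzero: "point_at k \<noteq> 0"
proof
  assume "point_at k = 0"
  moreover have "poly3_eval (coordinate k) (0 *s point_at k) = 0" by (subst eval_scale[of 1]) simp_all
  ultimately show False using eval_coordinate[of k k] by simp
qed

lemma line_point_at_eq_iff: "line_through (point_at j) = line_through (point_at k) \<longleftrightarrow> j = k"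
proof
  assume "line_through (point_at j) = line_through (point_at k)"
  then obtain c where "point_at j = c *s point_at k" using line_through_eq_iff point_at_nonzero by blast
  then have "poly3_eval (coordinate j) (point_at j) = poly3_eval (coordinate j) (c *s point_at k)" by simp
  then show "j = k" by (simp add: eval_scale[of 1] eval_coordinate split: if_splits)
qed simp

lemma local_iff: "homogeneous d f \<Longrightarrow> locally_in I (point_at k) f \<longleftrightarrow> normal_stalk \<tau> k (change g f)"
  using standard by (simp add: standard_def)

lemma support_eq: "scheme_support I = (\<lambda>k. line_through (point_at k)) ` {k. \<not> normal_stalk \<tau> k 1}"
proof -
  have "line_through v \<in> scheme_support I \<longleftrightarrow> line_through v \<in> (\<lambda>k. line_through (point_at k)) ` {k. \<not> normal_stalk \<tau> k 1}"
    if v: "v \<noteq> 0" for v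
  proof (cases "\<exists>k. v \<in> line_through (point_at k)")
    case True
    then obtain k c where c: "v = c *s point_at k" by (auto simp: line_through_def)
    with v have "c \<noteq> 0" by auto
    then have line: "line_through v = line_through (point_at k)" by (simp add: c line_through_scale)
    have "line_through (point_at k) \<in> scheme_support I \<longleftrightarrow> \<not> normal_stalk \<tau> k 1"
      unfolding line_in_support_iff[OF point_at_nonzero] using locally_in_one_iff local_iff[of 0 1 k] by auto
    then show ?thesis by (auto simp: line line_point_at_eq_iff)
  next
    case False
    then have "locally_in I v 1" using standard v by (simp add: standard_def)
    then have "line_through v \<notin> scheme_support I"
      using line_in_support_iff[OF v] locally_in_one_iff by simp
    moreover have "line_through v \<noteq> line_through (point_at k)" for k
      using False in_line_through_self[of v] by auto
    ultimately show ?thesis by auto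
  qed
  moreover have "\<exists>v. v \<noteq> 0 \<and> p = line_through v" if "p \<in> scheme_support I" for p
    using that by (simp add: scheme_support_def P2_iff)
  ultimately show ?thesis using point_at_nonzero by blast
qed

lemma reduced:
  assumes "\<And>F. normal_stalk \<tau> k F \<longleftrightarrow> reduced_jet k F"
  shows "reduced_at I (line_through (point_at k))"
  unfolding reduced_at_iff[OF poly_ideal_segre point_at_nonzero]
  using local_iff[of _ _ k] assms by (simp add: reduced_jet_def)

text \<open>
  The image of an arc in normal coordinates under the change of coordinates.
\<close>
definition moved :: "(3 \<Rightarrow> complex poly) \<Rightarrow> 3 \<Rightarrow> complex poly" where
  "moved \<gamma> i = along \<gamma> (\<Sum>j\<in>UNIV. Const (g $ i $ j) * Var j)"

lemma along_moved: "along (moved \<gamma>) f = along \<gamma> (change g f)"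
  unfolding change_def along_subst moved_def ..

lemma moved_start:
  assumes "\<And>i. poly (\<gamma> i) 0 = axis 1 1 $ i"
  shows "poly (moved \<gamma> i) 0 = point_at 1 $ i"
proof -
  have "(\<chi> i. poly (\<gamma> i) 0) = axis 1 1" by (simp add: assms vec_eq_iff)
  then have "poly (moved \<gamma> i) 0 = poly3_eval (\<Sum>j\<in>UNIV. Const (g $ i $ j) * Var j) (axis 1 1)"
    unfolding moved_def poly_along by simp
  then show ?thesis by (simp add: matrix_vector_mult_def)
qed

lemma curvilinear_presentation:
  assumes cond: "\<And>F. normal_stalk \<tau> 1 F \<longleftrightarrow> \<epsilon> ^ m dvd along \<gamma> F"
    and \<gamma>: "\<gamma> 1 = 1" "\<gamma> 3 = \<epsilon>" "\<And>i. poly (\<gamma> i) 0 = axis 1 1 $ i"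
  shows "jet_presentation m I (point_at 1) (expands m (moved \<gamma>))"
proof (rule jet_presentation_expands[OF poly_ideal_segre moved_start[OF \<gamma>(3)]])
  show "homogeneous 1 (coordinate 1)" "homogeneous 1 (coordinate 3)" by simp_all
  show "along (moved \<gamma>) (coordinate 1) = 1" "along (moved \<gamma>) (coordinate 3) = \<epsilon>"
    by (simp_all add: along_moved \<gamma>)
  show "locally_in I (point_at 1) f \<longleftrightarrow> \<epsilon> ^ m dvd along (moved \<gamma>) f" if "homogeneous d f" for d f
    using local_iff[OF that, of 1] cond by (simp add: along_moved)
qed

lemma curvilinear:
  assumes "\<And>F. normal_stalk \<tau> 1 F \<longleftrightarrow> \<epsilon> ^ m dvd along \<gamma> F"
    and "\<gamma> 1 = 1" "\<gamma> 3 = \<epsilon>" "\<And>i. poly (\<gamma> i) 0 = axis 1 1 $ i"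
  shows "curvilinear_at m I (line_through (point_at 1))"
  using curvilinear_presentation[OF assms] curvilinear_at_iff[OF poly_ideal_segre] by blast

end

section \<open>Types and lengths of standard schemes\<close>

lemma jet_presentation_diff:
  assumes R: "jet_presentation m I v R" and zw: "z \<in> regular v" "w \<in> regular v" "R z P" "R w Q"
  shows "R (z - w) (P - Q)"
proof -
  have "R (z + Fract (Const (- 1)) 1 * w) (P + [:- 1:] * Q)"
    by (intro jet_presentation_add[OF R] jet_presentation_mult[OF R] regular_mult regular_Const zw
        jet_presentation_Const[OF R])
  then show ?thesis by (simp add: Fract_Const_uminus_1)
qed

text \<open>
  Preimages of \<open>1\<close>, \<open>\<epsilon>\<close>, \<open>\<epsilon>^2\<close> span the local algebra. Only the lengths two and three occur, and
  three spanning elements are indexed by the type \<open>3\<close>.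
\<close>
lemma curvilinear_length:
  assumes "curvilinear_at m I (line_through v)" and I: "poly_ideal I" and m: "m = 2 \<or> m = 3"
  shows "ring_length (local_algebra I (line_through v)) \<le> enat m"
proof -
  obtain R where R: "jet_presentation m I v R"
    using assms by (auto simp: curvilinear_at_iff)
  define ix :: "3 \<Rightarrow> nat" where "ix k = (if k = 1 then 0 else if k = 2 then 1 else 2)" for k
  have "\<forall>k. \<exists>z. z \<in> regular v \<and> R z (\<epsilon> ^ ix k)" using jet_presentation_surj[OF R] by blast
  then obtain E where E: "\<And>k. E k \<in> regular v" "\<And>k. R (E k) (\<epsilon> ^ ix k)" by metis
  let ?M = "{k. ix k < m}"
  have "{k. ix k < 2} = {1, 2}" "{k. ix k < 3} = {1, 2, 3}"
    using exhaust_3 by (auto simp: ix_def split: if_splits)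
  then have card: "card ?M = m" using m by auto
  have "ring_length (local_algebra I (line_through v)) \<le> enat (card ?M)"
  proof (rule ring_length_local_algebra_le[OF I E(1)])
    fix z assume z: "z \<in> regular v"
    obtain P where P: "R z P" using jet_presentation_total[OF R z] by blast
    define c :: "complex^3" where "c = (\<chi> k. if ix k < m then Polynomial.coeff P (ix k) else 0)"
    let ?w = "Fract (Const (c $ 1)) 1 * E 1 + Fract (Const (c $ 2)) 1 * E 2 + Fract (Const (c $ 3)) 1 * E 3"
    let ?Q = "[:c $ 1:] * \<epsilon> ^ ix 1 + [:c $ 2:] * \<epsilon> ^ ix 2 + [:c $ 3:] * \<epsilon> ^ ix 3"
    have w: "?w \<in> regular v" by (intro regular_add regular_mult regular_Const E)
    have "R ?w ?Q"
      by (intro jet_presentation_add[OF R] jet_presentation_mult[OF R] regular_add regular_mult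
          regular_Const E jet_presentation_Const[OF R])
    then have "R (z - ?w) (P - ?Q)" by (rule jet_presentation_diff[OF R z w P])
    moreover have "\<epsilon> ^ m dvd P - ?Q"
      using m by (auto simp only: epsilon_square_dvd_iff epsilon_cube_dvd_iff)
        (simp_all add: c_def ix_def power2_eq_square numeral_2_eq_2)
    ultimately have "z - ?w \<in> ideal_stalk I (line_through v)"
      using jet_presentation_kernel[OF R regular_diff[OF z w]] by blast
    moreover have "\<forall>k. k \<notin> ?M \<longrightarrow> c $ k = 0" by (simp add: c_def)
    ultimately show "\<exists>c::complex^3. (\<forall>k. k \<notin> ?M \<longrightarrow> c $ k = 0) \<and>
        z - (\<Sum>k\<in>UNIV. Fract (Const (c $ k)) 1 * E k) \<in> ideal_stalk I (line_through v)"
      unfolding sum_3 by blast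
  qed
  then show ?thesis by (simp add: card)
qed

lemma reduced_length:
  assumes "reduced_at I (line_through v)" and I: "poly_ideal I" and v: "v \<noteq> 0"
  shows "ring_length (local_algebra I (line_through v)) \<le> enat 1"
proof -
  have "ring_length (local_algebra I (line_through v)) \<le> enat (card {1::3})"
  proof (rule ring_length_local_algebra_le[OF I, of "\<lambda>_. 1"])
    fix z assume "z \<in> regular v"
    then obtain f k d where z: "z = Fract f k" "homogeneous d f" "homogeneous d k" "poly3_eval k v \<noteq> 0"
      by (rule regularE)
    define a where "a = poly3_eval f v / poly3_eval k v"
    define c :: "complex^3" where "c = axis 1 a"
    have "k \<noteq> 0" using z by auto
    have hom: "homogeneous d (f - Const a * k)" by (intro homogeneous_diff homogeneous_mult_Const z)
    have "poly3_eval (f - Const a * k) v = 0" using z by (simp add: a_def)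
    then have "locally_in I v (f - Const a * k)"
      using hom assms by (simp add: reduced_at_iff)
    then have "Fract (f - Const a * k) k \<in> ideal_stalk I (line_through v)"
      using Fract_in_stalk_iff[OF I hom z(3,4)] by blast
    moreover have "Fract (f - Const a * k) k = z - Fract (Const a) 1"
      using \<open>k \<noteq> 0\<close> by (simp add: z(1))
    moreover have "c $ 1 = a" "c $ 2 = 0" "c $ 3 = 0" by (simp_all add: c_def axis_def)
    ultimately show "\<exists>c::complex^3. (\<forall>k. k \<notin> {1} \<longrightarrow> c $ k = 0) \<and>
        z - (\<Sum>k\<in>UNIV. Fract (Const (c $ k)) 1 * 1) \<in> ideal_stalk I (line_through v)"
      unfolding sum_3 by (intro exI[of _ c]) (simp add: c_def axis_def Const_0 Zero_fract_def[symmetric])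
  qed (rule regular_1)
  then show ?thesis by simp
qed

text \<open>
  Apply the decomposition of forms once in degree one, and once more to the cofactors in degree
  zero.
\<close>
lemma linear_form_decomposition:
  assumes "homogeneous 1 l"
  obtains \<alpha> \<beta> \<delta> where "l = Const \<alpha> * Var 1 + Const \<beta> * Var 2 + Const \<delta> * Var 3"
proof -
  obtain \<alpha> A B where l: "l = Const \<alpha> * Var 1 ^ 1 + Var 2 * A + Var 3 * B"
    "homogeneous (1 - 1) A" "homogeneous (1 - 1) B"
    using homogeneous_decomposition[OF assms] by metis
  have "\<exists>\<beta>. C = Const \<beta>" if "homogeneous (1 - 1) C" for C
    using homogeneous_decomposition[OF that] by (metis diff_self_eq_0 mult.right_neutral mult_zero_right add.right_neutral power_0)
  then obtain \<beta> \<delta> where "A = Const \<beta>" "B = Const \<delta>" using l by blast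
  then show thesis using that l by (simp add: mult.commute)
qed

lemma tangent_arc_simps [simp]:
  "tangent_arc k 1 = 1" "tangent_arc 2 2 = \<epsilon>" "tangent_arc 2 3 = 0" "tangent_arc 3 2 = 0" "tangent_arc 3 3 = \<epsilon>"
  by (simp_all add: tangent_arc_def)

lemma parabola_simps [simp]:
  "parabola 1 = 1" "parabola 2 = \<epsilon> ^ 2" "parabola 3 = \<epsilon>"
  by (simp_all add: parabola_def)

lemma tangent_arc_start: "poly (tangent_arc k i) 0 = axis 1 1 $ i"
  by (simp add: tangent_arc_def axis_def)

lemma parabola_start: "poly (parabola i) 0 = axis 1 1 $ i"
  by (simp add: parabola_def axis_def)

lemma start_along:
  assumes "\<And>i. poly (\<gamma> i) 0 = axis 1 1 $ i"
  shows "Polynomial.coeff (along \<gamma> F) 0 = poly3_eval F (axis 1 1)"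
proof -
  have "(\<chi> i. poly (\<gamma> i) 0) = axis 1 1" by (simp add: assms vec_eq_iff)
  then show ?thesis unfolding poly_0_coeff_0[symmetric] poly_along by simp
qed

lemma jets_of_one [simp]: "\<not> reduced_jet k 1" "\<not> double_jet 1" "\<not> triple_jet 1" "\<not> fat_jet 1"
  by (simp_all only: reduced_jet_def double_jet_def triple_jet_def fat_jet_def epsilon_square_dvd_iff
      epsilon_cube_dvd_iff curve.evaluate_one poly3_eval_simps) simp_all

context standard_net
begin

lemma change_back: "change h (change g f) = f"
  by (simp add: change_change inverse_right)

lemma eval_change_back: "poly3_eval (change h F) (point_at k) = poly3_eval F (axis k 1)"
  by (simp add: matrix_vector_mul_assoc inverse_left)

text \<open>
  A form with vanishing jet of order two is a sum of products of the second or third coordinate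
  with a cofactor that vanishes at the point. Dividing by the first coordinate makes both
  factors elements of the maximal ideal.
\<close>
lemma fat:
  assumes cond: "\<And>F. normal_stalk \<tau> 1 F \<longleftrightarrow> fat_jet F"
  shows "ideal_stalk I (line_through (point_at 1)) =
    ideal_prod (local_ring (line_through (point_at 1))) (maximal_ideal (line_through (point_at 1))) (maximal_ideal (line_through (point_at 1)))"
    (is "_ = ideal_prod ?O ?m ?m")
proof (intro equalityI subsetI)
  fix z assume z: "z \<in> ideal_prod ?O ?m ?m"
  have "?m \<subseteq> regular (point_at 1)" by (auto simp: maximal_ideal_iff regular_def)
  with z have "z \<in> regular (point_at 1)"
    by (induction rule: ideal_prod.induct) (auto intro: regular_add regular_mult)
  then obtain f k d where f: "z = Fract f k" "homogeneous d f" "homogeneous d k" "poly3_eval k (point_at 1) \<noteq> 0"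
    by (rule regularE)
  have "\<epsilon> ^ 2 dvd along (moved (tangent_arc i)) f" for i
    using square_of_maximal_ideal_tangent[of f k "point_at 1"] z f moved_start[OF tangent_arc_start] by simp
  then have "locally_in I (point_at 1) f"
    using local_iff[OF f(2), of 1] cond by (simp add: fat_jet_def along_moved)
  then show "z \<in> ideal_stalk I (line_through (point_at 1))"
    using Fract_in_stalk_iff[OF poly_ideal_segre f(2-4)] f(1) by blast
next
  fix z assume "z \<in> ideal_stalk I (line_through (point_at 1))"
  then obtain f k d where f: "z = Fract f k" "homogeneous d f" "homogeneous d k"
    "poly3_eval k (point_at 1) \<noteq> 0" "locally_in I (point_at 1) f"
    unfolding ideal_stalk_iff[OF poly_ideal_segre] by blast
  let ?F = "change g f"
  have jet: "fat_jet ?F" using local_iff[OF f(2), of 1] cond f(5) by blast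
  obtain \<alpha> A B where F: "?F = Const \<alpha> * Var 1 ^ d + Var 2 * A + Var 3 * B"
    "homogeneous (d - 1) A" "homogeneous (d - 1) B" "d = 0 \<Longrightarrow> A = 0 \<and> B = 0"
    using homogeneous_decomposition[OF homogeneous_change[OF f(2)]] by metis
  have zero: "\<alpha> = 0" "poly3_eval A (axis 1 1) = 0" "poly3_eval B (axis 1 1) = 0"
    using jet unfolding fat_jet_def epsilon_square_dvd_iff F(1) 
    by (simp_all add: start_along[OF tangent_arc_start])
  define A' B' where "A' = change h A" and "B' = change h B"
  have hom: "homogeneous (d - 1) A'" "homogeneous (d - 1) B'"
    unfolding A'_def B'_def by (intro homogeneous_change F)+
  have vanish: "poly3_eval A' (point_at 1) = 0" "poly3_eval B' (point_at 1) = 0"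
    unfolding A'_def B'_def eval_change_back using zero by simp_all
  have "f = change h ?F" by (simp add: change_back)
  then have f_eq: "f = coordinate 2 * A' + coordinate 3 * B'"
    unfolding F(1) by (simp add: zero Const_0 A'_def B'_def coordinate_def)
  have nz: "k \<noteq> 0" "coordinate 1 \<noteq> 0"
    using f(4) eval_coordinate[of 1 1] by auto
  have member: "Fract (coordinate j * C) k \<in> ideal_prod ?O ?m ?m"
    if C: "homogeneous (d - 1) C" "poly3_eval C (point_at 1) = 0" and j: "j \<noteq> 1" and d: "d = 0 \<longrightarrow> C = 0" for C j
  proof (cases "C = 0")
    case False
    have a: "Fract (coordinate j) (coordinate 1) \<in> ?m"
      unfolding maximal_ideal_iff using j
      by (intro CollectI exI[of _ "coordinate j"] exI[of _ "coordinate 1"] exI[of _ 1])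
        (simp add: eval_coordinate)
    have "homogeneous d (C * coordinate 1)"
      using homogeneous_mult[OF C(1) homogeneous_coordinate(1), of 1] d False by (cases d) simp_all
    then have b: "Fract (C * coordinate 1) k \<in> ?m"
      unfolding maximal_ideal_iff using C f
      by (intro CollectI exI[of _ "C * coordinate 1"] exI[of _ k] exI[of _ d]) simp
    have "Fract (coordinate j) (coordinate 1) * Fract (C * coordinate 1) k \<in> ideal_prod ?O ?m ?m"
      using ideal_prod.prod[OF a b, of ?O] unfolding local_ring_simps .
    moreover have "Fract (coordinate j) (coordinate 1) * Fract (C * coordinate 1) k = Fract (coordinate j * C) k"
      using nz by (simp add: eq_fract algebra_simps)
    ultimately show ?thesis by simp
  next
    case True
    have "0 \<in> ?m" unfolding maximal_ideal_iff
      by (intro CollectI exI[of _ 0] exI[of _ 1] exI[of _ 0]) (simp add: Zero_fract_def)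
    then have "0 \<in> ideal_prod ?O ?m ?m" using ideal_prod.prod[of 0 ?m 0 ?m ?O] by simp
    moreover have "Fract (coordinate j * C) k = 0" using True nz by (simp add: Zero_fract_def eq_fract)
    ultimately show ?thesis by simp
  qed
  have "Fract (coordinate 2 * A') k + Fract (coordinate 3 * B') k \<in> ideal_prod ?O ?m ?m"
    using ideal_prod.sum[OF member[OF hom(1) vanish(1), of 2] member[OF hom(2) vanish(2), of 3]] F(4)
    by (auto simp: A'_def B'_def)
  moreover have "Fract (coordinate 2 * A') k + Fract (coordinate 3 * B') k = z"
    using nz unfolding f(1) f_eq by (simp add: eq_fract algebra_simps)
  ultimately show "z \<in> ideal_prod ?O ?m ?m" by simp
qed

text \<open>
  The residues of \<open>1\<close>, \<open>t / s\<close>, \<open>u / s\<close> span: the coefficients solve the triangular system given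
  by the value and the two first derivatives.
\<close>
lemma fat_length:
  assumes cond: "\<And>F. normal_stalk \<tau> 1 F \<longleftrightarrow> fat_jet F"
  shows "ring_length (local_algebra I (line_through (point_at 1))) \<le> enat 3"
proof -
  have nz: "coordinate 1 \<noteq> 0" using eval_coordinate[of 1 1] by auto
  have "ring_length (local_algebra I (line_through (point_at 1))) \<le> enat (card (UNIV::3 set))"
  proof (rule ring_length_local_algebra_le[OF poly_ideal_segre, of "\<lambda>k. Fract (coordinate k) (coordinate 1)"])
    show "Fract (coordinate k) (coordinate 1) \<in> regular (point_at 1)" for k
      by (rule regularI[of 1]) (simp_all add: eval_coordinate)
  next
    fix z assume "z \<in> regular (point_at 1)"
    then obtain f k d where f: "z = Fract f k" "homogeneous d f" "homogeneous d k" "poly3_eval k (point_at 1) \<noteq> 0"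
      by (rule regularE)
    then have "k \<noteq> 0" by auto
    obtain \<alpha> A B where F: "change g f = Const \<alpha> * Var 1 ^ d + Var 2 * A + Var 3 * B"
      using homogeneous_decomposition[OF homogeneous_change[OF f(2)]] by metis
    obtain \<kappa> C D where K: "change g k = Const \<kappa> * Var 1 ^ d + Var 2 * C + Var 3 * D"
      using homogeneous_decomposition[OF homogeneous_change[OF f(3)]] by metis
    have "poly3_eval (change g k) (axis 1 1) = \<kappa>" unfolding K by (simp add: axis_def)
    then have \<kappa>: "\<kappa> \<noteq> 0" using f(4) by simp
    let ?ev = "\<lambda>F. poly3_eval F (axis 1 1)"
    define x y w where "x = \<alpha> / \<kappa>" and "y = (?ev A - ?ev C * x) / \<kappa>" and "w = (?ev B - ?ev D * x) / \<kappa>"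
    define c :: "complex^3" where "c = vector [x, y, w]"
    have c: "c $ 1 = x" "c $ 2 = y" "c $ 3 = w" by (simp_all add: c_def)
    let ?l = "Const x * coordinate 1 + Const y * coordinate 2 + Const w * coordinate 3"
    let ?n = "coordinate 1 * f - k * ?l"
    have hom: "homogeneous (1 + d) ?n" "homogeneous (1 + d) (coordinate 1 * k)"
    proof -
      have "homogeneous 1 ?l"
        by (intro homogeneous_add homogeneous_mult_Const homogeneous_coordinate)
      then have "homogeneous (1 + d) (k * ?l)"
        using homogeneous_mult[OF f(3), of 1 ?l] by simp
      moreover have "homogeneous (1 + d) (coordinate 1 * f)"
        by (rule homogeneous_mult[OF homogeneous_coordinate(1) f(2)])
      ultimately show "homogeneous (1 + d) ?n" by (intro homogeneous_diff)
      show "homogeneous (1 + d) (coordinate 1 * k)"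
        by (rule homogeneous_mult[OF homogeneous_coordinate(1) f(3)])
    qed
    have "fat_jet (change g ?n)"
      unfolding fat_jet_def epsilon_square_dvd_iff using \<kappa>
      by (simp add: F K coeff_mult start_along[OF tangent_arc_start] x_def y_def w_def field_simps)
    then have "locally_in I (point_at 1) ?n" using local_iff[OF hom(1), of 1] cond by blast
    then have "Fract ?n (coordinate 1 * k) \<in> ideal_stalk I (line_through (point_at 1))"
      using Fract_in_stalk_iff[OF poly_ideal_segre hom, of "point_at 1"] f(4) by (simp add: eval_coordinate)
    moreover have "Fract ?n (coordinate 1 * k) = z - (\<Sum>j\<in>UNIV. Fract (Const (c $ j)) 1 * Fract (coordinate j) (coordinate 1))"
    proof -
      have "(\<Sum>j\<in>UNIV. Fract (Const (c $ j)) 1 * Fract (coordinate j) (coordinate 1)) = Fract ?l (coordinate 1)"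
        unfolding sum_3 c using nz by (simp add: eq_fract algebra_simps)
      then show ?thesis unfolding f(1) using nz \<open>k \<noteq> 0\<close> by (simp add: eq_fract algebra_simps)
    qed
    ultimately show "\<exists>c::complex^3. (\<forall>k. k \<notin> UNIV \<longrightarrow> c $ k = 0) \<and>
        z - (\<Sum>j\<in>UNIV. Fract (Const (c $ j)) 1 * Fract (coordinate j) (coordinate 1))
          \<in> ideal_stalk I (line_through (point_at 1))"
      by auto
  qed
  then show ?thesis by simp
qed

text \<open>
  If the scheme lies on a line, the equation of the line belongs to all its stalks.
\<close>
lemma linear_form_vanishing:
  assumes l: "homogeneous 1 l" "subscheme I (genideal poly3_ring {l})"
  shows "normal_stalk \<tau> k (change g l)"
proof -
  have J: "poly_ideal (genideal poly3_ring {l})" by (rule poly_ideal_genideal)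
  have e: "poly3_eval (coordinate k) (point_at k) \<noteq> 0" by (simp add: eval_coordinate)
  have "locally_in (genideal poly3_ring {l}) (point_at k) l"
    by (intro locally_in_member in_genideal) simp
  then have "Fract l (coordinate k) \<in> ideal_stalk (genideal poly3_ring {l}) (line_through (point_at k))"
    using Fract_in_stalk_iff[OF J l(1) homogeneous_coordinate(1) e] by blast
  then have "Fract l (coordinate k) \<in> ideal_stalk I (line_through (point_at k))"
    using l(2) line_through_in_P2[OF point_at_nonzero] unfolding subscheme_def by blast
  then show ?thesis
    using Fract_in_stalk_iff[OF poly_ideal_segre l(1) homogeneous_coordinate(1) e] local_iff[OF l(1)] by blast
qed

lemma spans:
  assumes "\<And>\<alpha> \<beta> \<delta>. (\<And>k. normal_stalk \<tau> k (Const \<alpha> * Var 1 + Const \<beta> * Var 2 + Const \<delta> * Var 3))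
    \<Longrightarrow> \<alpha> = 0 \<and> \<beta> = 0 \<and> \<delta> = 0"
  shows "spans_plane I"
  unfolding spans_plane_def
proof
  assume "\<exists>l. l \<noteq> 0 \<and> homogeneous 1 l \<and> subscheme I (genideal poly3_ring {l})"
  then obtain l where l: "l \<noteq> 0" "homogeneous 1 l" "subscheme I (genideal poly3_ring {l})" by blast
  obtain \<alpha> \<beta> \<delta> where L: "change g l = Const \<alpha> * Var 1 + Const \<beta> * Var 2 + Const \<delta> * Var 3"
    using linear_form_decomposition[OF homogeneous_change[OF l(2)]] .
  have "normal_stalk \<tau> k (Const \<alpha> * Var 1 + Const \<beta> * Var 2 + Const \<delta> * Var 3)" for k
    using linear_form_vanishing[OF l(2,3), of k] unfolding L .
  then have "change g l = 0" using assms[of \<alpha> \<beta> \<delta>] L by (simp add: Const_0)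
  then have "l = 0" using change_back[of l] by simp
  with l(1) show False ..
qed

end

context standard_net
begin

lemma standard_has_type: "has_type \<tau> I"
proof (cases \<tau>)
  case Empty
  then show ?thesis by (simp add: support_eq)
next
  case One_Reduced
  then have "scheme_support I = {line_through (point_at 1)}" by (auto simp: support_eq)
  moreover have "reduced_at I (line_through (point_at 1))" using One_Reduced by (intro reduced) simp
  ultimately show ?thesis using One_Reduced by simp
next
  case Two_Reduced
  then have "scheme_support I = {line_through (point_at 1), line_through (point_at 2)}" by (auto simp: support_eq)
  moreover have "reduced_at I (line_through (point_at k))" if "k = 1 \<or> k = 2" for k
    using Two_Reduced that by (intro reduced) auto
  ultimately show ?thesis unfolding Two_Reduced has_type.simps
    by (intro exI[of _ "line_through (point_at 1)"] exI[of _ "line_through (point_at 2)"]) (simp add: line_point_at_eq_iff)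
next
  case Three_Reduced
  let ?p = "\<lambda>k. line_through (point_at k)"
  have "scheme_support I = range ?p" using Three_Reduced by (auto simp: support_eq)
  then have "scheme_support I = {?p 1, ?p 2, ?p 3}" by (simp add: UNIV_3)
  moreover have "reduced_at I (?p k)" for k using Three_Reduced by (intro reduced) simp
  moreover have "vec.span (?p 1 \<union> ?p 2 \<union> ?p 3) = UNIV"
  proof -
    have "x \<in> vec.span (?p 1 \<union> ?p 2 \<union> ?p 3)" for x
    proof -
      let ?y = "h *v x"
      have y: "?y = ?y $ 1 *s axis 1 1 + ?y $ 2 *s axis 2 1 + ?y $ 3 *s axis 3 1"
        unfolding vec_eq_iff forall_3 by (simp add: axis_def)
      have "x = g *v ?y" by (simp add: matrix_vector_mul_assoc inverse_right)
      also have "\<dots> = ?y $ 1 *s point_at 1 + ?y $ 2 *s point_at 2 + ?y $ 3 *s point_at 3"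
        by (subst y) (simp only: matrix_vector_right_distrib vector_scalar_commute)
      finally have x: "x = ?y $ 1 *s point_at 1 + ?y $ 2 *s point_at 2 + ?y $ 3 *s point_at 3" .
      have "point_at 1 \<in> ?p 1 \<union> ?p 2 \<union> ?p 3" "point_at 2 \<in> ?p 1 \<union> ?p 2 \<union> ?p 3" "point_at 3 \<in> ?p 1 \<union> ?p 2 \<union> ?p 3"
        using in_line_through_self by blast+
      then show ?thesis
        by (subst x) (intro vec.span_add vec.span_scale vec.span_base)
    qed
    then show ?thesis by blast
  qed
  ultimately show ?thesis unfolding Three_Reduced has_type.simps
    by (intro exI[of _ "?p 1"] exI[of _ "?p 2"] exI[of _ "?p 3"]) (simp add: line_point_at_eq_iff)
next
  case Double
  then have "scheme_support I = {line_through (point_at 1)}" by (auto simp: support_eq)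
  moreover have "curvilinear_at 2 I (line_through (point_at 1))"
    using Double by (intro curvilinear[OF _ _ _ tangent_arc_start[of 3]]) (simp_all add: double_jet_def)
  ultimately show ?thesis using Double by simp
next
  case Double_Plus_Reduced
  then have "scheme_support I = {line_through (point_at 1), line_through (point_at 2)}"
    by (auto simp: support_eq)
  moreover have "curvilinear_at 2 I (line_through (point_at 1))"
    using Double_Plus_Reduced
    by (intro curvilinear[OF _ _ _ tangent_arc_start[of 3]]) (simp_all add: double_jet_def)
  moreover have "reduced_at I (line_through (point_at 2))" using Double_Plus_Reduced by (intro reduced) simp
  moreover have "spans_plane I"
  proof (rule spans)
    fix \<alpha> \<beta> \<delta>
    assume *: "\<And>k. normal_stalk \<tau> k (Const \<alpha> * Var 1 + Const \<beta> * Var 2 + Const \<delta> * Var 3)"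
    show "\<alpha> = 0 \<and> \<beta> = 0 \<and> \<delta> = 0"
      using *[of 1] *[of 2]
      by (simp add: Double_Plus_Reduced double_jet_def epsilon_square_dvd_iff reduced_jet_def axis_def
          del: power2_eq_square)
  qed
  ultimately show ?thesis unfolding Double_Plus_Reduced has_type.simps
    by (intro exI[of _ "line_through (point_at 1)"] exI[of _ "line_through (point_at 2)"]) (simp add: line_point_at_eq_iff)
next
  case Curvilinear_Triple
  then have "scheme_support I = {line_through (point_at 1)}" by (auto simp: support_eq)
  moreover have "curvilinear_at 3 I (line_through (point_at 1))"
    using Curvilinear_Triple by (intro curvilinear[OF _ _ _ parabola_start]) (simp_all add: triple_jet_def)
  moreover have "spans_plane I"
  proof (rule spans)
    fix \<alpha> \<beta> \<delta>
    assume *: "\<And>k. normal_stalk \<tau> k (Const \<alpha> * Var 1 + Const \<beta> * Var 2 + Const \<delta> * Var 3)"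
    show "\<alpha> = 0 \<and> \<beta> = 0 \<and> \<delta> = 0"
      using *[of 1]
      by (simp add: Curvilinear_Triple triple_jet_def epsilon_cube_dvd_iff)
        (simp add: power2_eq_square numeral_2_eq_2)
  qed
  ultimately show ?thesis using Curvilinear_Triple by simp
next
  case Fat_Point
  then have "scheme_support I = {line_through (point_at 1)}" by (auto simp: support_eq)
  moreover note fat
  ultimately show ?thesis using Fat_Point by simp
qed

lemma standard_length: "scheme_length I \<le> 3"
proof -
  let ?p = "\<lambda>k. line_through (point_at k)" and ?S = "{k. \<not> normal_stalk \<tau> k 1}"
  define len where "len k = ring_length (local_algebra I (?p k))" for k
  have "inj_on ?p ?S" by (auto simp: inj_on_def line_point_at_eq_iff)
  then have sum: "scheme_length I = (\<Sum>k\<in>?S. len k)"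
    by (simp add: scheme_length_def support_eq sum.reindex len_def)
  have reduced_le: "len k \<le> 1" if "\<And>F. normal_stalk \<tau> k F \<longleftrightarrow> reduced_jet k F" for k
    using reduced_length[OF reduced[OF that] poly_ideal_segre point_at_nonzero]
    by (simp add: len_def one_enat_def)
  have curvilinear_le: "len 1 \<le> enat m"
    if "curvilinear_at m I (?p 1)" "m = 2 \<or> m = 3" for m
    using curvilinear_length[OF that(1) poly_ideal_segre that(2)] by (simp add: len_def)
  have "(\<Sum>k\<in>?S. len k) \<le> 3"
  proof (cases \<tau>)
    case Empty
    then show ?thesis by simp
  next
    case One_Reduced
    then have "?S = {1}" by auto
    moreover have "len 1 \<le> 1" using reduced_le One_Reduced by simp
    then have "len 1 \<le> 3" by (rule order_trans) (simp add: numeral_eq_enat one_enat_def)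
    ultimately show ?thesis by simp
  next
    case Two_Reduced
    then have "?S = {1, 2}" by auto
    moreover have "len 1 \<le> 1" "len 2 \<le> 1" using reduced_le Two_Reduced by simp_all
    then have "len 1 + len 2 \<le> 1 + 1" by (rule add_mono)
    then have "len 1 + len 2 \<le> 3" by (rule order_trans) (simp add: numeral_eq_enat one_enat_def)
    ultimately show ?thesis by simp
  next
    case Three_Reduced
    then have "?S = {1, 2, 3}" using UNIV_3 by auto
    moreover have "len 1 \<le> 1" "len 2 \<le> 1" "len 3 \<le> 1" using reduced_le Three_Reduced by simp_all
    then have "len 1 + (len 2 + len 3) \<le> 1 + (1 + 1)" by (intro add_mono)
    ultimately show ?thesis by simp
  next
    case Double
    then have "?S = {1}" by auto
    moreover have "len 1 \<le> enat 2"
      using Double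
      by (intro curvilinear_le curvilinear[OF _ _ _ tangent_arc_start[of 3]]) (simp_all add: double_jet_def)
    moreover have "enat 2 \<le> 3" by (simp add: numeral_eq_enat)
    ultimately show ?thesis by simp
  next
    case Double_Plus_Reduced
    then have "?S = {1, 2}" by auto
    moreover have "len 1 \<le> enat 2" 
      using Double_Plus_Reduced
      by (intro curvilinear_le curvilinear[OF _ _ _ tangent_arc_start[of 3]]) (simp_all add: double_jet_def)
    moreover have "len 2 \<le> 1" using reduced_le[of 2] Double_Plus_Reduced by simp
    ultimately have "len 1 + len 2 \<le> enat 2 + 1" by (intro add_mono)
    then show ?thesis using \<open>?S = {1, 2}\<close> by (simp add: numeral_eq_enat one_enat_def)
  next
    case Curvilinear_Triple
    then have "?S = {1}" by auto
    moreover have "len 1 \<le> enat 3"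
      using Curvilinear_Triple
      by (intro curvilinear_le curvilinear[OF _ _ _ parabola_start]) (simp_all add: triple_jet_def)
    ultimately show ?thesis by (simp add: numeral_eq_enat)
  next
    case Fat_Point
    then have "?S = {1}" by auto
    moreover have "len 1 \<le> enat 3" unfolding len_def using Fat_Point by (intro fat_length) simp
    ultimately show ?thesis by (simp add: numeral_eq_enat)
  qed
  then show ?thesis by (simp add: sum)
qed

lemma reduced_criterion:
  assumes "reduced_at I (line_through (point_at k))" "homogeneous d F" "reduced_jet k F"
  shows "normal_stalk \<tau> k F"
proof -
  have hom: "homogeneous d (change h F)" using assms(2) by (rule homogeneous_change)
  have "locally_in I (point_at k) (change h F)"
    using assms hom unfolding reduced_at_iff[OF poly_ideal_segre point_at_nonzero] reduced_jet_def
    by (simp add: matrix_vector_mul_assoc inverse_left)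
  then show ?thesis using local_iff[OF hom] by (simp add: change_change inverse_left)
qed

lemma curvilinear_criterion:
  assumes "curvilinear_at (Suc m) I (line_through (point_at k))"
  obtains d F where "homogeneous d F" "normal_stalk \<tau> k (F ^ Suc m)" "\<not> normal_stalk \<tau> k (F ^ m)"
proof -
  obtain d f where f: "homogeneous d f" "locally_in I (point_at k) (f ^ Suc m)" "\<not> locally_in I (point_at k) (f ^ m)"
    using curvilinear_parameter[OF assms poly_ideal_segre] .
  have pow: "change g (f ^ n) = change g f ^ n" for n by (induction n) simp_all
  have iff: "locally_in I (point_at k) (f ^ n) \<longleftrightarrow> normal_stalk \<tau> k (change g f ^ n)" for n
    unfolding local_iff[OF homogeneous_power[OF f(1)]] pow ..
  from homogeneous_change[OF f(1)] f(2,3)[unfolded iff] show thesis by (rule that)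
qed

lemma curvilinear_two_criterion:
  assumes "curvilinear_at 2 I (line_through (point_at k))" "homogeneous d F" "normal_stalk \<tau> k (F ^ n)"
  shows "normal_stalk \<tau> k (F ^ 2)"
proof -
  have hom: "homogeneous d (change h F)" using assms(2) by (rule homogeneous_change)
  have pow: "change g (change h F ^ n) = F ^ n" for n
    by (induction n) (simp_all add: change_change inverse_left)
  have iff: "locally_in I (point_at k) (change h F ^ n) \<longleftrightarrow> normal_stalk \<tau> k (F ^ n)" for n
    using local_iff[OF homogeneous_power[OF hom]] by (simp add: pow)
  show ?thesis
    using curvilinear_two_nilpotent[OF assms(1) poly_ideal_segre point_at_nonzero hom] assms(3) unfolding iff by blast
qed

lemma fat_criterion:
  assumes fat: "ideal_stalk I (line_through (point_at 1)) =
    ideal_prod (local_ring (line_through (point_at 1))) (maximal_ideal (line_through (point_at 1))) (maximal_ideal (line_through (point_at 1)))"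
    and F: "homogeneous d F" "normal_stalk \<tau> 1 F"
  shows "\<epsilon> ^ 2 dvd along (tangent_arc i) F"
proof -
  have hom: "homogeneous d (change h F)" using F(1) by (rule homogeneous_change)
  obtain k where k: "homogeneous d k" "poly3_eval k (point_at 1) \<noteq> 0" using ex_nonvanishing_form[OF point_at_nonzero] .
  have "locally_in I (point_at 1) (change h F)"
    using local_iff[OF hom] F(2) by (simp add: change_change inverse_left)
  then have "Fract (change h F) k \<in> ideal_stalk I (line_through (point_at 1))"
    using Fract_in_stalk_iff[OF poly_ideal_segre hom k] by blast
  note square_of_maximal_ideal_tangent[OF this[unfolded fat] k(2) moved_start[OF tangent_arc_start]]
  then have "\<epsilon> ^ 2 dvd along (moved (tangent_arc i)) (change h F)" .
  then show ?thesis unfolding along_moved change_change inverse_left change_id .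
qed

text \<open>
  The number of points separates the types up to the structure at the points. A reduced point
  has \<open>u\<close> in its stalk, the other types do not. In the normal form of a reduced point all
  nilpotents vanish, and at a double or fat point their squares vanish, which a longer
  curvilinear structure forbids. A double point can be neither triple, where \<open>u^2\<close> survives, nor
  fat, where the nilpotents \<open>t\<close> and \<open>u\<close> are independent. Finally, an ideal equal to the square
  of the maximal ideal contains none of \<open>u\<close>, \<open>t\<close>, \<open>st - u^2\<close>, since these have nonzero first
  derivatives.
\<close>
lemma type_unique:
  assumes type: "has_type \<sigma> I"
  shows "\<sigma> = \<tau>"
proof -
  let ?p = "\<lambda>k. line_through (point_at k)"
  have support1: "scheme_support I = {?p 1}"
    if "\<tau> \<in> {One_Reduced, Double, Curvilinear_Triple, Fat_Point}"
    using that by (auto simp: support_eq)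
  have support2: "scheme_support I = {?p 1, ?p 2}"
    if "\<tau> \<in> {Two_Reduced, Double_Plus_Reduced}"
    using that by (auto simp: support_eq)
  have "card (scheme_support I) = card {k. \<not> normal_stalk \<tau> k 1}"
    unfolding support_eq by (rule card_image) (simp add: inj_on_def line_point_at_eq_iff)
  also have "\<dots> = (case \<tau> of Empty \<Rightarrow> 0 | One_Reduced \<Rightarrow> 1 | Two_Reduced \<Rightarrow> 2 | Double \<Rightarrow> 1
      | Three_Reduced \<Rightarrow> 3 | Double_Plus_Reduced \<Rightarrow> 2 | Curvilinear_Triple \<Rightarrow> 1 | Fat_Point \<Rightarrow> 1)"
  proof -
    have "{k::3. k = 1 \<or> k = 2} = {1, 2}" by auto
    then show ?thesis by (cases \<tau>) (simp_all add: Collect_disj_eq insert_commute)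
  qed
  finally have card_\<tau>: "card (scheme_support I) = \<dots>" .
  have card_\<sigma>: "card (scheme_support I) = (case \<sigma> of Empty \<Rightarrow> 0 | One_Reduced \<Rightarrow> 1 | Two_Reduced \<Rightarrow> 2 | Double \<Rightarrow> 1
      | Three_Reduced \<Rightarrow> 3 | Double_Plus_Reduced \<Rightarrow> 2 | Curvilinear_Triple \<Rightarrow> 1 | Fat_Point \<Rightarrow> 1)"
    using type
    by (cases \<sigma>; simp only: has_type.simps scheme_type.case; (elim exE conjE)?; simp)
  have u: "reduced_jet 1 (Var 3)" "\<not> double_jet (Var 3)" "\<not> triple_jet (Var 3)" "\<not> fat_jet (Var 3)"
    by (simp_all add: reduced_jet_def double_jet_def triple_jet_def fat_jet_def epsilon_square_dvd_iff
        epsilon_cube_dvd_iff axis_def)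
  have not_reduced: "\<not> reduced_at I (?p 1)"
    if "\<tau> \<in> {Double, Curvilinear_Triple, Fat_Point, Double_Plus_Reduced}"
    using reduced_criterion[of 1 1 "Var 3"] u that by auto
  have nilpotent: "\<not> curvilinear_at (Suc m) I (?p k)"
    if "m > 0" and "\<And>F. normal_stalk \<tau> k F \<longleftrightarrow> reduced_jet k F" for m k
  proof
    assume "curvilinear_at (Suc m) I (?p k)"
    then obtain F where "normal_stalk \<tau> k (F ^ Suc m)" "\<not> normal_stalk \<tau> k (F ^ m)"
      using curvilinear_criterion by metis
    with that show False by (simp add: reduced_jet_def)
  qed
  have not_triple: "\<not> curvilinear_at 3 I (?p 1)" if \<tau>: "\<tau> \<in> {Double, Fat_Point}"
  proof
    assume "curvilinear_at 3 I (?p 1)"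
    then have "curvilinear_at (Suc 2) I (?p 1)" by (simp add: numeral_3_eq_3 numeral_2_eq_2)
    then obtain F where F: "normal_stalk \<tau> 1 (F ^ Suc 2)" "\<not> normal_stalk \<tau> 1 (F ^ 2)"
      using curvilinear_criterion by metis
    have "\<epsilon> ^ 2 dvd along (tangent_arc i) (F ^ 2)" if "\<epsilon> ^ 2 dvd along (tangent_arc i) (F ^ Suc 2)" for i
      using vanishes_if_power_divisible[of "along (tangent_arc i) F" "Suc 2"] that
        dvd_epsilon_square_product[of "along (tangent_arc i) F" "along (tangent_arc i) F"]
      unfolding curve.evaluate_power power2_eq_square[of "along (tangent_arc i) F"] by blast
    then show False using F \<tau> by (auto simp: double_jet_def fat_jet_def)
  qed
  have not_double: "\<not> curvilinear_at 2 I (?p 1)" if "\<tau> \<in> {Curvilinear_Triple, Fat_Point}"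
  proof
    assume c: "curvilinear_at 2 I (?p 1)"
    show False
    proof (cases "\<tau> = Curvilinear_Triple")
      case True
      have "normal_stalk \<tau> 1 (Var 3 ^ 3)" "\<not> normal_stalk \<tau> 1 (Var 3 ^ 2)"
        using True by (simp_all add: triple_jet_def epsilon_cube_dvd_iff)
          (simp_all add: power2_eq_square power3_eq_cube numeral_2_eq_2)
      then show False using curvilinear_two_criterion[OF c homogeneous_Var(1)] by blast
    next
      case False
      then have \<tau>: "\<tau> = Fat_Point" using that by simp
      have square: "locally_in I (point_at 1) (coordinate j ^ 2)" if "j \<noteq> 1" for j
      proof -
        have "\<epsilon> ^ 2 dvd along (tangent_arc i) (Var j ^ 2)" for i
          using that unfolding curve.evaluate_power power2_eq_square[of "along _ _"]
          by (intro dvd_epsilon_square_product) (simp_all add: tangent_arc_def)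
        then show ?thesis
          unfolding local_iff[OF homogeneous_power[OF homogeneous_coordinate(1)]]
          by (simp add: \<tau> fat_jet_def power2_eq_square)
      qed
      have squares: "locally_in I (point_at 1) (coordinate 2 ^ 2)" "locally_in I (point_at 1) (coordinate 3 ^ 2)"
        by (rule square, simp)+
      obtain a b where ab: "a \<noteq> 0 \<or> b \<noteq> 0"
        "locally_in I (point_at 1) (Const a * coordinate 2 + Const b * coordinate 3)"
        using curvilinear_two_dependent[OF c poly_ideal_segre point_at_nonzero homogeneous_coordinate(1) squares(1)
            homogeneous_coordinate(1) squares(2)] .
      have "homogeneous 1 (Const a * coordinate 2 + Const b * coordinate 3)"
        by (intro homogeneous_add homogeneous_mult_Const homogeneous_coordinate)
      then have "fat_jet (Const a * Var 2 + Const b * Var 3)"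
        using ab(2) local_iff[of 1 _ 1] \<tau> by simp
      then have "a = 0" "b = 0" unfolding fat_jet_def epsilon_square_dvd_iff by simp_all
      then show False using ab(1) by simp
    qed
  qed
  have not_fat: "\<not> has_type Fat_Point I" if \<tau>: "\<tau> \<in> {One_Reduced, Double, Curvilinear_Triple}"
  proof
    assume "has_type Fat_Point I"
    then have *: "ideal_stalk I (?p 1) = ideal_prod (local_ring (?p 1)) (maximal_ideal (?p 1)) (maximal_ideal (?p 1))"
      using support1 \<tau> by auto
    have dvd: "\<not> \<epsilon> ^ 2 dvd along (tangent_arc 3) (Var 3)" "\<not> \<epsilon> ^ 2 dvd along (tangent_arc 2) (Var 2)"
      "\<not> \<epsilon> ^ 2 dvd along (tangent_arc 2) (Var 1 * Var 2 - Var 3 * Var 3)"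
      by (simp_all add: epsilon_square_dvd_iff)
    have 1: "\<tau> \<noteq> One_Reduced" using fat_criterion[OF * homogeneous_Var(1), of 3 3] u dvd by auto
    have 2: "\<tau> \<noteq> Double"
    proof
      assume "\<tau> = Double"
      then have "normal_stalk \<tau> 1 (Var 2)" by (simp add: double_jet_def)
      then show False using fat_criterion[OF * homogeneous_Var(1), of 2 2] dvd by blast
    qed
    have "normal_stalk Curvilinear_Triple 1 (Var 1 * Var 2 - Var 3 * Var 3)"
      by (simp add: triple_jet_def power2_eq_square)
    moreover have "homogeneous (1 + 1) (Var 1 * Var 2 - Var 3 * Var 3)"
      by (intro homogeneous_diff homogeneous_mult homogeneous_Var(1))
    ultimately have "\<tau> \<noteq> Curvilinear_Triple"
      using fat_criterion[OF *, of "1 + 1" "Var 1 * Var 2 - Var 3 * Var 3" 2] dvd by blast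
    with 1 2 \<tau> show False by blast
  qed
  have nil1: "\<not> curvilinear_at 2 I (?p 1)" "\<not> curvilinear_at 3 I (?p 1)" if "\<tau> = One_Reduced"
    using nilpotent[of 1 1] nilpotent[of 2 1] that by (simp_all add: numeral_2_eq_2 numeral_3_eq_3)
  have nil2: "\<not> curvilinear_at 2 I (?p k)" if "\<tau> = Two_Reduced" "k = 1 \<or> k = 2" for k
    using nilpotent[of 1 k] that by (auto simp: numeral_2_eq_2)
  show ?thesis
  proof (cases "card (scheme_support I) = 1")
    case True
    then have \<tau>: "\<tau> \<in> {One_Reduced, Double, Curvilinear_Triple, Fat_Point}"
      using card_\<tau> by (cases \<tau>) simp_all
    have \<sigma>: "\<sigma> \<in> {One_Reduced, Double, Curvilinear_Triple, Fat_Point}"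
      using True card_\<sigma> by (cases \<sigma>) simp_all
    have local: "\<sigma> = One_Reduced \<Longrightarrow> reduced_at I (?p 1)" "\<sigma> = Double \<Longrightarrow> curvilinear_at 2 I (?p 1)"
      "\<sigma> = Curvilinear_Triple \<Longrightarrow> curvilinear_at 3 I (?p 1)"
      using type by (auto simp: support1[OF \<tau>])
    have fat: "has_type Fat_Point I" if "\<sigma> = Fat_Point" using type that by simp
    show ?thesis
      using \<tau> \<sigma> local not_reduced nil1 not_triple not_double not_fat fat
      by (cases \<tau>; cases \<sigma>; simp del: has_type.simps)
  next
    case False
    show ?thesis
    proof (cases "card (scheme_support I) = 2")
      case True
      then have \<tau>: "\<tau> \<in> {Two_Reduced, Double_Plus_Reduced}" using card_\<tau> by (cases \<tau>) simp_all
      have \<sigma>: "\<sigma> \<in> {Two_Reduced, Double_Plus_Reduced}" using True card_\<sigma> by (cases \<sigma>) simp_all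
      have "reduced_at I (?p 1)" if s: "\<sigma> = Two_Reduced"
      proof -
        from type obtain p q where pq: "scheme_support I = {p, q}" "reduced_at I p" "reduced_at I q"
          unfolding s has_type.simps by (elim exE conjE)
        then show ?thesis using pq(1)[unfolded support2[OF \<tau>] doubleton_eq_iff] by metis
      qed
      moreover have "curvilinear_at 2 I (?p 1) \<or> curvilinear_at 2 I (?p 2)" if s: "\<sigma> = Double_Plus_Reduced"
      proof -
        from type obtain p q where pq: "scheme_support I = {p, q}" "curvilinear_at 2 I p"
          unfolding s has_type.simps by (elim exE conjE)
        then show ?thesis using pq(1)[unfolded support2[OF \<tau>] doubleton_eq_iff] by metis
      qed
      ultimately show ?thesis using \<tau> \<sigma> not_reduced nil2 by blast
    next
      case False
      with \<open>card (scheme_support I) \<noteq> 1\<close> show ?thesis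
        using card_\<sigma> card_\<tau> by (cases \<sigma>; cases \<tau>) simp_all
    qed
  qed
qed

end

section \<open>Recognizing standard schemes\<close>

text \<open>
  Modulo the other variables a form is a multiple of a power of the \<open>k\<close>-th one, with its value
  at the \<open>k\<close>-th coordinate point as coefficient.
\<close>
lemma ideal_mod_form:
  assumes L: "poly_ideal L" and vars: "\<And>j. j \<noteq> k \<Longrightarrow> Var j \<in> L" and f: "homogeneous d f"
    and zero: "reduced_jet k f"
  shows "f \<in> L"
proof -
  let ?e = "axis k 1 :: complex^3"
  let ?D = "\<lambda>f. f - Const (poly3_eval f ?e) * Var k ^ d"
  have single: "?D (Poly_Mapping.single m c) \<in> L" if m: "(\<Sum>i\<in>UNIV. Poly_Mapping.lookup m i) = d" for m c
  proof (cases "\<exists>j. j \<noteq> k \<and> Poly_Mapping.lookup m j \<noteq> 0")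
    case True
    then obtain j n where j: "j \<noteq> k" "Poly_Mapping.lookup m j = Suc n" by (metis not0_implies_Suc)
    have "(\<Prod>i\<in>UNIV. Var i ^ Poly_Mapping.lookup m i) =
        Var j ^ Suc n * (\<Prod>i\<in>UNIV - {j}. Var i ^ Poly_Mapping.lookup m i)"
      using j(2) prod.remove[of UNIV j "\<lambda>i. Var i ^ Poly_Mapping.lookup m i"] by simp
    then have C: "Poly_Mapping.single m c
        = (Const c * Var j ^ n * (\<Prod>i\<in>UNIV - {j}. Var i ^ Poly_Mapping.lookup m i)) * Var j" (is "_ = ?C * Var j")
      unfolding single_as_product by (simp only: power_Suc mult_ac)
    have e: "poly3_eval (Poly_Mapping.single m c) ?e = 0"
      unfolding C poly3_eval_simps using j(1) by (simp add: axis_def)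
    have "?C * Var j \<in> L" using vars[OF j(1)] by (rule poly_ideal_mult[OF L])
    then show ?thesis unfolding e unfolding C by (simp add: Const_0)
  next
    case False
    then have m0: "Poly_Mapping.lookup m j = 0" if "j \<noteq> k" for j using that by blast
    have "(\<Prod>i\<in>UNIV. Var i ^ Poly_Mapping.lookup m i) = Var k ^ Poly_Mapping.lookup m k *
        (\<Prod>i\<in>UNIV - {k}. Var i ^ Poly_Mapping.lookup m i)"
      using prod.remove[of UNIV k "\<lambda>i. Var i ^ Poly_Mapping.lookup m i"] by simp
    also have "(\<Prod>i\<in>UNIV - {k}. Var i ^ Poly_Mapping.lookup m i) = 1"
      using m0 by (intro prod.neutral) simp
    also have "Poly_Mapping.lookup m k = d"
      using m m0 sum.remove[of UNIV k "Poly_Mapping.lookup m"] by simp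
    finally have "Poly_Mapping.single m c = Const c * Var k ^ d"
      unfolding single_as_product by simp
    then show ?thesis using poly_ideal_zero[OF L] by simp
  qed
  have "?D (\<Sum>m\<in>S. Poly_Mapping.single m (Poly_Mapping.lookup f m)) \<in> L" if "S \<subseteq> Poly_Mapping.keys f" for S
    using finite_subset[OF that finite_keys] that
  proof (induction S rule: finite_induct)
    case empty
    show ?case using poly_ideal_zero[OF L] by (simp add: Const_0)
  next
    case (insert m S)
    let ?s = "Poly_Mapping.single m (Poly_Mapping.lookup f m)"
      and ?t = "\<Sum>m\<in>S. Poly_Mapping.single m (Poly_Mapping.lookup f m)"
    have "?D ?s \<in> L" using insert f by (intro single) (auto simp: homogeneous_def)
    moreover have "?D ?t \<in> L" using insert by simp
    ultimately have "?D ?s + ?D ?t \<in> L" by (rule poly_ideal_add[OF L])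
    moreover have "?D ?s + ?D ?t = ?D (?s + ?t)"
      unfolding poly3_eval_simps(1) by (simp add: Const_add algebra_simps)
    ultimately have "?D (?s + ?t) \<in> L" by (simp only:)
    then show ?case using insert(1,2) by (simp only: sum.insert not_False_eq_True)
  qed
  from this[OF order_refl] have "?D f \<in> L" by (simp only: poly3_sum_of_terms[of f, symmetric])
  then show ?thesis using zero by (simp add: reduced_jet_def Const_0)
qed

text \<open>
  Modulo \<open>t\<close> and \<open>u^2\<close> a form is a combination of \<open>s^d\<close> and \<open>s^(d-1) u\<close>, and the jet determines
  both coefficients.
\<close>
lemma ideal_double_jet:
  assumes L: "poly_ideal L" and gens: "Var 2 \<in> L" "Var 3 * Var 3 \<in> L"
    and f: "homogeneous d f" and jet: "double_jet f"
  shows "f \<in> L"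
proof -
  obtain \<alpha> A B where F: "f = Const \<alpha> * Var 1 ^ d + Var 2 * A + Var 3 * B" "homogeneous (d - 1) B"
    using homogeneous_decomposition[OF f] by metis
  have zero: "\<alpha> = 0" "poly3_eval B (axis 1 1) = 0"
    using jet unfolding double_jet_def epsilon_square_dvd_iff F(1)
    by (simp_all add: start_along[OF tangent_arc_start])
  obtain \<beta> C D where B: "B = Const \<beta> * Var 1 ^ (d - 1) + Var 2 * C + Var 3 * D"
    using homogeneous_decomposition[OF F(2)] by metis
  have "\<beta> = 0" using zero(2) unfolding B by (simp add: axis_def)
  then have "f = (A + Var 3 * C) * Var 2 + D * (Var 3 * Var 3)"
    unfolding F(1) B by (simp add: zero(1) Const_0 algebra_simps)
  then show ?thesis using gens by (simp add: poly_ideal_add[OF L] poly_ideal_mult[OF L])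
qed

lemma ideal_fat_jet:
  assumes L: "poly_ideal L" and gens: "Var 2 * Var 2 \<in> L" "Var 2 * Var 3 \<in> L" "Var 3 * Var 3 \<in> L"
    and f: "homogeneous d f" and jet: "fat_jet f"
  shows "f \<in> L"
proof -
  obtain \<alpha> A B where F: "f = Const \<alpha> * Var 1 ^ d + Var 2 * A + Var 3 * B"
    "homogeneous (d - 1) A" "homogeneous (d - 1) B"
    using homogeneous_decomposition[OF f] by metis
  have zero: "\<alpha> = 0" "poly3_eval A (axis 1 1) = 0" "poly3_eval B (axis 1 1) = 0"
    using jet unfolding fat_jet_def epsilon_square_dvd_iff F(1)
    by (simp_all add: start_along[OF tangent_arc_start])
  obtain \<beta> C D where B: "B = Const \<beta> * Var 1 ^ (d - 1) + Var 2 * C + Var 3 * D"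
    using homogeneous_decomposition[OF F(3)] by metis
  obtain \<beta>' C' D' where A: "A = Const \<beta>' * Var 1 ^ (d - 1) + Var 2 * C' + Var 3 * D'"
    using homogeneous_decomposition[OF F(2)] by metis
  have "\<beta> = 0" "\<beta>' = 0" using zero(2,3) unfolding A B by (simp_all add: axis_def)
  then have "f = C' * (Var 2 * Var 2) + (D' + C) * (Var 2 * Var 3) + D * (Var 3 * Var 3)"
    unfolding F(1) A B by (simp add: zero(1) Const_0 algebra_simps)
  then show ?thesis using gens by (simp add: poly_ideal_add[OF L] poly_ideal_mult[OF L])
qed

text \<open>
  The generators imply \<open>u^3 = stu = 0\<close>, so a form reduces to \<open>s^d\<close>, \<open>s^(d-1) t\<close>, \<open>s^(d-1) u\<close>,
  \<open>s^(d-2) u^2\<close>. The second and the fourth agree modulo \<open>st - u^2\<close> and restrict to the same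
  power of \<open>\<epsilon>\<close>; the jet determines the three remaining coefficients.
\<close>
lemma ideal_triple_jet:
  assumes L: "poly_ideal L"
    and gens: "Var 2 * Var 2 \<in> L" "Var 2 * Var 3 \<in> L" "Var 1 * Var 2 - Var 3 * Var 3 \<in> L"
    and f: "homogeneous d f" and jet: "triple_jet f"
  shows "f \<in> L"
proof -
  obtain \<alpha> A B where F: "f = Const \<alpha> * Var 1 ^ d + Var 2 * A + Var 3 * B"
    "homogeneous (d - 1) A" "homogeneous (d - 1) B" "d = 0 \<Longrightarrow> A = 0 \<and> B = 0"
    using homogeneous_decomposition[OF f] by metis
  obtain \<beta>' C' D' where A: "A = Const \<beta>' * Var 1 ^ (d - 1) + Var 2 * C' + Var 3 * D'"
    using homogeneous_decomposition[OF F(2)] by metis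
  obtain \<beta> C D where B: "B = Const \<beta> * Var 1 ^ (d - 1) + Var 2 * C + Var 3 * D"
    "homogeneous (d - 1 - 1) D" "d - 1 = 0 \<Longrightarrow> D = 0"
    using homogeneous_decomposition[OF F(3)] by metis
  obtain \<kappa> G H where D: "D = Const \<kappa> * Var 1 ^ (d - 1 - 1) + Var 2 * G + Var 3 * H"
    using homogeneous_decomposition[OF B(2)] by metis
  have "\<alpha> = 0"
    using jet unfolding triple_jet_def epsilon_cube_dvd_iff F(1) by (simp add: power2_eq_square)
  have ev: "Polynomial.coeff (along parabola A) 0 = \<beta>'" "Polynomial.coeff (along parabola B) 0 = \<beta>"
    "Polynomial.coeff (along parabola D) 0 = \<kappa>"
    unfolding start_along[OF parabola_start] A B D by (simp_all add: axis_def)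
  have "along parabola f = [:\<alpha>:] + \<epsilon> * (\<epsilon> * along parabola A) + \<epsilon> * along parabola B"
    unfolding F(1) by (simp add: power2_eq_square)
  moreover have "along parabola B = [:\<beta>:] + \<epsilon> * (\<epsilon> * along parabola C) + \<epsilon> * along parabola D"
    unfolding B(1) by (simp add: power2_eq_square)
  ultimately have "\<beta> = 0" "\<beta>' + \<kappa> = 0"
    using jet unfolding triple_jet_def epsilon_cube_dvd_iff
    by (simp_all add: numeral_2_eq_2 ev)
  then have \<beta>: "\<beta> = 0" "\<beta>' = - \<kappa>" by (simp_all add: eq_neg_iff_add_eq_0)
  have "Const \<kappa> * (Var 1 ^ (d - 1) * Var 2 - Var 1 ^ (d - 1 - 1) * (Var 3 * Var 3)) \<in> L"
  proof (cases "d - 1 = 0")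
    case True
    then have "D = 0" by (rule B(3))
    then have "\<kappa> = 0" using ev(3) by simp
    then show ?thesis using poly_ideal_zero[OF L] by (simp add: Const_0)
  next
    case False
    then obtain n where "d - 1 = Suc n" by (metis not0_implies_Suc)
    then have eq: "Const \<kappa> * (Var 1 ^ (d - 1) * Var 2 - Var 1 ^ (d - 1 - 1) * (Var 3 * Var 3))
        = (Const \<kappa> * Var 1 ^ n) * (Var 1 * Var 2 - Var 3 * Var 3)"
      by (simp add: algebra_simps)
    show ?thesis unfolding eq by (rule poly_ideal_mult[OF L gens(3)])
  qed
  moreover have "f = C' * (Var 2 * Var 2) + (D' + C + Var 3 * G + H * Var 1) * (Var 2 * Var 3)
      - (H * Var 3) * (Var 1 * Var 2 - Var 3 * Var 3)
      - Const \<kappa> * (Var 1 ^ (d - 1) * Var 2 - Var 1 ^ (d - 1 - 1) * (Var 3 * Var 3))"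
    unfolding F(1) A B D by (simp add: \<open>\<alpha> = 0\<close> \<beta> Const_0 Const_uminus algebra_simps)
  ultimately show ?thesis
    using gens by (simp add: poly_ideal_add[OF L] poly_ideal_diff[OF L] poly_ideal_mult[OF L])
qed

abbreviation entry where "entry \<equiv> linear_form_matrix"

text \<open>
  Forms that do not vanish at \<open>v\<close> restrict to units along the arc, so it is enough to look at
  the generators of the ideal.
\<close>
lemma locally_in_jet:
  fixes v :: "complex^3"
  assumes minors: "\<And>i j k l. \<epsilon> ^ m dvd minor (\<lambda>i j. along \<gamma> (entry b i j)) i j k l"
    and v: "\<And>i. poly (\<gamma> i) 0 = v $ i" and f: "locally_in (segre_section b) v f"
  shows "\<epsilon> ^ m dvd along \<gamma> f"
proof -
  have start: "poly (along \<gamma> f) 0 = poly3_eval f v" for f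
  proof -
    have "(\<chi> i. poly (\<gamma> i) 0) = v" by (simp add: v vec_eq_iff)
    then show ?thesis by (simp add: poly_along)
  qed
  have "segre_section b \<subseteq> {f. \<epsilon> ^ m dvd along \<gamma> f}"
  proof (rule segre_subset)
    show "poly_ideal {f. \<epsilon> ^ m dvd along \<gamma> f}"
      unfolding poly_ideal_def by (auto intro: dvd_add dvd_mult)
    show "minor (entry b) i j k l \<in> {f. \<epsilon> ^ m dvd along \<gamma> f}" for i j k l
      using minors[of i j k l] by (simp add: minor_def)
  qed
  then obtain h where h: "poly3_eval h v \<noteq> 0" "\<epsilon> ^ m dvd along \<gamma> (h * f)"
    using f unfolding locally_in_def by blast
  then show ?thesis using cancel_mod_power[of "along \<gamma> h" m "along \<gamma> f"] start by simp
qed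

lemma standardI:
  assumes points: "\<And>v. v \<noteq> 0 \<Longrightarrow> rank_le_one (net b v) \<Longrightarrow> \<exists>k. v \<in> line_through (axis k 1)"
    and stalks: "\<And>k d f. homogeneous d f \<Longrightarrow> rank_le_one (b k) \<Longrightarrow>
      locally_in (segre_section b) (axis k 1) f \<longleftrightarrow> normal_stalk \<tau> k f"
    and outside: "\<And>k f. \<not> rank_le_one (b k) \<Longrightarrow> normal_stalk \<tau> k f"
  shows "standard (mat 1) \<tau> b"
  unfolding standard_def
proof (intro conjI allI impI)
  fix k d f assume f: "homogeneous d f"
  show "locally_in (segre_section b) (mat 1 *v axis k 1) f \<longleftrightarrow> normal_stalk \<tau> k (change (mat 1) f)"
  proof (cases "rank_le_one (b k)")
    case True
    then show ?thesis using stalks[OF f] by simp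
  next
    case False
    then have "locally_in (segre_section b) (axis k 1) 1" by (simp add: locally_in_one_iff net_axis)
    then have "locally_in (segre_section b) (axis k 1) f"
      using locally_in_mult[OF poly_ideal_segre, of b "axis k 1" 1 f] by simp
    then show ?thesis using outside[OF False] by simp
  qed
next
  fix v :: "complex^3" assume "v \<noteq> 0" "\<forall>k. v \<notin> line_through (mat 1 *v axis k 1)"
  then have "\<not> rank_le_one (net b v)" using points by auto
  then show "locally_in (segre_section b) v 1" by (simp add: locally_in_one_iff)
qed

lemma reduced_stalk:
  assumes "rank_le_one (b k)" "\<And>j. j \<noteq> k \<Longrightarrow> locally_in (segre_section b) (axis k 1) (Var j)"
    "homogeneous d f"
  shows "locally_in (segre_section b) (axis k 1) f \<longleftrightarrow> reduced_jet k f"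
proof
  assume "locally_in (segre_section b) (axis k 1) f"
  then show "reduced_jet k f"
    using locally_in_eval[of "segre_section b"] segre_vanishes_iff[of b "axis k 1"] assms(1)
    unfolding reduced_jet_def net_axis by blast
next
  assume "reduced_jet k f"
  then show "locally_in (segre_section b) (axis k 1) f"
    using ideal_mod_form[OF poly_ideal_locally_in[OF poly_ideal_segre] _ assms(3)] assms(2) by blast
qed

lemma entry_along: "along \<gamma> (entry b i j) = [:b 1 $ i $ j:] * \<gamma> 1 + [:b 2 $ i $ j:] * \<gamma> 2 + [:b 3 $ i $ j:] * \<gamma> 3"
  by (simp add: linear_form_matrix_def sum_3)

text \<open>
  Every net with a point of the section at the first basis matrix can be put in this form: row
  and column operations produce the first elementary matrix, and multiples of it are subtracted
  from the other two.
\<close>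
definition normalized :: "(3 \<Rightarrow> complex^3^3) \<Rightarrow> bool" where
  "normalized b \<longleftrightarrow> (\<forall>i j. b 1 $ i $ j = (if i = 1 \<and> j = 1 then 1 else 0)) \<and> b 2 $ 1 $ 1 = 0 \<and> b 3 $ 1 $ 1 = 0"

lemma minor_swap: "minor A j i k l = - minor A i j k l" "minor A i j l k = - minor A i j k l"
  by (simp_all add: minor_def algebra_simps)

text \<open>
  Nine of the minors determine the others up to sign.
\<close>
lemma all_minors:
  assumes P0: "P 0" and Pm: "\<And>x. P x \<Longrightarrow> P (- x)"
    and "P (minor A 1 2 1 2)" "P (minor A 1 2 1 3)" "P (minor A 1 2 2 3)"
      "P (minor A 1 3 1 2)" "P (minor A 1 3 1 3)" "P (minor A 1 3 2 3)"
      "P (minor A 2 3 1 2)" "P (minor A 2 3 1 3)" "P (minor A 2 3 2 3)"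
  shows "P (minor A i j k l)"
proof -
  have swap: "P (minor A j i k l)" "P (minor A i j l k)" if "P (minor A i j k l)" for i j k l
    unfolding minor_swap(1)[of A j i k l] minor_swap(2)[of A i j l k] using Pm[OF that] by blast+
  have row: "\<forall>i j. P (minor A i j k l)" if "P (minor A 1 2 k l)" "P (minor A 1 3 k l)" "P (minor A 2 3 k l)" for k l
    unfolding forall_3 minor_same by (intro conjI P0 that swap(1)[OF that(1)] swap(1)[OF that(2)] swap(1)[OF that(3)])
  have col: "\<forall>k l. P (minor A i j k l)" if "P (minor A i j 1 2)" "P (minor A i j 1 3)" "P (minor A i j 2 3)" for i j
    unfolding forall_3 minor_same by (intro conjI P0 that swap(2)[OF that(1)] swap(2)[OF that(2)] swap(2)[OF that(3)])
  show ?thesis using row[of k l] col[of 1 2] col[of 1 3] col[of 2 3] assms(3-) by blast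
qed

lemma rank_le_one_iff:
  "rank_le_one M \<longleftrightarrow>
     M $ 1 $ 1 * M $ 2 $ 2 = M $ 1 $ 2 * M $ 2 $ 1 \<and> M $ 1 $ 1 * M $ 2 $ 3 = M $ 1 $ 3 * M $ 2 $ 1 \<and>
     M $ 1 $ 2 * M $ 2 $ 3 = M $ 1 $ 3 * M $ 2 $ 2 \<and> M $ 1 $ 1 * M $ 3 $ 2 = M $ 1 $ 2 * M $ 3 $ 1 \<and>
     M $ 1 $ 1 * M $ 3 $ 3 = M $ 1 $ 3 * M $ 3 $ 1 \<and> M $ 1 $ 2 * M $ 3 $ 3 = M $ 1 $ 3 * M $ 3 $ 2 \<and>
     M $ 2 $ 1 * M $ 3 $ 2 = M $ 2 $ 2 * M $ 3 $ 1 \<and> M $ 2 $ 1 * M $ 3 $ 3 = M $ 2 $ 3 * M $ 3 $ 1 \<and>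
     M $ 2 $ 2 * M $ 3 $ 3 = M $ 2 $ 3 * M $ 3 $ 2" (is "_ \<longleftrightarrow> ?R")
proof
  assume "rank_le_one M"
  then have "minor (\<lambda>i j. M $ i $ j) i j k l = 0" for i j k l by (simp add: rank_le_one_def)
  then show ?R by (simp add: minor_def)
next
  assume R: ?R
  show "rank_le_one M"
    unfolding rank_le_one_def
    by (intro allI; rule all_minors[of "\<lambda>x. x = 0"]; (simp only: minor_def right_minus_eq R)?) simp_all
qed

text \<open>
  The hypothesis that the block of the third matrix vanishes makes the arc \<open>(1 : 0 : \<epsilon>)\<close> tangent
  to the section.
\<close>
lemma double_stalk:
  assumes b: "normalized b" and flat: "\<And>i j. i \<noteq> 1 \<Longrightarrow> j \<noteq> 1 \<Longrightarrow> b 3 $ i $ j = 0"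
    and gens: "locally_in (segre_section b) (axis 1 1) (Var 2)"
      "locally_in (segre_section b) (axis 1 1) (Var 3 * Var 3)"
    and f: "homogeneous d f"
  shows "locally_in (segre_section b) (axis 1 1) f \<longleftrightarrow> double_jet f"
proof
  assume f: "locally_in (segre_section b) (axis 1 1) f"
  have "\<epsilon> ^ 2 dvd minor (\<lambda>i j. along (tangent_arc 3) (entry b i j)) i j k l" for i j k l
    by (rule all_minors[of "\<lambda>P. \<epsilon> ^ 2 dvd P"]; simp only: epsilon_square_dvd_iff minor_def entry_along)
      (use b flat in \<open>simp_all add: normalized_def\<close>)
  then show "double_jet f"
    unfolding double_jet_def by (rule locally_in_jet[OF _ tangent_arc_start f])
next
  assume "double_jet f"
  then show "locally_in (segre_section b) (axis 1 1) f"
    using ideal_double_jet[OF poly_ideal_locally_in[OF poly_ideal_segre] _ _ f] gens by blast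
qed

lemma fat_stalk:
  assumes b: "normalized b" and flat: "\<And>i j. i \<noteq> 1 \<Longrightarrow> j \<noteq> 1 \<Longrightarrow> b 3 $ i $ j = 0"
     "\<And>i j. i \<noteq> 1 \<Longrightarrow> j \<noteq> 1 \<Longrightarrow> b 2 $ i $ j = 0"
    and gens: "Var 2 * Var 2 \<in> segre_section b" "Var 2 * Var 3 \<in> segre_section b" "Var 3 * Var 3 \<in> segre_section b"
    and f: "homogeneous d f"
  shows "locally_in (segre_section b) (axis 1 1) f \<longleftrightarrow> fat_jet f"
proof
  assume f: "locally_in (segre_section b) (axis 1 1) f"
  have "\<epsilon> ^ 2 dvd minor (\<lambda>i j. along (tangent_arc 3) (entry b i j)) i j k l"
    "\<epsilon> ^ 2 dvd minor (\<lambda>i j. along (tangent_arc 2) (entry b i j)) i j k l" for i j k l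
    by (rule all_minors[of "\<lambda>P. \<epsilon> ^ 2 dvd P"]; simp only: epsilon_square_dvd_iff minor_def entry_along;
      use b flat in \<open>simp add: normalized_def\<close>)+
  from locally_in_jet[OF this(1) tangent_arc_start f] locally_in_jet[OF this(2) tangent_arc_start f]
  show "fat_jet f" by (simp add: fat_jet_def)
next
  assume "fat_jet f"
  then show "locally_in (segre_section b) (axis 1 1) f"
    using ideal_fat_jet[OF poly_ideal_locally_in[OF poly_ideal_segre] _ _ _ f]
      gens[THEN locally_in_member] by blast
qed

lemma triple_stalk:
  assumes minors: "\<And>i j k l. \<epsilon> ^ 3 dvd minor (\<lambda>i j. along parabola (entry b i j)) i j k l"
    and gens: "Var 2 * Var 2 \<in> segre_section b" "Var 2 * Var 3 \<in> segre_section b"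
      "Var 1 * Var 2 - Var 3 * Var 3 \<in> segre_section b"
    and f: "homogeneous d f"
  shows "locally_in (segre_section b) (axis 1 1) f \<longleftrightarrow> triple_jet f"
proof
  assume f: "locally_in (segre_section b) (axis 1 1) f"
  show "triple_jet f"
    unfolding triple_jet_def by (rule locally_in_jet[OF minors parabola_start f])
next
  assume "triple_jet f"
  then show "locally_in (segre_section b) (axis 1 1) f"
    using ideal_triple_jet[OF poly_ideal_locally_in[OF poly_ideal_segre] _ _ _ f]
      gens[THEN locally_in_member] by blast
qed

section \<open>Equivalence of nets\<close>

definition row_operation :: "complex^3^3 \<Rightarrow> (3 \<Rightarrow> complex^3^3) \<Rightarrow> 3 \<Rightarrow> complex^3^3" where
  "row_operation P b k = P ** b k"

definition transposed :: "(3 \<Rightarrow> complex^3^3) \<Rightarrow> 3 \<Rightarrow> complex^3^3" where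
  "transposed b k = transpose (b k)"

lemma net_row_operation: "net (row_operation P b) v = P ** net b v"
  by (simp add: vec_eq_iff net_nth row_operation_def matrix_matrix_mult_def sum_3 algebra_simps)

lemma net_transposed: "net (transposed b) v = transpose (net b v)"
  by (simp add: vec_eq_iff net_nth transposed_def transpose_def)

lemma reparametrize_row_operation: "reparametrize g (row_operation P b) = row_operation P (reparametrize g b)"
  by (rule ext) (simp add: reparametrize_def net_row_operation row_operation_def)

lemma reparametrize_transposed: "reparametrize g (transposed b) = transposed (reparametrize g b)"
  by (rule ext) (simp add: reparametrize_def net_transposed transposed_def)

lemma row_operation_row_operation: "row_operation P (row_operation Q b) = row_operation (P ** Q) b"
  by (rule ext) (simp add: row_operation_def matrix_mul_assoc)

lemma row_operation_id: "row_operation (mat 1) b = b"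
  by (rule ext) (simp add: row_operation_def)

lemma transposed_transposed: "transposed (transposed b) = b"
  by (rule ext) (simp add: transposed_def)

lemma entry_row_operation: "entry (row_operation P b) i j = (\<Sum>a\<in>UNIV. Const (P $ i $ a) * entry b a j)"
  by (simp add: linear_form_matrix_def row_operation_def matrix_matrix_mult_def sum_3 Const_add Const_mult algebra_simps)

lemma minor_row_combination:
  "minor (\<lambda>i k. \<Sum>a\<in>UNIV. p i a * A a k) i j k l = (\<Sum>a\<in>UNIV. \<Sum>c\<in>UNIV. (p i a * p j c) * minor A a c k l)"
  by (simp add: minor_def sum_3 algebra_simps)

text \<open>
  A minor of \<open>P A\<close> is a combination of minors of \<open>A\<close>, by bilinearity in the two rows.
\<close>
lemma segre_row_operation_subset: "segre_section (row_operation P b) \<subseteq> segre_section b"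
proof (rule segre_subset[OF poly_ideal_segre])
  fix i j k l
  have "minor (entry (row_operation P b)) i j k l =
    (\<Sum>a\<in>UNIV. \<Sum>c\<in>UNIV. (Const (P $ i $ a) * Const (P $ j $ c)) * minor (entry b) a c k l)"
    using minor_row_combination[of "\<lambda>i a. Const (P $ i $ a)" "entry b" i j k l]
    by (simp only: minor_def entry_row_operation)
  also have "\<dots> \<in> segre_section b"
    by (intro poly_ideal_sum[OF poly_ideal_segre] poly_ideal_mult[OF poly_ideal_segre] minor_in_segre)
  finally show "minor (entry (row_operation P b)) i j k l \<in> segre_section b" .
qed

lemma segre_row_operation:
  assumes "invertible P"
  shows "segre_section (row_operation P b) = segre_section b"
proof
  obtain Q where "Q ** P = mat 1" using assms by (auto simp: invertible_def)
  then have "segre_section b = segre_section (row_operation Q (row_operation P b))" by (simp add: row_operation_row_operation row_operation_id)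
  also have "\<dots> \<subseteq> segre_section (row_operation P b)" by (rule segre_row_operation_subset)
  finally show "segre_section b \<subseteq> segre_section (row_operation P b)" .
qed (rule segre_row_operation_subset)

lemma segre_transposed_subset: "segre_section (transposed b) \<subseteq> segre_section b"
proof (rule segre_subset[OF poly_ideal_segre])
  fix i j k l
  have "entry (transposed b) i j = entry b j i" for i j
    by (simp add: linear_form_matrix_def transposed_def transpose_def)
  then have "minor (entry (transposed b)) i j k l = minor (entry b) k l i j"
    by (simp add: minor_def mult.commute)
  then show "minor (entry (transposed b)) i j k l \<in> segre_section b" using minor_in_segre by simp
qed

lemma segre_transposed: "segre_section (transposed b) = segre_section b"
  using segre_transposed_subset[of b] segre_transposed_subset[of "transposed b"] by (simp add: transposed_transposed)

text \<open>
  Lines and conics are both parametrized by vectors that are quadratic in one variable. The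
  points with parameters \<open>0\<close> and \<open>1\<close> suffice to detect that such a curve moves in the plane.
\<close>
definition no_curve :: "(3 \<Rightarrow> complex^3^3) \<Rightarrow> bool" where
  "no_curve b \<longleftrightarrow> (\<forall>u v w. (\<forall>x. u + x *s v + x ^ 2 *s w \<noteq> 0 \<and> rank_le_one (net b (u + x *s v + x ^ 2 *s w)))
     \<longrightarrow> (\<exists>c. u + v + w = c *s u))"

definition admissible :: "(3 \<Rightarrow> complex^3^3) \<Rightarrow> bool" where
  "admissible b \<longleftrightarrow> (\<forall>v. net b v = 0 \<longrightarrow> v = 0) \<and> no_curve b"

text \<open>
  The property of a net that the classification establishes; it is invariant under coordinate
  changes and row operations and transposition, which allows normal forms to be reached step by
  step.
\<close>
definition standardizable :: "(3 \<Rightarrow> complex^3^3) \<Rightarrow> bool" where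
  "standardizable b \<longleftrightarrow> (\<exists>g \<tau>. invertible g \<and> standard (mat 1) \<tau> (reparametrize g b))"

lemma standardizableI: "standard (mat 1) \<tau> b \<Longrightarrow> standardizable b"
  unfolding standardizable_def by (intro exI[of _ "mat 1"] exI[of _ \<tau>]) (simp add: invertible_def)

lemma standardizable_reparametrize:
  assumes "invertible g" "standardizable (reparametrize g b)"
  shows "standardizable b"
proof -
  obtain h \<tau> where "invertible h" "standard (mat 1) \<tau> (reparametrize (g ** h) b)"
    using assms(2) by (auto simp: standardizable_def reparametrize_reparametrize)
  then show ?thesis using assms(1) invertible_mult unfolding standardizable_def by blast
qed

lemma standardizable_row_operation:
  assumes "invertible P" "standardizable (row_operation P b)"
  shows "standardizable b"
  using assms unfolding standardizable_def standard_def by (simp add: reparametrize_row_operation segre_row_operation)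

lemma standardizable_transposed: "standardizable (transposed b) \<Longrightarrow> standardizable b"
  unfolding standardizable_def standard_def by (simp add: reparametrize_transposed segre_transposed)

lemma rank_le_one_cong:
  assumes "segre_section b = segre_section b'"
  shows "rank_le_one (net b v) \<longleftrightarrow> rank_le_one (net b' v)"
  using segre_vanishes_iff[of b v] segre_vanishes_iff[of b' v] assms by simp

lemma rank_le_one_row_operation: "invertible P \<Longrightarrow> rank_le_one (net (row_operation P b) v) \<longleftrightarrow> rank_le_one (net b v)"
  by (rule rank_le_one_cong[OF segre_row_operation])

lemma rank_le_one_transposed: "rank_le_one (net (transposed b) v) \<longleftrightarrow> rank_le_one (net b v)"
  by (rule rank_le_one_cong[OF segre_transposed])

lemma admissible_reparametrize:
  assumes g: "invertible g" and b: "admissible b"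
  shows "admissible (reparametrize g b)"
proof -
  obtain h where h: "h ** g = mat 1" using g by (auto simp: invertible_def)
  have gz: "g *v v = 0 \<longleftrightarrow> v = 0" for v
    using h by (metis matrix_vector_mul_assoc matrix_vector_mul_lid matrix_vector_mult_0_right)
  have lin: "g *v (u + x *s v + y *s w) = g *v u + x *s (g *v v) + y *s (g *v w)" for u v w x y
    by (simp only: matrix_vector_right_distrib vector_scalar_commute)
  have "no_curve (reparametrize g b)"
    unfolding no_curve_def
  proof (intro allI impI)
    fix u v w
    assume *: "\<forall>x. u + x *s v + x ^ 2 *s w \<noteq> 0 \<and> rank_le_one (net (reparametrize g b) (u + x *s v + x ^ 2 *s w))"
    have "\<exists>c. g *v u + g *v v + g *v w = c *s (g *v u)"
      using b[unfolded admissible_def no_curve_def, THEN conjunct2, rule_format, of "g *v u" "g *v v" "g *v w"] *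
      unfolding net_reparametrize lin[symmetric] gz by blast
    then obtain c where "g *v (u + v + w) = g *v (c *s u)"
      by (auto simp: matrix_vector_right_distrib vector_scalar_commute)
    then have "u + v + w = c *s u" using h by (metis matrix_vector_mul_assoc matrix_vector_mul_lid)
    then show "\<exists>c. u + v + w = c *s u" ..
  qed
  then show ?thesis using b gz unfolding admissible_def net_reparametrize by blast
qed

lemma no_curve_cong:
  assumes "\<And>v. rank_le_one (net b v) \<longleftrightarrow> rank_le_one (net b' v)" "no_curve b"
  shows "no_curve b'"
  using assms unfolding no_curve_def by simp

lemma admissible_row_operation:
  assumes P: "invertible P" and b: "admissible b"
  shows "admissible (row_operation P b)"
proof -
  obtain Q where Q: "Q ** P = mat 1" using P by (auto simp: invertible_def)
  have "net b v = 0" if "net (row_operation P b) v = 0" for v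
  proof -
    have "Q ** (P ** net b v) = 0" using that by (simp add: net_row_operation)
    then show ?thesis by (simp add: matrix_mul_assoc Q)
  qed
  then show ?thesis
    using b no_curve_cong[of b "row_operation P b"] rank_le_one_row_operation[OF P] unfolding admissible_def by blast
qed

lemma admissible_transposed:
  assumes "admissible b"
  shows "admissible (transposed b)"
proof -
  have "net b v = 0" if "net (transposed b) v = 0" for v
    using that by (simp add: net_transposed vec_eq_iff transpose_def)
  then show ?thesis
    using assms no_curve_cong[of b "transposed b"] rank_le_one_transposed unfolding admissible_def by blast
qed

section \<open>Rank one matrices\<close>

definition outer :: "complex^3 \<Rightarrow> complex^3 \<Rightarrow> complex^3^3" where
  "outer x y = (\<chi> i j. x $ i * y $ j)"

lemma outer_nth [simp]: "outer x y $ i $ j = x $ i * y $ j"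
  by (simp add: outer_def)

lemma rank_le_one_outer: "rank_le_one (outer x y)"
  by (simp add: rank_le_one_def minor_def)

lemma rank_le_oneE:
  assumes "rank_le_one M"
  obtains x y where "M = outer x y"
proof (cases "M = 0")
  case True
  then have "M = outer 0 0" by (simp add: vec_eq_iff)
  then show thesis by (rule that)
next
  case False
  then obtain i j where ij: "M $ i $ j \<noteq> 0" by (auto simp: vec_eq_iff)
  have "M = outer (\<chi> a. M $ a $ j) (\<chi> c. M $ i $ c / M $ i $ j)"
  proof -
    have "M $ a $ c * M $ i $ j = M $ a $ j * M $ i $ c" for a c
      using assms[unfolded rank_le_one_def, rule_format, of a i c j] by (simp add: minor_def)
    then show ?thesis using ij by (simp add: vec_eq_iff field_simps)
  qed
  then show thesis by (rule that)
qed

lemma mult_outer: "P ** outer x y = outer (P *v x) y"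
  by (simp add: vec_eq_iff matrix_matrix_mult_def matrix_vector_mult_def sum_3 algebra_simps)

lemma transpose_outer: "transpose (outer x y) = outer y x"
  by (simp add: vec_eq_iff transpose_def)

definition parallel :: "complex^3 \<Rightarrow> complex^3 \<Rightarrow> bool" where
  "parallel x y \<longleftrightarrow> (\<forall>i j. x $ i * y $ j = x $ j * y $ i)"

lemma parallel_multiple:
  assumes "parallel x y" "x \<noteq> 0"
  obtains c where "y = c *s x"
proof -
  obtain i where i: "x $ i \<noteq> 0" using assms(2) by (auto simp: vec_eq_iff)
  have "x $ i * y $ j = x $ j * y $ i" for j using assms(1) by (simp add: parallel_def)
  then have "y = (y $ i / x $ i) *s x" using i by (simp add: vec_eq_iff field_simps)
  then show thesis by (rule that)
qed

lemma parallel_scale: "parallel x (c *s x)"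
  by (simp add: parallel_def)

definition columns :: "complex^3 \<Rightarrow> complex^3 \<Rightarrow> complex^3 \<Rightarrow> complex^3^3" where
  "columns x y z = (\<chi> i j. if j = 1 then x $ i else if j = 2 then y $ i else z $ i)"

lemma columns_axis [simp]:
  "columns x y z *v axis 1 1 = x" "columns x y z *v axis 2 1 = y" "columns x y z *v axis 3 1 = z"
  by (simp_all add: vec_eq_iff columns_def matrix_vector_mult_def sum_3 axis_def)

lemma column_columns [simp]:
  "column 1 (columns x y z) = x" "column 2 (columns x y z) = y" "column 3 (columns x y z) = z"
  by (simp_all add: vec_eq_iff columns_def column_def)

lemma det_columns:
  "det (columns x y z) = x $ 1 * (y $ 2 * z $ 3 - y $ 3 * z $ 2) - x $ 2 * (y $ 1 * z $ 3 - y $ 3 * z $ 1)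
    + x $ 3 * (y $ 1 * z $ 2 - y $ 2 * z $ 1)"
  by (simp add: det_3 columns_def algebra_simps)

text \<open>
  Expanding the determinant along a third column shows that some coordinate vector completes the
  basis.
\<close>
lemma ex_basis_two:
  assumes "\<not> parallel x y"
  obtains z where "invertible (columns x y z)"
proof -
  have "\<exists>k. det (columns x y (axis k 1)) \<noteq> 0"
  proof (rule ccontr)
    assume "\<not> ?thesis"
    then have *: "det (columns x y (axis 1 1)) = 0" "det (columns x y (axis 2 1)) = 0" "det (columns x y (axis 3 1)) = 0"
      by blast+
    have "x $ 1 * y $ 2 = x $ 2 * y $ 1" "x $ 1 * y $ 3 = x $ 3 * y $ 1" "x $ 2 * y $ 3 = x $ 3 * y $ 2"
      using * unfolding det_columns by (simp_all add: axis_def)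
    then have "parallel x y" unfolding parallel_def forall_3 by simp
    with assms show False ..
  qed
  then show thesis using that by (auto simp: invertible_det_nz)
qed

lemma ex_basis_one:
  assumes "x \<noteq> 0"
  obtains y z where "invertible (columns x y z)"
proof -
  have "\<exists>k. \<not> parallel x (axis k 1)"
  proof (rule ccontr)
    assume "\<not> ?thesis"
    then have "parallel x (axis 1 1)" "parallel x (axis 2 1)" by blast+
    then have "x = 0" unfolding parallel_def forall_3 by (simp add: vec_eq_iff forall_3 axis_def)
    with assms show False ..
  qed
  then show thesis using that ex_basis_two by blast
qed

lemma invertible_inverse:
  assumes "invertible P"
  obtains Q where "invertible Q" "Q ** P = mat 1" "P ** Q = mat 1"
  using assms unfolding invertible_def by blast

lemma ex_moving_pair:
  assumes "\<not> parallel x y"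
  obtains P :: "complex^3^3" where "invertible P" "P *v x = axis 1 1" "P *v y = axis 2 1"
proof -
  obtain z where "invertible (columns x y z)" using ex_basis_two[OF assms] .
  then obtain P where P: "invertible P" "P ** columns x y z = mat 1"
    using invertible_inverse by metis
  have "P *v (columns x y z *v axis k 1) = axis k 1" for k by (simp add: matrix_vector_mul_assoc P(2))
  from this[of 1] this[of 2] P(1) show thesis using that by simp
qed

lemma columns_dependent:
  assumes "\<not> invertible (columns x y z)" "\<not> parallel x y"
  obtains \<alpha> \<beta> where "z = \<alpha> *s x + \<beta> *s y"
proof -
  obtain w where w: "invertible (columns x y w)" using ex_basis_two[OF assms(2)] .
  then obtain h where h: "columns x y w ** h = mat 1" by (auto simp: invertible_def)
  define c where "c = h *v z"
  have "z = columns x y w *v c" by (simp add: c_def matrix_vector_mul_assoc h)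
  then have z: "z = c $ 1 *s x + c $ 2 *s y + c $ 3 *s w"
    by (simp add: vec_eq_iff columns_def matrix_vector_mult_def sum_3 mult.commute)
  have "det (columns x y z) = c $ 3 * det (columns x y w)"
    unfolding det_columns by (subst (1 2 3 4 5 6) z) (simp add: algebra_simps)
  then have "c $ 3 = 0" using assms(1) w by (simp add: invertible_det_nz)
  then show thesis using that[of "c $ 1" "c $ 2"] z by simp
qed

text \<open>
  A line is a curve with vanishing quadratic coefficient. It passes through the origin only if
  its two vectors are parallel.
\<close>
lemma no_line:
  assumes b: "admissible b" and u: "u \<noteq> 0" and rank: "\<And>x. rank_le_one (net b (u + x *s v))"
  shows "parallel u v"
proof (rule ccontr)
  assume np: "\<not> parallel u v"
  have nz: "u + x *s v \<noteq> 0" for x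
  proof
    assume "u + x *s v = 0"
    then have "u = (- x) *s v" by (simp add: eq_neg_iff_add_eq_0 vec.scale_minus_left)
    then show False using np by (simp add: parallel_def)
  qed
  have "\<exists>c. u + v + 0 = c *s u"
    using b[unfolded admissible_def no_curve_def, THEN conjunct2, rule_format, of u v 0] rank nz by simp
  then obtain c where "v = c *s u - u" by (auto simp: eq_diff_eq add.commute)
  then have "v = (c - 1) *s u" by (simp only: vec.scale_left_diff_distrib vec.scale_one)
  then show False using np parallel_scale[of u "c - 1"] by metis
qed

lemma no_line_axis:
  assumes b: "admissible b" and ij: "i \<noteq> j" and rank: "\<And>x. rank_le_one (b i + mscale x (b j))"
  shows False
proof -
  have "parallel (axis i 1) (axis j 1 :: complex^3)"
    using rank by (intro no_line[OF b]) (simp_all add: axis_eq_0_iff net_add net_scale net_axis)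
  then have "(axis i 1 :: complex^3) $ i * (axis j 1 :: complex^3) $ j = (axis i 1 :: complex^3) $ j * (axis j 1 :: complex^3) $ i"
    unfolding parallel_def by blast
  then show False using ij by (simp add: axis_def)
qed

section \<open>Sections with at least two points\<close>

lemma on_axis_line:
  assumes "\<And>j. j \<noteq> k \<Longrightarrow> v $ j = 0"
  shows "(v :: complex^3) \<in> line_through (axis k 1)"
proof -
  have "v = v $ k *s axis k 1" using assms by (auto simp: vec_eq_iff axis_def)
  then show ?thesis unfolding line_through_def by (rule range_eqI)
qed

lemma axis_in_line: "axis k 1 \<in> line_through (axis j 1 :: complex^3) \<Longrightarrow> k = j"
proof -
  assume "axis k 1 \<in> line_through (axis j 1 :: complex^3)"
  then obtain c where "axis k 1 = c *s (axis j 1 :: complex^3)" by (auto simp: line_through_def)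
  then have "(axis k 1 :: complex^3) $ k = (c *s axis j 1) $ k" by (rule arg_cong)
  then show "k = j" by (simp add: axis_def split: if_splits)
qed

lemma net_entries: "net b v $ i $ j = v $ 1 * b 1 $ i $ j + v $ 2 * b 2 $ i $ j + v $ 3 * b 3 $ i $ j"
  by (simp add: net_nth sum_3)

lemma entry_expand: "entry b i j = Const (b 1 $ i $ j) * Var 1 + Const (b 2 $ i $ j) * Var 2 + Const (b 3 $ i $ j) * Var 3"
  by (simp add: linear_form_matrix_def sum_3)

lemma locally_in_minor: "locally_in (segre_section b) v (minor (entry b) i j k l)"
  by (rule locally_in_member[OF minor_in_segre])

lemma locally_in_cancel_linear:
  assumes "locally_in (segre_section b) v (l * f)" "homogeneous d l" "poly3_eval l v \<noteq> 0"
  shows "locally_in (segre_section b) v f"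
  using locally_in_cancel[OF poly_ideal_segre assms(2,3,1)] .

lemma ideal_Const_cancel:
  assumes L: "poly_ideal L" and c: "c \<noteq> 0" and f: "Const c * f \<in> L"
  shows "f \<in> L"
proof -
  have "Const (1 / c) * (Const c * f) = Const (1 / c * c) * f" by (simp only: Const_mult mult.assoc)
  also have "\<dots> = f" using c by (simp add: Const_1)
  finally have "Const (1 / c) * (Const c * f) = f" .
  then show ?thesis using poly_ideal_mult[OF L f, of "Const (1 / c)"] by (simp only:)
qed

lemma rank_le_one_outer_sum:
  assumes "parallel x x' \<or> parallel y y'" "x \<noteq> 0" "y \<noteq> 0"
  shows "rank_le_one (outer x y + mscale c (outer x' y'))"
proof -
  have "\<exists>p q. outer x y + mscale c (outer x' y') = outer p q"
    using assms(1)
  proof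
    assume "parallel x x'"
    then obtain a where "x' = a *s x" using assms(2) by (rule parallel_multiple)
    then have "outer x y + mscale c (outer x' y') = outer x (y + (c * a) *s y')"
      by (simp add: vec_eq_iff mscale_def algebra_simps)
    then show ?thesis by blast
  next
    assume "parallel y y'"
    then obtain a where "y' = a *s y" using assms(3) by (rule parallel_multiple)
    then have "outer x y + mscale c (outer x' y') = outer (x + (c * a) *s x') y"
      by (simp add: vec_eq_iff mscale_def algebra_simps)
    then show ?thesis by blast
  qed
  then show ?thesis using rank_le_one_outer by metis
qed

lemma outer_nonzero: "outer x y \<noteq> 0 \<Longrightarrow> x \<noteq> 0" "outer x y \<noteq> 0 \<Longrightarrow> y \<noteq> 0"
  by (auto simp: vec_eq_iff)

lemma admissible_nonzero:
  assumes "admissible b"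
  shows "b k \<noteq> 0"
proof
  assume "b k = 0"
  then have "net b (axis k 1) = 0" by (simp add: net_axis)
  then have "axis k 1 = (0 :: complex^3)" using assms unfolding admissible_def by blast
  then show False by (simp add: axis_eq_0_iff)
qed

text \<open>
  If the column spaces or the row spaces of the two matrices coincide, all matrices on the line
  joining them have rank at most one.
\<close>
lemma points_independent:
  assumes b: "admissible b" and ij: "i \<noteq> j" and bi: "b i = outer x y" and bj: "b j = outer x' y'"
  shows "\<not> parallel x x'" "\<not> parallel y y'"
proof -
  have "x \<noteq> 0" "y \<noteq> 0" using admissible_nonzero[OF b, of i] outer_nonzero unfolding bi by blast+
  then have "\<not> (parallel x x' \<or> parallel y y')"
    using no_line_axis[OF b ij] rank_le_one_outer_sum unfolding bi bj by blast
  then show "\<not> parallel x x'" "\<not> parallel y y'" by blast+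
qed

text \<open>
  The rows are \<open>s y1\<close>, \<open>t y2\<close>, \<open>u y3\<close> with pairwise independent vectors, so the minors span
  \<open>st\<close>, \<open>su\<close> and \<open>tu\<close>.
\<close>
lemma diagonal_rows_standard:
  assumes b: "admissible b" and rows: "\<And>k. b k = outer (axis k 1) (y k)"
  shows "standard (mat 1) Three_Reduced b"
proof -
  have product: "Var i * Var j \<in> segre_section b" if "i \<noteq> j" for i j
  proof -
    have "\<not> parallel (y i) (y j)" using points_independent(2)[OF b that rows rows] .
    then obtain k l where kl: "y i $ k * y j $ l - y i $ l * y j $ k \<noteq> 0"
      unfolding parallel_def by auto
    have e: "entry b i k = Const (y i $ k) * Var i" for i k
      using exhaust_3[of i] by (auto simp: entry_expand rows axis_def Const_0)
    have "minor (entry b) i j k l = Const (y i $ k * y j $ l - y i $ l * y j $ k) * (Var i * Var j)"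
      by (simp add: minor_def e Const_diff Const_mult algebra_simps)
    then show ?thesis
      using ideal_Const_cancel[OF poly_ideal_segre kl] minor_in_segre[of b i j k l] by simp
  qed
  show ?thesis
  proof (rule standardI)
    fix v :: "complex^3" assume v: "v \<noteq> 0" "rank_le_one (net b v)"
    have zero: "v $ i * v $ j = 0" if "i \<noteq> j" for i j
    proof -
      have "poly3_eval (Var i * Var j) v = 0"
        using v(2) product[OF that] segre_vanishes_iff[of b v] by blast
      then show ?thesis by simp
    qed
    obtain k where k: "v $ k \<noteq> 0" using v(1) by (auto simp: vec_eq_iff)
    then have "v $ j = 0" if "j \<noteq> k" for j using zero[OF that] by simp
    then show "\<exists>k. v \<in> line_through (axis k 1)" using on_axis_line by blast
  next
    fix k d f assume f: "homogeneous d f"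
    have "locally_in (segre_section b) (axis k 1) (Var j)" if "j \<noteq> k" for j
    proof (rule locally_in_cancel_linear[OF _ homogeneous_Var(1)[of k]])
      show "locally_in (segre_section b) (axis k 1) (Var k * Var j)"
        using product[of k j] that by (intro locally_in_member) simp
    qed (simp add: axis_def)
    then show "locally_in (segre_section b) (axis k 1) f \<longleftrightarrow> normal_stalk Three_Reduced k f"
      using f by (simp add: reduced_stalk rows rank_le_one_outer)
  next
    fix k f assume "\<not> rank_le_one (b k)"
    then show "normal_stalk Three_Reduced k f" by (simp add: rows rank_le_one_outer)
  qed
qed

lemma three_points_standardizable_left:
  assumes b: "admissible b" and rank: "\<And>k. b k = outer (x k) (y k)"
    and inv: "invertible (columns (x 1) (x 2) (x 3))"
  shows "standardizable b"
proof -
  obtain P where P: "invertible P" "P ** columns (x 1) (x 2) (x 3) = mat 1"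
    using invertible_inverse[OF inv] by metis
  have "P *v (columns (x 1) (x 2) (x 3) *v axis k 1) = axis k 1" for k
    by (simp add: matrix_vector_mul_assoc P(2))
  from this[of 1] this[of 2] this[of 3] have Px: "P *v x k = axis k 1" for k
    using exhaust_3[of k] by auto
  have "standard (mat 1) Three_Reduced (row_operation P b)"
    by (rule diagonal_rows_standard[OF admissible_row_operation[OF P(1) b], of y]) (simp add: row_operation_def rank mult_outer Px)
  then show ?thesis using standardizableI standardizable_row_operation[OF P(1)] by blast
qed

text \<open>
  The case of dependent columns and dependent rows is excluded: there the whole net lives on the
  span of two columns and two rows, and the section contains a conic.
\<close>
lemma three_points_standardizable:
  assumes b: "admissible b" and rank: "\<And>k. rank_le_one (b k)"
  shows "standardizable b"
proof -
  have "\<forall>k. \<exists>x y. b k = outer x y" using rank rank_le_oneE by metis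
  then obtain x y where xy: "\<And>k. b k = outer (x k) (y k)" by metis
  show ?thesis
  proof (cases "invertible (columns (x 1) (x 2) (x 3))")
    case True
    then show ?thesis using three_points_standardizable_left[OF b xy] by blast
  next
    case x_dep: False
    show ?thesis
    proof (cases "invertible (columns (y 1) (y 2) (y 3))")
      case True
      have "standardizable (transposed b)"
        using True by (intro three_points_standardizable_left[OF admissible_transposed[OF b], of y x])
          (simp_all add: transposed_def xy transpose_outer)
      then show ?thesis by (rule standardizable_transposed)
    next
      case False
      obtain \<alpha> \<beta> where x3: "x 3 = \<alpha> *s x 1 + \<beta> *s x 2"
        using columns_dependent[OF x_dep] points_independent(1)[OF b _ xy xy, of 1 2] by auto
      obtain \<alpha>' \<beta>' where y3: "y 3 = \<alpha>' *s y 1 + \<beta>' *s y 2"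
        using columns_dependent[OF False] points_independent(2)[OF b _ xy xy, of 1 2] by auto
      \<comment> \<open>On the span of two columns and two rows the determinant is
        \<open>(s + \<alpha> \<alpha>' u) (t + \<beta> \<beta>' u) - \<alpha> \<beta> \<alpha>' \<beta>' u^2\<close>; the conic is parametrized by \<open>u\<close>, with second factor \<open>1\<close>.\<close>
      define u :: "complex^3" where "u = vector [0, 1, 0]"
      define v :: "complex^3" where "v = vector [- (\<alpha> * \<alpha>'), - (\<beta> * \<beta>'), 1]"
      define w :: "complex^3" where "w = vector [\<alpha> * \<beta> * \<alpha>' * \<beta>', 0, 0]"
      note defs = u_def v_def w_def
      have "u + t *s v + t ^ 2 *s w \<noteq> 0 \<and> rank_le_one (net b (u + t *s v + t ^ 2 *s w))" for t
      proof
        show "u + t *s v + t ^ 2 *s w \<noteq> 0"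
        proof
          assume "u + t *s v + t ^ 2 *s w = 0"
          then have "(u + t *s v + t ^ 2 *s w) $ 2 = 0" "(u + t *s v + t ^ 2 *s w) $ 3 = 0" by simp_all
          then show False by (simp add: defs)
        qed
        have "net b (u + t *s v + t ^ 2 *s w) =
            outer ((\<alpha> * \<beta>' * t) *s x 1 + x 2) ((\<beta> * \<alpha>' * t) *s y 1 + y 2)"
          unfolding vec_eq_iff net_entries
          by (simp add: defs xy x3 y3 algebra_simps power2_eq_square)
        then show "rank_le_one (net b (u + t *s v + t ^ 2 *s w))" by (simp add: rank_le_one_outer)
      qed
      then obtain c where "u + v + w = c *s u"
        using b unfolding admissible_def no_curve_def by blast
      then have "(u + v + w) $ 3 = (c *s u) $ 3" by simp
      then show ?thesis by (simp add: defs)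
    qed
  qed
qed

text \<open>
  At the first point the minors through the entry \<open>s\<close> have the form \<open>u (s c - u c')\<close>, where \<open>c\<close>
  runs through the entries of the third matrix in positions \<open>(2,3)\<close>, \<open>(3,2)\<close>, \<open>(3,3)\<close>. If one of
  these is nonzero, \<open>u\<close> belongs to the stalk; then so does \<open>t\<close>, because of the minor \<open>st - a
  u^2\<close>. The second point is symmetric.
\<close>
lemma two_reduced_standard:
  assumes b1: "b 1 = outer (axis 1 1) (axis 1 1)" and b2: "b 2 = outer (axis 2 1) (axis 2 1)"
    and b3: "b 3 $ 1 $ 1 = 0" "b 3 $ 2 $ 2 = 0"
    and points: "\<And>v. v \<noteq> 0 \<Longrightarrow> rank_le_one (net b v) \<Longrightarrow> v \<in> line_through (axis 1 1) \<or> v \<in> line_through (axis 2 1)"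
    and first: "b 3 $ 2 $ 3 \<noteq> 0 \<or> b 3 $ 3 $ 2 \<noteq> 0 \<or> b 3 $ 3 $ 3 \<noteq> 0"
    and second: "b 3 $ 1 $ 3 \<noteq> 0 \<or> b 3 $ 3 $ 1 \<noteq> 0 \<or> b 3 $ 3 $ 3 \<noteq> 0"
  shows "standard (mat 1) Two_Reduced b"
proof -
  let ?I = "segre_section b"
  note e = entry_expand b1 b2 b3 axis_def
  have m3: "Const (b 3 $ i $ j) * Var 3 * Var k - Const (b 3 $ i $ k * b 3 $ k $ j) * Var 3 * Var 3 \<in> ?I"
    if "k = 1 \<or> k = 2" "i \<noteq> k" "j \<noteq> k" "i = 3 \<or> j = 3" for i j k
  proof -
    have kk: "entry b k k = Var k" using that(1) by (auto simp: e Const_0 Const_1)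
    have off: "entry b p q = Const (b 3 $ p $ q) * Var 3" if "p \<noteq> q \<or> p = 3" for p q
      using that exhaust_3[of p] by (auto simp: e Const_0)
    have "minor (entry b) k i k j = Const (b 3 $ i $ j) * Var 3 * Var k - Const (b 3 $ i $ k * b 3 $ k $ j) * Var 3 * Var 3"
    proof -
      have "i \<noteq> j \<or> i = 3" using that exhaust_3[of i] exhaust_3[of j] by auto
      then have "entry b i j = Const (b 3 $ i $ j) * Var 3" by (rule off)
      moreover have "entry b k j = Const (b 3 $ k $ j) * Var 3" "entry b i k = Const (b 3 $ i $ k) * Var 3"
        using that(2,3) off[of k j] off[of i k] by simp_all
      ultimately show ?thesis unfolding minor_def kk Const_mult by (simp only: mult_ac)
    qed
    then show ?thesis using minor_in_segre[of b k i k j] by simp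
  qed
  have u: "locally_in ?I (axis k 1) (Var 3)"
    if k: "k = 1 \<or> k = 2" and ij: "i \<noteq> k" "j \<noteq> k" "i = 3 \<or> j = 3" and nz: "b 3 $ i $ j \<noteq> 0" for i j k
  proof (rule locally_in_cancel_linear)
    let ?l = "Const (b 3 $ i $ j) * Var k - Const (b 3 $ i $ k * b 3 $ k $ j) * Var 3"
    show "locally_in ?I (axis k 1) (?l * Var 3)"
      using m3[OF k ij] by (intro locally_in_member) (simp add: algebra_simps)
    show "homogeneous 1 ?l" by (intro homogeneous_diff homogeneous_mult_Const homogeneous_Var)
    show "poly3_eval ?l (axis k 1) \<noteq> 0" using k nz by (auto simp: axis_def)
  qed
  have V3: "locally_in ?I (axis 1 1) (Var 3)" "locally_in ?I (axis 2 1) (Var 3)"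
  proof -
    have "b 3 $ 2 $ 3 \<noteq> 0 \<Longrightarrow> locally_in ?I (axis 1 1) (Var 3)" by (rule u[of 1 2 3]) simp_all
    moreover have "b 3 $ 3 $ 2 \<noteq> 0 \<Longrightarrow> locally_in ?I (axis 1 1) (Var 3)" by (rule u[of 1 3 2]) simp_all
    moreover have "b 3 $ 3 $ 3 \<noteq> 0 \<Longrightarrow> locally_in ?I (axis 1 1) (Var 3)" by (rule u[of 1 3 3]) simp_all
    ultimately show "locally_in ?I (axis 1 1) (Var 3)" using first by blast
    have "b 3 $ 1 $ 3 \<noteq> 0 \<Longrightarrow> locally_in ?I (axis 2 1) (Var 3)" by (rule u[of 2 1 3]) simp_all
    moreover have "b 3 $ 3 $ 1 \<noteq> 0 \<Longrightarrow> locally_in ?I (axis 2 1) (Var 3)" by (rule u[of 2 3 1]) simp_all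
    moreover have "b 3 $ 3 $ 3 \<noteq> 0 \<Longrightarrow> locally_in ?I (axis 2 1) (Var 3)" by (rule u[of 2 3 3]) simp_all
    ultimately show "locally_in ?I (axis 2 1) (Var 3)" using second by blast
  qed
  have st: "Var 1 * Var 2 - Const (b 3 $ 1 $ 2 * b 3 $ 2 $ 1) * Var 3 * Var 3 \<in> ?I"
    using minor_in_segre[of b 1 2 1 2] by (simp add: minor_def e Const_0 Const_1 Const_mult algebra_simps)
  have st': "locally_in ?I (axis k 1) (Var 1 * Var 2)" if "locally_in ?I (axis k 1) (Var 3)" for k
  proof -
    have "locally_in ?I (axis k 1) ((Var 1 * Var 2 - Const (b 3 $ 1 $ 2 * b 3 $ 2 $ 1) * Var 3 * Var 3)
        + (Const (b 3 $ 1 $ 2 * b 3 $ 2 $ 1) * Var 3) * Var 3)"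
      by (intro locally_in_add[OF poly_ideal_segre] locally_in_mult[OF poly_ideal_segre] that
          locally_in_member[OF st])
    then show ?thesis by simp
  qed
  have V2: "locally_in ?I (axis 1 1) (Var 2)"
    by (rule locally_in_cancel_linear[OF st'[OF V3(1)] homogeneous_Var(1)]) (simp add: axis_def)
  have V1: "locally_in ?I (axis 2 1) (Var 1)"
  proof (rule locally_in_cancel_linear[OF _ homogeneous_Var(1)[of 2]])
    show "locally_in ?I (axis 2 1) (Var 2 * Var 1)" using st'[OF V3(2)] by (simp add: mult.commute)
  qed (simp add: axis_def)
  show ?thesis
  proof (rule standardI)
    fix k d f assume f: "homogeneous d f" and "rank_le_one (b k)"
    then have k: "k = 1 \<or> k = 2"
      using points[of "axis k 1"] axis_in_line by (auto simp: net_axis axis_eq_0_iff)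
    then have "locally_in ?I (axis k 1) (Var j)" if "j \<noteq> k" for j
      using V1 V2 V3 exhaust_3[of j] that by auto
    then show "locally_in ?I (axis k 1) f \<longleftrightarrow> normal_stalk Two_Reduced k f"
      using f k by (auto simp: reduced_stalk b1 b2 rank_le_one_outer)
  next
    fix k f assume "\<not> rank_le_one (b k)"
    then have "k \<noteq> 1" "k \<noteq> 2" using rank_le_one_outer by (auto simp: b1 b2)
    then show "normal_stalk Two_Reduced k f" by simp
  qed (use points in blast)
qed

text \<open>
  When the three entries that could make the first point reduced vanish, the minors are \<open>st - a
  c u^2\<close>, multiples of \<open>u^2\<close> and multiples of \<open>tu\<close>. Not all of these multiples are zero, since
  otherwise the section contains a conic or a line; so \<open>t\<close>, \<open>u^2\<close> generate the stalk at the
  first point and \<open>s\<close>, \<open>u\<close> the one at the second.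
\<close>
lemma double_plus_reduced_standard:
  assumes b: "admissible b"
    and b1: "b 1 = outer (axis 1 1) (axis 1 1)" and b2: "b 2 = outer (axis 2 1) (axis 2 1)"
    and b3: "b 3 $ 1 $ 1 = 0" "b 3 $ 2 $ 2 = 0"
    and points: "\<And>v. v \<noteq> 0 \<Longrightarrow> rank_le_one (net b v) \<Longrightarrow> v \<in> line_through (axis 1 1) \<or> v \<in> line_through (axis 2 1)"
    and tangent: "b 3 $ 2 $ 3 = 0" "b 3 $ 3 $ 2 = 0" "b 3 $ 3 $ 3 = 0"
  shows "standard (mat 1) Double_Plus_Reduced b"
proof -
  let ?I = "segre_section b"
  note e = entry_expand b1 b2 b3 tangent axis_def
  let ?a = "b 3 $ 1 $ 2" and ?b = "b 3 $ 1 $ 3" and ?c = "b 3 $ 2 $ 1" and ?e = "b 3 $ 3 $ 1"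
  have be: "?b \<noteq> 0 \<or> ?e \<noteq> 0"
  proof (rule ccontr)
    assume *: "\<not> ?thesis"
    \<comment> \<open>The conic \<open>st = a c u^2\<close>, parametrized by \<open>u\<close> with \<open>t = 1\<close>.\<close>
    define u :: "complex^3" where "u = vector [0, 1, 0]"
    define v :: "complex^3" where "v = vector [0, 0, 1]"
    define w :: "complex^3" where "w = vector [?a * ?c, 0, 0]"
    note defs = u_def v_def w_def
    have "u + t *s v + t ^ 2 *s w \<noteq> 0 \<and> rank_le_one (net b (u + t *s v + t ^ 2 *s w))" for t
    proof
      show "u + t *s v + t ^ 2 *s w \<noteq> 0"
        by (auto simp: vec_eq_iff forall_3 defs)
      show "rank_le_one (net b (u + t *s v + t ^ 2 *s w))"
        unfolding rank_le_one_iff net_entries using *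
        by (simp add: defs b1 b2 b3 tangent axis_def power2_eq_square)
    qed
    then obtain c where "u + v + w = c *s u"
      using b unfolding admissible_def no_curve_def by blast
    then have "(u + v + w) $ 3 = (c *s u) $ 3" by simp
    then show False by (simp add: defs)
  qed
  have products: "?b * ?c \<noteq> 0 \<or> ?a * ?e \<noteq> 0 \<or> ?b * ?e \<noteq> 0"
  proof (rule ccontr)
    assume *: "\<not> ?thesis"
    then have cases: "?e = 0 \<and> ?c = 0 \<or> ?b = 0 \<and> ?a = 0" using be by auto
    \<comment> \<open>The line \<open>t = 0\<close>, on which only the first row or only the first column is nonzero.\<close>
    have "rank_le_one (b 1 + mscale x (b 3))" for x
      unfolding rank_le_one_iff using cases by (auto simp: b1 b3 tangent axis_def mscale_def)
    then show False using no_line_axis[OF b, of 1 3] by simp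
  qed
  have "Const (?b * ?c) * (Var 3 * Var 3) \<in> ?I" "Const (?a * ?e) * (Var 3 * Var 3) \<in> ?I"
    "Const (?b * ?e) * (Var 3 * Var 3) \<in> ?I"
    using poly_ideal_uminus[OF poly_ideal_segre minor_in_segre[of b 1 2 1 3]]
      poly_ideal_uminus[OF poly_ideal_segre minor_in_segre[of b 1 3 1 2]]
      poly_ideal_uminus[OF poly_ideal_segre minor_in_segre[of b 1 3 1 3]]
    by (simp_all add: minor_def e Const_0 Const_1 Const_mult algebra_simps)
  then have V33: "Var 3 * Var 3 \<in> ?I" using products ideal_Const_cancel[OF poly_ideal_segre] by blast
  have "Const ?b * (Var 2 * Var 3) \<in> ?I" "Const ?e * (Var 2 * Var 3) \<in> ?I"
    using poly_ideal_uminus[OF poly_ideal_segre minor_in_segre[of b 1 2 2 3]]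
      poly_ideal_uminus[OF poly_ideal_segre minor_in_segre[of b 2 3 1 2]]
    by (simp_all add: minor_def e Const_0 Const_1 Const_mult algebra_simps)
  then have V23: "Var 2 * Var 3 \<in> ?I" using be ideal_Const_cancel[OF poly_ideal_segre] by blast
  have "Var 1 * Var 2 - Const (?a * ?c) * (Var 3 * Var 3) \<in> ?I"
    using minor_in_segre[of b 1 2 1 2] by (simp add: minor_def e Const_0 Const_1 Const_mult algebra_simps)
  from poly_ideal_add[OF poly_ideal_segre this poly_ideal_mult[OF poly_ideal_segre V33, of "Const (?a * ?c)"]]
  have V12: "Var 1 * Var 2 \<in> ?I" by simp
  have V2: "locally_in ?I (axis 1 1) (Var 2)"
    by (rule locally_in_cancel_linear[OF locally_in_member[OF V12] homogeneous_Var(1)]) (simp add: axis_def)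
  have V3: "locally_in ?I (axis 2 1) (Var 3)"
    by (rule locally_in_cancel_linear[OF locally_in_member[OF V23] homogeneous_Var(1)]) (simp add: axis_def)
  have V1: "locally_in ?I (axis 2 1) (Var 1)"
    by (rule locally_in_cancel_linear[OF _ homogeneous_Var(1)[of 2]])
      (use locally_in_member[OF V12] in \<open>simp_all add: mult.commute axis_def\<close>)
  have normal: "normalized b" by (simp add: normalized_def b1 b2 b3 axis_def)
  have flat: "b 3 $ i $ j = 0" if "i \<noteq> 1" "j \<noteq> 1" for i j
    using exhaust_3[of i] exhaust_3[of j] that b3 tangent by auto
  show ?thesis
  proof (rule standardI)
    fix k d f assume f: "homogeneous d f" and "rank_le_one (b k)"
    then consider "k = 1" | "k = 2"
      using points[of "axis k 1"] axis_in_line by (auto simp: net_axis axis_eq_0_iff)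
    then show "locally_in ?I (axis k 1) f \<longleftrightarrow> normal_stalk Double_Plus_Reduced k f"
    proof cases
      case 1
      then show ?thesis using double_stalk[OF normal flat V2 locally_in_member[OF V33] f] by simp
    next
      case 2
      have "locally_in ?I (axis 2 1) (Var j)" if "j \<noteq> 2" for j
        using V1 V3 exhaust_3[of j] that by auto
      then show ?thesis using 2 f by (simp add: reduced_stalk b2 rank_le_one_outer)
    qed
  next
    fix k f assume "\<not> rank_le_one (b k)"
    then have "k \<noteq> 1" "k \<noteq> 2" using rank_le_one_outer by (auto simp: b1 b2)
    then show "normal_stalk Double_Plus_Reduced k f" by simp
  qed (use points in blast)
qed

lemma fixed_axis_line:
  assumes g: "invertible g" "g *v axis k 1 = axis k 1" and v: "g *v v \<in> line_through (axis k 1)"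
  shows "v \<in> line_through (axis k 1)"
proof -
  obtain h where h: "h ** g = mat 1" using g by (auto simp: invertible_def)
  have undo: "h *v (g *v w) = w" for w by (simp add: matrix_vector_mul_assoc h)
  obtain c where "g *v v = c *s axis k 1" using v by (auto simp: line_through_def)
  then have "v = c *s (h *v axis k 1)" using undo[of v] by (simp add: vector_scalar_commute)
  moreover have "h *v axis k 1 = axis k 1" using undo[of "axis k 1"] g(2) by simp
  ultimately show ?thesis by (simp add: line_through_def)
qed

lemma invertible_zero_iff: "invertible (g :: complex^3^3) \<Longrightarrow> g *v v = 0 \<longleftrightarrow> v = 0"
  unfolding invertible_def by (metis matrix_vector_mul_assoc matrix_vector_mul_lid matrix_vector_mult_0_right)

definition only_points :: "3 set \<Rightarrow> (3 \<Rightarrow> complex^3^3) \<Rightarrow> bool" where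
  "only_points S b \<longleftrightarrow> (\<forall>v. v \<noteq> 0 \<longrightarrow> rank_le_one (net b v) \<longrightarrow> (\<exists>k\<in>S. v \<in> line_through (axis k 1)))"

lemma only_points_reparametrize:
  assumes g: "invertible g" "\<And>k. k \<in> S \<Longrightarrow> g *v axis k 1 = axis k 1" and b: "only_points S b"
  shows "only_points S (reparametrize g b)"
  unfolding only_points_def
proof (intro allI impI)
  fix v :: "complex^3" assume v: "v \<noteq> 0" "rank_le_one (net (reparametrize g b) v)"
  then have "g *v v \<noteq> 0" using invertible_zero_iff[OF g(1)] by simp
  then obtain k where k: "k \<in> S" "g *v v \<in> line_through (axis k 1)"
    using b v(2) unfolding only_points_def net_reparametrize by blast
  then show "\<exists>k\<in>S. v \<in> line_through (axis k 1)" using fixed_axis_line[OF g(1) g(2)[OF k(1)]] by blast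
qed

lemma only_points_row_operation: "invertible P \<Longrightarrow> only_points S (row_operation P b) \<longleftrightarrow> only_points S b"
  by (simp add: only_points_def rank_le_one_row_operation)

lemma only_points_transposed: "only_points S (transposed b) \<longleftrightarrow> only_points S b"
  by (simp add: only_points_def rank_le_one_transposed)

lemma only_point_index:
  assumes "only_points S b" "rank_le_one (b k)"
  shows "k \<in> S"
proof -
  have "rank_le_one (net b (axis k 1))" using assms(2) by (simp add: net_axis)
  then obtain j where "j \<in> S" "axis k 1 \<in> line_through (axis j 1 :: complex^3)"
    using assms(1) unfolding only_points_def by (metis axis_eq_0_iff one_neq_zero)
  then show ?thesis using axis_in_line by blast
qed

definition swap :: "complex^3^3" where "swap = columns (axis 2 1) (axis 1 1) (axis 3 1)"

lemma two_points_normal_standardizable: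
  assumes b: "admissible b"
    and b1: "b 1 = outer (axis 1 1) (axis 1 1)" and b2: "b 2 = outer (axis 2 1) (axis 2 1)"
    and b3: "b 3 $ 1 $ 1 = 0" "b 3 $ 2 $ 2 = 0"
    and points: "only_points {1, 2} b"
  shows "standardizable b"
proof -
  have points': "v \<in> line_through (axis 1 1) \<or> v \<in> line_through (axis 2 1)"
    if "v \<noteq> 0" "rank_le_one (net b v)" for v
    using points that unfolding only_points_def by blast
  consider "b 3 $ 2 $ 3 = 0 \<and> b 3 $ 3 $ 2 = 0 \<and> b 3 $ 3 $ 3 = 0"
    | "b 3 $ 1 $ 3 = 0 \<and> b 3 $ 3 $ 1 = 0 \<and> b 3 $ 3 $ 3 = 0"
    | "b 3 $ 2 $ 3 \<noteq> 0 \<or> b 3 $ 3 $ 2 \<noteq> 0 \<or> b 3 $ 3 $ 3 \<noteq> 0" "b 3 $ 1 $ 3 \<noteq> 0 \<or> b 3 $ 3 $ 1 \<noteq> 0 \<or> b 3 $ 3 $ 3 \<noteq> 0"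
    by blast
  then show ?thesis
  proof cases
    case 1
    then show ?thesis
      using double_plus_reduced_standard[OF b b1 b2 b3 points'] standardizableI by blast
  next
    case 2
    have S: "invertible swap" by (simp add: swap_def invertible_det_nz det_columns axis_def)
    \<comment> \<open>Exchanging the two points, the first two rows and the first two columns reduces to the previous case.\<close>
    define c where "c = transposed (row_operation swap (transposed (row_operation swap (reparametrize swap b))))"
    have c_entry: "c k = (\<chi> i j. \<Sum>p\<in>UNIV. \<Sum>q\<in>UNIV. swap $ i $ p * (reparametrize swap b k $ p $ q) * swap $ j $ q)" for k
      by (simp add: c_def transposed_def row_operation_def transpose_def matrix_matrix_mult_def vec_eq_iff sum_3 algebra_simps)
    have r: "reparametrize swap b 1 = b 2" "reparametrize swap b 2 = b 1" "reparametrize swap b 3 = b 3"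
      by (simp_all add: reparametrize_def swap_def net_axis)
    have "admissible c"
      unfolding c_def by (intro admissible_transposed admissible_row_operation S admissible_reparametrize b)
    moreover have "c 1 = outer (axis 1 1) (axis 1 1)" "c 2 = outer (axis 2 1) (axis 2 1)"
      unfolding c_entry r b1 b2 by (simp_all add: vec_eq_iff forall_3 sum_3 swap_def columns_def axis_def)
    moreover have "c 3 $ 1 $ 1 = 0" "c 3 $ 2 $ 2 = 0" "c 3 $ 2 $ 3 = 0" "c 3 $ 3 $ 2 = 0" "c 3 $ 3 $ 3 = 0"
      unfolding c_entry r using b3 2 by (simp_all add: sum_3 swap_def columns_def axis_def)
    moreover have "v \<in> line_through (axis 1 1) \<or> v \<in> line_through (axis 2 1)"
      if v: "v \<noteq> 0" "rank_le_one (net c v)" for v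
    proof -
      have "rank_le_one (net b (swap *v v))"
        using v(2) by (simp add: c_def rank_le_one_transposed rank_le_one_row_operation[OF S] net_reparametrize)
      moreover have "swap *v v \<noteq> 0" using v(1) invertible_zero_iff[OF S] by simp
      ultimately have "swap *v v \<in> line_through (axis 1 1) \<or> swap *v v \<in> line_through (axis 2 1)"
        using points' by blast
      moreover have "swap *v v = vector [v $ 2, v $ 1, v $ 3]"
        by (simp add: vec_eq_iff forall_3 swap_def columns_def matrix_vector_mult_def sum_3 axis_def)
      ultimately consider "v $ 1 = 0" "v $ 3 = 0" | "v $ 2 = 0" "v $ 3 = 0"
        by (auto simp: line_through_def vec_eq_iff forall_3 axis_def)
      then show ?thesis
        using on_axis_line[of 2 v] on_axis_line[of 1 v] exhaust_3 by metis
    qed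
    ultimately have "standardizable c" using double_plus_reduced_standard[of c] standardizableI by blast
    then show ?thesis
      unfolding c_def using standardizable_transposed standardizable_row_operation[OF S] standardizable_reparametrize[OF S] by blast
  next
    case 3
    then show ?thesis using two_reduced_standard[OF b1 b2 b3 points'] standardizableI by blast
  qed
qed

text \<open>
  Row and column operations move the two matrices to \<open>E11\<close> and \<open>E22\<close>; subtracting multiples of
  them from the third matrix clears its first two diagonal entries.
\<close>
lemma two_points_standardizable:
  assumes b: "admissible b" and rank: "rank_le_one (b 1)" "rank_le_one (b 2)" and points: "only_points {1, 2} b"
  shows "standardizable b"
proof -
  obtain x y where b1: "b 1 = outer x y" using rank(1) by (rule rank_le_oneE)
  obtain x' y' where b2: "b 2 = outer x' y'" using rank(2) by (rule rank_le_oneE)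
  have indep: "\<not> parallel x x'" "\<not> parallel y y'" using points_independent[OF b _ b1 b2] by simp_all
  obtain P :: "complex^3^3" where P: "invertible P" "P *v x = axis 1 1" "P *v x' = axis 2 1"
    using ex_moving_pair[OF indep(1)] .
  obtain Q :: "complex^3^3" where Q: "invertible Q" "Q *v y = axis 1 1" "Q *v y' = axis 2 1"
    using ex_moving_pair[OF indep(2)] .
  define c where "c = row_operation Q (transposed (row_operation P b))"
  have c12: "c 1 = outer (axis 1 1) (axis 1 1)" "c 2 = outer (axis 2 1) (axis 2 1)"
    by (simp_all add: c_def row_operation_def transposed_def b1 b2 mult_outer transpose_outer P Q)
  have c: "admissible c" unfolding c_def by (intro admissible_transposed admissible_row_operation P Q b)
  have pc: "only_points {1, 2} c"
    using points by (simp add: c_def only_points_row_operation P Q only_points_transposed)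
  define g where "g = columns (axis 1 1) (axis 2 1) (vector [- (c 3 $ 1 $ 1), - (c 3 $ 2 $ 2), 1])"
  have g: "invertible g" by (simp add: g_def invertible_det_nz det_columns axis_def)
  define d where "d = reparametrize g c"
  have "standardizable d"
  proof (rule two_points_normal_standardizable)
    show "admissible d" unfolding d_def by (rule admissible_reparametrize[OF g c])
    show "d 1 = outer (axis 1 1) (axis 1 1)" "d 2 = outer (axis 2 1) (axis 2 1)"
      by (simp_all add: d_def reparametrize_def g_def net_axis c12)
    show "d 3 $ 1 $ 1 = 0" "d 3 $ 2 $ 2 = 0"
      by (simp_all add: d_def reparametrize_def g_def net_entries c12 axis_def)
    show "only_points {1, 2} d"
      unfolding d_def by (rule only_points_reparametrize[OF g _ pc]) (auto simp: g_def)
  qed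
  then show ?thesis
    unfolding d_def c_def using standardizable_reparametrize[OF g] standardizable_row_operation[OF Q(1)] standardizable_transposed standardizable_row_operation[OF P(1)]
    by (metis c_def)
qed

section \<open>Sections with one point\<close>

lemma normalized_entries:
  assumes "normalized b"
  shows "entry b 1 1 = Var 1" "\<And>i j. i \<noteq> 1 \<or> j \<noteq> 1 \<Longrightarrow>
    entry b i j = Const (b 2 $ i $ j) * Var 2 + Const (b 3 $ i $ j) * Var 3"
  using assms by (auto simp: entry_expand normalized_def Const_0 Const_1)

lemma only_one_standard:
  assumes points: "only_points {1} b" and stalk: "\<And>d f. homogeneous d f \<Longrightarrow>
    locally_in (segre_section b) (axis 1 1) f \<longleftrightarrow> normal_stalk \<tau> 1 f"
    and outside: "\<And>k f. k \<noteq> 1 \<Longrightarrow> normal_stalk \<tau> k f" and rank: "rank_le_one (b 1)"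
  shows "standard (mat 1) \<tau> b"
proof (rule standardI)
  fix k d f assume "homogeneous d f" "rank_le_one (b k)"
  then show "locally_in (segre_section b) (axis k 1) f \<longleftrightarrow> normal_stalk \<tau> k f"
    using only_point_index[OF points] stalk by blast
next
  fix k f assume "\<not> rank_le_one (b k)"
  then show "normal_stalk \<tau> k f" using rank outside by metis
qed (use points in \<open>auto simp: only_points_def\<close>)

lemma normalized_rank_one: "normalized b \<Longrightarrow> rank_le_one (b 1)"
  unfolding rank_le_one_iff by (simp add: normalized_def)

text \<open>
  A coefficient of the \<open>m\<close>-th variable, for \<open>m = 2, 3\<close>, in the minor that uses the first row and
  column together with row \<open>i\<close> and column \<open>j\<close>.
\<close>
definition tangent_form :: "(3 \<Rightarrow> complex^3^3) \<Rightarrow> 3 \<Rightarrow> 3 \<Rightarrow> 3 \<Rightarrow> poly3" where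
  "tangent_form b m i j = Const (b m $ i $ j) * Var 1 - Const (b m $ 1 $ j) * entry b i 1"

lemma homogeneous_tangent_form: "homogeneous 1 (tangent_form b m i j)"
  unfolding tangent_form_def
  by (intro homogeneous_diff homogeneous_mult_Const homogeneous_Var homogeneous_linear_form_matrix)

lemma eval_tangent_form:
  "normalized b \<Longrightarrow> i \<noteq> 1 \<Longrightarrow> poly3_eval (tangent_form b m i j) (axis 1 1) = b m $ i $ j"
  using net_axis[of b 1] by (simp add: tangent_form_def normalized_def)

lemma minor_tangent_form:
  assumes "normalized b" "i \<noteq> 1" "j \<noteq> 1"
  shows "minor (entry b) 1 i 1 j = tangent_form b 2 i j * Var 2 + tangent_form b 3 i j * Var 3"
  using assms(2,3) by (simp add: minor_def tangent_form_def normalized_entries[OF assms(1)] algebra_simps)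

text \<open>
  Two of the minors through the entry \<open>s\<close> are independent linear combinations of \<open>t\<close> and \<open>u\<close>
  near the point, so by Cramer's rule their determinant, which does not vanish there, multiplies
  \<open>t\<close> and \<open>u\<close> into the ideal.
\<close>
lemma one_reduced_standard:
  assumes b: "normalized b" and points: "only_points {1} b"
    and ijkl: "i \<noteq> 1" "j \<noteq> 1" "k \<noteq> 1" "l \<noteq> 1" "b 2 $ i $ j * b 3 $ k $ l \<noteq> b 3 $ i $ j * b 2 $ k $ l"
  shows "standard (mat 1) One_Reduced b"
proof -
  let ?I = "segre_section b" and ?t = "tangent_form b"
  define \<Delta> where "\<Delta> = ?t 2 i j * ?t 3 k l - ?t 3 i j * ?t 2 k l"
  have hom: "homogeneous (1 + 1) \<Delta>"
    unfolding \<Delta>_def by (intro homogeneous_diff homogeneous_mult homogeneous_tangent_form)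
  have ev: "poly3_eval \<Delta> (axis 1 1) \<noteq> 0"
    using ijkl by (simp add: \<Delta>_def eval_tangent_form[OF b])
  note minors = minor_in_segre[of b 1 i 1 j] minor_in_segre[of b 1 k 1 l]
  have "\<Delta> * Var 2 = ?t 3 k l * minor (entry b) 1 i 1 j - ?t 3 i j * minor (entry b) 1 k 1 l"
    using ijkl by (simp add: \<Delta>_def minor_tangent_form[OF b] algebra_simps)
  then have "locally_in ?I (axis 1 1) (\<Delta> * Var 2)"
    using minors by (intro locally_in_member) (simp add: poly_ideal_diff poly_ideal_mult poly_ideal_segre)
  then have V2: "locally_in ?I (axis 1 1) (Var 2)" by (rule locally_in_cancel_linear[OF _ hom ev])
  have "\<Delta> * Var 3 = ?t 2 i j * minor (entry b) 1 k 1 l - ?t 2 k l * minor (entry b) 1 i 1 j"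
    using ijkl by (simp add: \<Delta>_def minor_tangent_form[OF b] algebra_simps)
  then have "locally_in ?I (axis 1 1) (\<Delta> * Var 3)"
    using minors by (intro locally_in_member) (simp add: poly_ideal_diff poly_ideal_mult poly_ideal_segre)
  then have V3: "locally_in ?I (axis 1 1) (Var 3)" by (rule locally_in_cancel_linear[OF _ hom ev])
  have "locally_in ?I (axis 1 1) (Var j)" if "j \<noteq> 1" for j
    using V2 V3 exhaust_3[of j] that by auto
  then show ?thesis
    by (intro only_one_standard[OF points]) (simp_all add: reduced_stalk normalized_rank_one[OF b])
qed

text \<open>
  With \<open>D = t D0\<close> the minors through the entry \<open>s\<close> are \<open>T_ij t - N_ij u^2\<close>, where \<open>T_ij\<close> takes
  the value \<open>D0_ij\<close> at the point. If \<open>N\<close> and \<open>D0\<close> are not proportional, eliminating \<open>u^2\<close> puts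
  \<open>t\<close> in the stalk, and then \<open>u^2\<close> follows.
\<close>
lemma double_standard:
  assumes b: "normalized b" and points: "only_points {1} b"
    and flat: "\<And>i j. i \<noteq> 1 \<Longrightarrow> j \<noteq> 1 \<Longrightarrow> b 3 $ i $ j = 0"
    and ijkl: "i \<noteq> 1" "j \<noteq> 1" "k \<noteq> 1" "l \<noteq> 1"
      "b 2 $ i $ j * (b 3 $ k $ 1 * b 3 $ 1 $ l) \<noteq> b 2 $ k $ l * (b 3 $ i $ 1 * b 3 $ 1 $ j)"
  shows "standard (mat 1) Double b"
proof -
  let ?I = "segre_section b"
  define T where "T i j = tangent_form b 2 i j - Const (b 3 $ 1 $ j * b 2 $ i $ 1) * Var 3" for i j
  define N where "N i j = b 3 $ i $ 1 * b 3 $ 1 $ j" for i j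
  have hom: "homogeneous 1 (T i j)" for i j
    unfolding T_def by (intro homogeneous_diff homogeneous_tangent_form homogeneous_mult_Const homogeneous_Var)
  have ev: "poly3_eval (T i j) (axis 1 1) = b 2 $ i $ j" if "i \<noteq> 1" for i j
    using that by (simp add: T_def eval_tangent_form[OF b]) (simp add: axis_def)
  have minor: "minor (entry b) 1 i 1 j = T i j * Var 2 - Const (N i j) * (Var 3 * Var 3)" if "i \<noteq> 1" "j \<noteq> 1" for i j
    using that by (simp add: minor_tangent_form[OF b] T_def N_def tangent_form_def[of b 3] flat
        normalized_entries[OF b] Const_0 Const_mult algebra_simps)
  let ?l = "Const (N k l) * T i j - Const (N i j) * T k l"
  have "?l * Var 2 = Const (N k l) * minor (entry b) 1 i 1 j - Const (N i j) * minor (entry b) 1 k 1 l"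
    using ijkl by (simp add: minor algebra_simps)
  then have "locally_in ?I (axis 1 1) (?l * Var 2)"
    by (intro locally_in_member) (simp add: minor_in_segre poly_ideal_diff poly_ideal_mult poly_ideal_segre)
  moreover have "homogeneous 1 ?l" by (intro homogeneous_diff homogeneous_mult_Const hom)
  moreover have "poly3_eval ?l (axis 1 1) \<noteq> 0"
    using ijkl by (simp add: ev) (simp add: N_def mult.commute)
  ultimately have V2: "locally_in ?I (axis 1 1) (Var 2)" by (rule locally_in_cancel_linear)
  have V33: "locally_in ?I (axis 1 1) (Const (N p q) * (Var 3 * Var 3))" if "p \<noteq> 1" "q \<noteq> 1" for p q
  proof -
    have "Const (N p q) * (Var 3 * Var 3) = T p q * Var 2 + - 1 * minor (entry b) 1 p 1 q"
      using that by (simp add: minor)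
    also have "locally_in ?I (axis 1 1) \<dots>"
      by (intro locally_in_add[OF poly_ideal_segre] locally_in_mult[OF poly_ideal_segre] V2 locally_in_minor)
    finally show ?thesis .
  qed
  have "N i j \<noteq> 0 \<or> N k l \<noteq> 0" using ijkl(5) by (auto simp: N_def)
  then have "locally_in ?I (axis 1 1) (Var 3 * Var 3)"
    using V33[OF ijkl(1,2)] V33[OF ijkl(3,4)]
      ideal_Const_cancel[OF poly_ideal_locally_in[OF poly_ideal_segre, of b "axis 1 1"]] by blast
  then show ?thesis
    using double_stalk[OF b flat V2]
    by (intro only_one_standard[OF points]) (simp_all add: normalized_rank_one[OF b])
qed

text \<open>
  The matrix has first row \<open>s, u + \<dots>, \<rho> t\<close>, first column \<open>s, u + \<dots>, \<gamma> t\<close> and the only further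
  entry \<open>t\<close>. The minors generate the ideal of \<open>st - u^2\<close>, \<open>tu\<close>, \<open>t^2\<close>, unless \<open>\<rho> = \<gamma> = 0\<close>, when
  the section is a conic.
\<close>
lemma triple_standard:
  assumes b: "admissible b" "normalized b" and points: "only_points {1} b"
    and b2: "b 2 $ 2 $ 2 = 1" "b 2 $ 2 $ 3 = 0" "b 2 $ 3 $ 2 = 0" "b 2 $ 3 $ 3 = 0"
    and b3: "b 3 $ 1 $ 2 = 1" "b 3 $ 1 $ 3 = 0" "b 3 $ 2 $ 1 = 1" "b 3 $ 3 $ 1 = 0"
      "b 3 $ 2 $ 2 = 0" "b 3 $ 2 $ 3 = 0" "b 3 $ 3 $ 2 = 0" "b 3 $ 3 $ 3 = 0"
  shows "standard (mat 1) Curvilinear_Triple b"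
proof -
  let ?I = "segre_section b"
  let ?r = "b 2 $ 1 $ 2" and ?c = "b 2 $ 2 $ 1" and ?\<rho> = "b 2 $ 1 $ 3" and ?\<gamma> = "b 2 $ 3 $ 1"
  have b1: "b 1 $ i $ j = (if i = 1 \<and> j = 1 then 1 else 0)" "b 2 $ 1 $ 1 = 0" "b 3 $ 1 $ 1 = 0" for i j
    using b(2) by (simp_all add: normalized_def)
  note entries = b1 b2 b3
  have nz: "?\<rho> \<noteq> 0 \<or> ?\<gamma> \<noteq> 0"
  proof (rule ccontr)
    assume *: "\<not> ?thesis"
    \<comment> \<open>The conic \<open>st = (u + r t) (u + c t)\<close>, parametrized by \<open>u\<close> with \<open>t = 1\<close>.\<close>
    define u :: "complex^3" where "u = vector [?r * ?c, 1, 0]"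
    define v :: "complex^3" where "v = vector [?r + ?c, 0, 1]"
    define w :: "complex^3" where "w = vector [1, 0, 0]"
    note defs = u_def v_def w_def
    have "u + t *s v + t ^ 2 *s w \<noteq> 0 \<and> rank_le_one (net b (u + t *s v + t ^ 2 *s w))" for t
    proof
      show "u + t *s v + t ^ 2 *s w \<noteq> 0" by (auto simp: vec_eq_iff forall_3 defs)
      show "rank_le_one (net b (u + t *s v + t ^ 2 *s w))"
        unfolding rank_le_one_iff net_entries using *
        by (simp add: defs entries power2_eq_square algebra_simps)
    qed
    then obtain c where "u + v + w = c *s u"
      using b(1) unfolding admissible_def no_curve_def by blast
    then have "(u + v + w) $ 3 = (c *s u) $ 3" by simp
    then show False by (simp add: defs)
  qed
  note e = entry_expand entries
  have "Const ?\<rho> * (Var 2 * Var 2) \<in> ?I" "Const ?\<gamma> * (Var 2 * Var 2) \<in> ?I"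
    using poly_ideal_uminus[OF poly_ideal_segre minor_in_segre[of b 1 2 2 3]]
      poly_ideal_uminus[OF poly_ideal_segre minor_in_segre[of b 2 3 1 2]]
    by (simp_all add: minor_def e Const_0 Const_1 algebra_simps)
  then have V22: "Var 2 * Var 2 \<in> ?I" using nz ideal_Const_cancel[OF poly_ideal_segre] by blast
  have "Const ?\<rho> * (Var 2 * Var 3) + (Const ?\<rho> * Const ?c) * (Var 2 * Var 2) \<in> ?I"
    "Const ?\<gamma> * (Var 2 * Var 3) + (Const ?\<gamma> * Const ?r) * (Var 2 * Var 2) \<in> ?I"
    using poly_ideal_uminus[OF poly_ideal_segre minor_in_segre[of b 1 2 1 3]]
      poly_ideal_uminus[OF poly_ideal_segre minor_in_segre[of b 1 3 1 2]]
    by (simp_all add: minor_def e Const_0 Const_1 algebra_simps)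
  from poly_ideal_diff[OF poly_ideal_segre this(1) poly_ideal_mult[OF poly_ideal_segre V22]]
    poly_ideal_diff[OF poly_ideal_segre this(2) poly_ideal_mult[OF poly_ideal_segre V22]]
  have "Const ?\<rho> * (Var 2 * Var 3) \<in> ?I" "Const ?\<gamma> * (Var 2 * Var 3) \<in> ?I"
    by (metis add_diff_cancel_right')+
  then have V23: "Var 2 * Var 3 \<in> ?I" using nz ideal_Const_cancel[OF poly_ideal_segre] by blast
  have "Var 1 * Var 2 - Var 3 * Var 3 = minor (entry b) 1 2 1 2 +
      ((Const ?r + Const ?c) * (Var 2 * Var 3) + (Const ?r * Const ?c) * (Var 2 * Var 2))"
    by (simp add: minor_def e Const_0 Const_1 algebra_simps)
  also have "\<dots> \<in> ?I"
    by (intro poly_ideal_add[OF poly_ideal_segre] poly_ideal_mult[OF poly_ideal_segre] minor_in_segre V22 V23)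
  finally have V12: "Var 1 * Var 2 - Var 3 * Var 3 \<in> ?I" .
  have "\<epsilon> ^ 3 dvd minor (\<lambda>i j. along parabola (entry b i j)) i j k l" for i j k l
    by (rule all_minors[of "\<lambda>P. \<epsilon> ^ 3 dvd P"]; simp only: epsilon_cube_dvd_iff minor_def entry_along)
      (simp_all add: entries power2_eq_square numeral_2_eq_2)
  from triple_stalk[OF this V22 V23 V12] show ?thesis
    by (intro only_one_standard[OF points]) (simp_all add: normalized_rank_one[OF b(2)])
qed

text \<open>
  A common zero of the two forms in the first column spans, with the point, a line on which only
  the first row is nonzero.
\<close>
lemma fat_columns_independent:
  assumes b: "admissible b" "normalized b"
    and flat: "\<And>i j m. i \<noteq> 1 \<Longrightarrow> j \<noteq> 1 \<Longrightarrow> m \<noteq> 1 \<Longrightarrow> b m $ i $ j = 0"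
  shows "b 2 $ 2 $ 1 * b 3 $ 3 $ 1 \<noteq> b 3 $ 2 $ 1 * b 2 $ 3 $ 1"
proof
  assume dep: "b 2 $ 2 $ 1 * b 3 $ 3 $ 1 = b 3 $ 2 $ 1 * b 2 $ 3 $ 1"
  have "\<exists>t u. (t \<noteq> 0 \<or> u \<noteq> 0) \<and> t * b 2 $ 2 $ 1 + u * b 3 $ 2 $ 1 = 0 \<and> t * b 2 $ 3 $ 1 + u * b 3 $ 3 $ 1 = 0"
  proof -
    consider "b 2 $ 2 $ 1 \<noteq> 0 \<or> b 3 $ 2 $ 1 \<noteq> 0" | "b 2 $ 3 $ 1 \<noteq> 0 \<or> b 3 $ 3 $ 1 \<noteq> 0"
      | "b 2 $ 2 $ 1 = 0" "b 3 $ 2 $ 1 = 0" "b 2 $ 3 $ 1 = 0" "b 3 $ 3 $ 1 = 0" by blast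
    then show ?thesis
    proof cases
      case 1
      then show ?thesis
        using dep by (intro exI[of _ "b 3 $ 2 $ 1"] exI[of _ "- (b 2 $ 2 $ 1)"]) (auto simp: algebra_simps)
    next
      case 2
      then show ?thesis
        using dep by (intro exI[of _ "b 3 $ 3 $ 1"] exI[of _ "- (b 2 $ 3 $ 1)"]) (auto simp: algebra_simps)
    next
      case 3
      then show ?thesis by (intro exI[of _ 1] exI[of _ 0]) simp
    qed
  qed
  then obtain t u where tu: "t \<noteq> 0 \<or> u \<noteq> 0" "t * b 2 $ 2 $ 1 + u * b 3 $ 2 $ 1 = 0" "t * b 2 $ 3 $ 1 + u * b 3 $ 3 $ 1 = 0"
    by blast
  \<comment> \<open>The direction of the line in which the first column is constant.\<close>
  define w :: "complex^3" where "w = vector [0, t, u]"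
  have b1: "b 1 $ i $ j = (if i = 1 \<and> j = 1 then 1 else 0)" "b 2 $ 1 $ 1 = 0" "b 3 $ 1 $ 1 = 0" for i j
    using b(2) by (simp_all add: normalized_def)
  have "rank_le_one (net b (axis 1 1 + x *s w))" for x
  proof -
    have z: "x * t * b 2 $ i $ 1 + x * u * b 3 $ i $ 1 = 0" if "i = 2 \<or> i = 3" for i
    proof -
      have "x * t * b 2 $ i $ 1 + x * u * b 3 $ i $ 1 = x * (t * b 2 $ i $ 1 + u * b 3 $ i $ 1)"
        by (simp add: algebra_simps)
      then show ?thesis using that tu(2,3) by auto
    qed
    show ?thesis
      unfolding rank_le_one_iff net_entries
      by (simp add: w_def axis_def b1 flat z)
  qed
  then have "parallel (axis 1 1) w" by (intro no_line[OF b(1)]) (simp_all add: axis_eq_0_iff)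
  then have "(axis 1 1 :: complex^3) $ 1 * w $ 2 = (axis 1 1 :: complex^3) $ 2 * w $ 1"
    "(axis 1 1 :: complex^3) $ 1 * w $ 3 = (axis 1 1 :: complex^3) $ 3 * w $ 1"
    unfolding parallel_def by blast+
  then show False using tu(1) by (simp add: axis_def w_def)
qed

text \<open>
  The minors contain all products of an entry of the first column with an entry of the first
  row, and both pairs of entries are bases of the forms in \<open>t\<close>, \<open>u\<close>.
\<close>
lemma fat_standard:
  assumes b: "admissible b" "normalized b" and points: "only_points {1} b"
    and flat: "\<And>i j m. i \<noteq> 1 \<Longrightarrow> j \<noteq> 1 \<Longrightarrow> m \<noteq> 1 \<Longrightarrow> b m $ i $ j = 0"
  shows "standard (mat 1) Fat_Point b"
proof -
  let ?I = "segre_section b"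
  note col = fat_columns_independent[OF b flat]
  have "normalized (transposed b)" using b(2) by (auto simp: normalized_def transposed_def transpose_def)
  then have row: "b 2 $ 1 $ 2 * b 3 $ 1 $ 3 \<noteq> b 3 $ 1 $ 2 * b 2 $ 1 $ 3"
    using fat_columns_independent[OF admissible_transposed[OF b(1)], simplified transposed_def transpose_def] flat
    by (simp add: transposed_def transpose_def)
  have product: "entry b i 1 * entry b 1 j \<in> ?I" if "i \<noteq> 1" "j \<noteq> 1" for i j
  proof -
    have "entry b i j = 0" using that flat by (simp add: normalized_entries[OF b(2)] Const_0)
    then have "minor (entry b) i 1 1 j = entry b i 1 * entry b 1 j" by (simp add: minor_def)
    then show ?thesis using minor_in_segre[of b i 1 1 j] by simp
  qed
  have ent: "entry b 2 1 = Const (b 2 $ 2 $ 1) * Var 2 + Const (b 3 $ 2 $ 1) * Var 3"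
    "entry b 3 1 = Const (b 2 $ 3 $ 1) * Var 2 + Const (b 3 $ 3 $ 1) * Var 3"
    "entry b 1 2 = Const (b 2 $ 1 $ 2) * Var 2 + Const (b 3 $ 1 $ 2) * Var 3"
    "entry b 1 3 = Const (b 2 $ 1 $ 3) * Var 2 + Const (b 3 $ 1 $ 3) * Var 3"
    by (simp_all add: normalized_entries[OF b(2)])
  \<comment> \<open>Used for the column first and for the row afterwards.\<close>
  have cramer: "Var 2 * f \<in> ?I" "Var 3 * f \<in> ?I"
    if pq: "(Const a * Var 2 + Const a' * Var 3) * f \<in> ?I" "(Const c * Var 2 + Const c' * Var 3) * f \<in> ?I"
      and det: "a * c' - a' * c \<noteq> 0" for a a' c c' f
  proof -
    have "Const (a * c' - a' * c) * (Var 2 * f) = Const c' * ((Const a * Var 2 + Const a' * Var 3) * f)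
        - Const a' * ((Const c * Var 2 + Const c' * Var 3) * f)"
      by (simp add: Const_diff Const_mult algebra_simps)
    also have "\<dots> \<in> ?I" using pq by (simp add: poly_ideal_diff poly_ideal_mult poly_ideal_segre)
    finally show "Var 2 * f \<in> ?I" using ideal_Const_cancel[OF poly_ideal_segre det] by blast
    have "Const (a * c' - a' * c) * (Var 3 * f) = Const a * ((Const c * Var 2 + Const c' * Var 3) * f)
        - Const c * ((Const a * Var 2 + Const a' * Var 3) * f)"
      by (simp add: Const_diff Const_mult algebra_simps)
    also have "\<dots> \<in> ?I" using pq by (simp add: poly_ideal_diff poly_ideal_mult poly_ideal_segre)
    finally show "Var 3 * f \<in> ?I" using ideal_Const_cancel[OF poly_ideal_segre det] by blast
  qed
  have "Var m * entry b 1 j \<in> ?I" if "j \<noteq> 1" "m = 2 \<or> m = 3" for j m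
    using cramer[of "b 2 $ 2 $ 1" "b 3 $ 2 $ 1" "entry b 1 j" "b 2 $ 3 $ 1" "b 3 $ 3 $ 1"]
      product[of 2 j] product[of 3 j] col that unfolding ent by auto
  then have "entry b 1 2 * Var m \<in> ?I" "entry b 1 3 * Var m \<in> ?I" if "m = 2 \<or> m = 3" for m
    using that by (simp_all add: mult.commute)
  then have "Var 2 * Var m \<in> ?I" "Var 3 * Var m \<in> ?I" if "m = 2 \<or> m = 3" for m
    using cramer[of "b 2 $ 1 $ 2" "b 3 $ 1 $ 2" "Var m" "b 2 $ 1 $ 3" "b 3 $ 1 $ 3"] row that
    unfolding ent by auto
  then have "Var 2 * Var 2 \<in> ?I" "Var 2 * Var 3 \<in> ?I" "Var 3 * Var 3 \<in> ?I" by blast+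
  from fat_stalk[OF b(2) _ _ this] flat show ?thesis
    by (intro only_one_standard[OF points]) (simp_all add: normalized_rank_one[OF b(2)])
qed

text \<open>
  Row operations by \<open>P\<close> and column operations by \<open>Q\<close>.
\<close>
definition two_sided :: "complex^3^3 \<Rightarrow> complex^3^3 \<Rightarrow> complex^3^3 \<Rightarrow> complex^3^3" where
  "two_sided P Q M = transpose (Q ** transpose (P ** M))"

lemma two_sided_outer: "two_sided P Q (outer x y) = outer (P *v x) (Q *v y)"
  by (simp add: two_sided_def mult_outer transpose_outer)

lemma two_sided_nth: "two_sided P Q M $ i $ j = (\<Sum>q\<in>UNIV. Q $ j $ q * (\<Sum>p\<in>UNIV. P $ i $ p * M $ p $ q))"
  by (simp add: two_sided_def transpose_def matrix_matrix_mult_def)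

lemma two_sided_add: "two_sided P Q (M + N) = two_sided P Q M + two_sided P Q N"
  by (simp add: vec_eq_iff two_sided_nth sum_3 algebra_simps)

lemma two_sided_mscale: "two_sided P Q (mscale c M) = mscale c (two_sided P Q M)"
  by (simp add: vec_eq_iff two_sided_nth mscale_def sum_3 algebra_simps)

text \<open>
  If \<open>N\<close> and \<open>D0\<close> are not proportional, the point is double. Otherwise \<open>N \<noteq> 0\<close>, for lack of a
  line in the section, and \<open>D0\<close> is a multiple of the rank one matrix \<open>N\<close>, whose column and row
  can be moved to the second coordinate vector.
\<close>
lemma flat_standardizable:
  assumes b: "admissible b" "normalized b" and points: "only_points {1} b"
    and flat: "\<And>i j. i \<noteq> 1 \<Longrightarrow> j \<noteq> 1 \<Longrightarrow> b 3 $ i $ j = 0"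
    and nonzero: "i0 \<noteq> 1" "j0 \<noteq> 1" "b 2 $ i0 $ j0 \<noteq> 0"
  shows "standardizable b"
proof (cases "\<exists>i j k l. i \<noteq> 1 \<and> j \<noteq> 1 \<and> k \<noteq> 1 \<and> l \<noteq> 1 \<and>
    b 2 $ i $ j * (b 3 $ k $ 1 * b 3 $ 1 $ l) \<noteq> b 2 $ k $ l * (b 3 $ i $ 1 * b 3 $ 1 $ j)")
  case True
  then show ?thesis using double_standard[OF b(2) points flat] standardizableI by blast
next
  case False
  define N where "N i j = b 3 $ i $ 1 * b 3 $ 1 $ j" for i j
  have proportional: "b 2 $ i $ j * N k l = b 2 $ k $ l * N i j" if "i \<noteq> 1" "j \<noteq> 1" "k \<noteq> 1" "l \<noteq> 1" for i j k l
    using False that unfolding N_def by blast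
  have b1: "b 1 $ i $ j = (if i = 1 \<and> j = 1 then 1 else 0)" "b 2 $ 1 $ 1 = 0" "b 3 $ 1 $ 1 = 0" for i j
    using b(2) by (simp_all add: normalized_def)
  have "\<exists>p q. p \<noteq> 1 \<and> q \<noteq> 1 \<and> N p q \<noteq> 0"
  proof (rule ccontr)
    assume "\<not> ?thesis"
    then have N0: "N p q = 0" if "p \<noteq> 1" "q \<noteq> 1" for p q using that by blast
    have "b 3 $ p $ 1 * b 3 $ 1 $ q = 0" "b 3 $ 1 $ q * b 3 $ p $ 1 = 0" if "p \<noteq> 1" "q \<noteq> 1" for p q
      using N0[OF that] by (auto simp: N_def)
    then have zero: "x * b 3 $ p $ 1 * (x * b 3 $ 1 $ q) = 0" "x * b 3 $ 1 $ q * (x * b 3 $ p $ 1) = 0"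
      if "p \<noteq> 1" "q \<noteq> 1" for p q x
      using that by auto
    have "rank_le_one (b 1 + mscale x (b 3))" for x
      unfolding rank_le_one_iff using zero[of 2 2 x] zero[of 2 3 x] zero[of 3 2 x] zero[of 3 3 x]
      by (simp add: b1 flat mscale_def)
    then show False using no_line_axis[OF b(1), of 1 3] by simp
  qed
  then obtain p q where pq: "p \<noteq> 1" "q \<noteq> 1" "N p q \<noteq> 0" by blast
  define \<mu> where "\<mu> = b 2 $ p $ q / N p q"
  have b2: "b 2 $ i $ j = \<mu> * N i j" if "i \<noteq> 1" "j \<noteq> 1" for i j
    using proportional[OF that pq(1,2)] pq(3) by (simp add: \<mu>_def field_simps)
  have \<mu>: "\<mu> \<noteq> 0" using b2[OF nonzero(1,2)] nonzero(3) by auto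
  define c :: "complex^3" where "c = vector [0, b 3 $ 2 $ 1, b 3 $ 3 $ 1]"
  define r :: "complex^3" where "r = vector [0, b 3 $ 1 $ 2, b 3 $ 1 $ 3]"
  define c2 :: "complex^3" where "c2 = vector [0, b 2 $ 2 $ 1, b 2 $ 3 $ 1]"
  define r2 :: "complex^3" where "r2 = vector [0, b 2 $ 1 $ 2, b 2 $ 1 $ 3]"
  note defs = c_def r_def c2_def r2_def
  have nz: "b 3 $ p $ 1 \<noteq> 0" "b 3 $ 1 $ q \<noteq> 0" using pq(3) by (auto simp: N_def)
  then have "c $ 2 \<noteq> 0 \<or> c $ 3 \<noteq> 0" "r $ 2 \<noteq> 0 \<or> r $ 3 \<noteq> 0"
    using pq(1,2) exhaust_3[of p] exhaust_3[of q] by (auto simp: defs)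
  then have "\<not> parallel (axis 1 1) c" "\<not> parallel (axis 1 1) r"
    by (auto simp: parallel_def forall_3 axis_def)
  then obtain P Q :: "complex^3^3" where P: "invertible P" "P *v axis 1 1 = axis 1 1" "P *v c = axis 2 1"
    and Q: "invertible Q" "Q *v axis 1 1 = axis 1 1" "Q *v r = axis 2 1"
    using ex_moving_pair by metis
  have form1: "b 1 = outer (axis 1 1) (axis 1 1)"
    by (simp add: vec_eq_iff forall_3 b1 axis_def)
  have form3: "b 3 = outer c (axis 1 1) + outer (axis 1 1) r"
    by (simp add: vec_eq_iff forall_3 b1 flat axis_def defs)
  have form2: "b 2 = outer c2 (axis 1 1) + outer (axis 1 1) r2 + mscale \<mu> (outer c r)"
    by (simp add: vec_eq_iff forall_3 b1 b2 axis_def defs N_def mscale_def)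
  define a where "a = transposed (row_operation Q (transposed (row_operation P b)))"
  have a: "a k = two_sided P Q (b k)" for k
    by (simp add: a_def transposed_def row_operation_def two_sided_def)
  have a1: "a 1 = outer (axis 1 1) (axis 1 1)"
    unfolding a form1 by (simp add: two_sided_outer P Q)
  have a3: "a 3 = outer (axis 2 1) (axis 1 1) + outer (axis 1 1) (axis 2 1)"
    unfolding a form3 by (simp add: two_sided_add two_sided_outer P Q)
  have a2: "a 2 = outer (P *v c2) (axis 1 1) + outer (axis 1 1) (Q *v r2) + mscale \<mu> (outer (axis 2 1) (axis 2 1))"
    unfolding a form2 by (simp add: two_sided_add two_sided_mscale two_sided_outer P Q)
  \<comment> \<open>Rescaling the second matrix makes the entry of its block equal to \<open>1\<close>.\<close>
  define g where "g = columns (axis 1 1) (vector [- (a 2 $ 1 $ 1) / \<mu>, 1 / \<mu>, 0]) (axis 3 1)"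
  have g: "invertible g" using \<mu> by (simp add: g_def invertible_det_nz det_columns axis_def)
  define d where "d = reparametrize g a"
  have d1: "d 1 = outer (axis 1 1) (axis 1 1)" and d3: "d 3 = outer (axis 2 1) (axis 1 1) + outer (axis 1 1) (axis 2 1)"
    by (simp_all add: d_def reparametrize_def g_def net_axis a1 a3)
  have d2: "d 2 $ i $ j = (a 2 $ i $ j - a 2 $ 1 $ 1 * a 1 $ i $ j) / \<mu>" for i j
    using \<mu> by (simp add: d_def reparametrize_def g_def net_entries field_simps)
  have "standard (mat 1) Curvilinear_Triple d"
  proof (rule triple_standard)
    show "admissible d"
      unfolding d_def a_def
      by (intro admissible_reparametrize g admissible_transposed admissible_row_operation P Q b)
    show "normalized d"
      using \<mu> by (simp add: normalized_def d1 d3 d2 a1) (simp add: axis_def)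
    have "only_points {1} a" using points by (simp add: a_def only_points_row_operation P Q only_points_transposed)
    then show "only_points {1} d"
      unfolding d_def by (rule only_points_reparametrize[OF g, rotated]) (simp add: g_def)
  qed (use \<mu> in \<open>simp_all add: d2 d3 a1 a2 axis_def mscale_def\<close>)
  then show ?thesis
    unfolding d_def a_def
    using standardizableI standardizable_reparametrize[OF g] standardizable_transposed standardizable_row_operation[OF Q(1)] standardizable_row_operation[OF P(1)] by blast
qed

text \<open>
  The pairs of coefficients of \<open>t\<close> and \<open>u\<close> in the entries of \<open>D\<close> are either not all
  proportional, or all zero, or multiples of one pair \<open>(p, q)\<close>; in the last case the new
  variable \<open>t\<close> is \<open>p t + q u\<close>.
\<close>
lemma one_point_normal_standardizable:
  assumes b: "admissible b" "normalized b" and points: "only_points {1} b"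
  shows "standardizable b"
proof (cases "\<exists>i j k l. i \<noteq> 1 \<and> j \<noteq> 1 \<and> k \<noteq> 1 \<and> l \<noteq> 1 \<and> b 2 $ i $ j * b 3 $ k $ l \<noteq> b 3 $ i $ j * b 2 $ k $ l")
  case True
  then show ?thesis using one_reduced_standard[OF b(2) points] standardizableI by blast
next
  case False
  then have dep: "b 2 $ i $ j * b 3 $ k $ l = b 3 $ i $ j * b 2 $ k $ l"
    if "i \<noteq> 1" "j \<noteq> 1" "k \<noteq> 1" "l \<noteq> 1" for i j k l
    using that by blast
  show ?thesis
  proof (cases "\<exists>i j. i \<noteq> 1 \<and> j \<noteq> 1 \<and> (b 2 $ i $ j \<noteq> 0 \<or> b 3 $ i $ j \<noteq> 0)")
    case False
    then have "b m $ i $ j = 0" if "i \<noteq> 1" "j \<noteq> 1" "m \<noteq> 1" for i j m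
      using that exhaust_3[of m] by auto
    then show ?thesis using fat_standard[OF b points] standardizableI by blast
  next
    case True
    then obtain i j where ij: "i \<noteq> 1" "j \<noteq> 1" "b 2 $ i $ j \<noteq> 0 \<or> b 3 $ i $ j \<noteq> 0" by blast
    define p q where "p = b 2 $ i $ j" and "q = b 3 $ i $ j"
    \<comment> \<open>The new second and third matrices \<open>r b2 + s b3\<close> and \<open>q b2 - p b3\<close> form a basis with determinant \<open>-1\<close>.\<close>
    obtain r s where rs: "r * p + s * q = 1"
    proof (cases "p = 0")
      case True
      then show thesis using that[of 0 "1 / q"] ij by (simp add: p_def q_def)
    next
      case False
      then show thesis using that[of "1 / p" 0] by simp
    qed
    define g where "g = columns (axis 1 1) (vector [0, r, s]) (vector [0, q, - p])"
    have "det g = - (r * p + s * q)" by (simp add: g_def det_columns axis_def)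
    then have g: "invertible g" by (simp add: rs invertible_det_nz)
    define d where "d = reparametrize g b"
    have d1: "d 1 = b 1" and d2: "d 2 $ k $ l = r * b 2 $ k $ l + s * b 3 $ k $ l"
      and d3: "d 3 $ k $ l = q * b 2 $ k $ l - p * b 3 $ k $ l" for k l
      by (simp_all add: d_def reparametrize_def g_def net_axis net_entries)
    have "standardizable d"
    proof (rule flat_standardizable)
      show "admissible d" unfolding d_def by (intro admissible_reparametrize g b)
      show "normalized d" using b(2) by (simp add: normalized_def d1 d2 d3)
      show "only_points {1} d"
        unfolding d_def by (rule only_points_reparametrize[OF g _ points]) (simp add: g_def)
      show "d 3 $ k $ l = 0" if "k \<noteq> 1" "l \<noteq> 1" for k l
        using dep[OF ij(1,2) that] by (simp add: d3 p_def q_def)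
      show "i \<noteq> 1" "j \<noteq> 1" by fact+
      show "d 2 $ i $ j \<noteq> 0" using rs by (simp add: d2 p_def q_def)
    qed
    then show ?thesis unfolding d_def by (rule standardizable_reparametrize[OF g])
  qed
qed

lemma one_point_standardizable:
  assumes b: "admissible b" and rank: "rank_le_one (b 1)" and points: "only_points {1} b"
  shows "standardizable b"
proof -
  obtain x y where b1: "b 1 = outer x y" using rank by (rule rank_le_oneE)
  have nz: "x \<noteq> 0" "y \<noteq> 0" using admissible_nonzero[OF b, of 1] outer_nonzero unfolding b1 by blast+
  have ex: "\<exists>P::complex^3^3. invertible P \<and> P *v x = axis 1 1" if "x \<noteq> 0" for x :: "complex^3"
  proof -
    obtain y z where "invertible (columns x y z)" using ex_basis_one[OF \<open>x \<noteq> 0\<close>] .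
    then obtain P where P: "invertible P" "P ** columns x y z = mat 1" using invertible_inverse by metis
    have "P *v (columns x y z *v axis k 1) = axis k 1" for k by (simp add: matrix_vector_mul_assoc P(2))
    from this[of 1] P(1) show ?thesis by auto
  qed
  obtain P :: "complex^3^3" where P: "invertible P" "P *v x = axis 1 1" using ex[OF nz(1)] by blast
  obtain Q :: "complex^3^3" where Q: "invertible Q" "Q *v y = axis 1 1" using ex[OF nz(2)] by blast
  define c where "c = row_operation Q (transposed (row_operation P b))"
  have c1: "c 1 = outer (axis 1 1) (axis 1 1)"
    by (simp add: c_def row_operation_def transposed_def b1 mult_outer transpose_outer P Q)
  define g where "g = columns (axis 1 1) (vector [- (c 2 $ 1 $ 1), 1, 0]) (vector [- (c 3 $ 1 $ 1), 0, 1])"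
  have g: "invertible g" by (simp add: g_def invertible_det_nz det_columns axis_def)
  define d where "d = reparametrize g c"
  have "standardizable d"
  proof (rule one_point_normal_standardizable)
    show "admissible d"
      unfolding d_def c_def by (intro admissible_reparametrize g admissible_transposed admissible_row_operation P Q b)
    show "normalized d"
      by (simp add: normalized_def d_def reparametrize_def g_def net_axis net_entries c1) (simp add: axis_def)
    have "only_points {1} c" using points by (simp add: c_def only_points_row_operation P Q only_points_transposed)
    then show "only_points {1} d"
      unfolding d_def by (rule only_points_reparametrize[OF g, rotated]) (simp add: g_def)
  qed
  then show ?thesis
    unfolding d_def c_def using standardizable_reparametrize[OF g] standardizable_row_operation[OF Q(1)] standardizable_transposed standardizable_row_operation[OF P(1)] by blast
qed

section \<open>Normal forms of zero-dimensional sections\<close>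

text \<open>
  A minor of the combination is \<open>\<alpha> \<beta>\<close> times the product of a minor of the two columns and a
  minor of the two rows.
\<close>
lemma rank_le_one_parallel_combination:
  assumes "rank_le_one (mscale \<alpha> (outer x y) + mscale \<beta> (outer x' y'))" "\<alpha> \<noteq> 0" "\<beta> \<noteq> 0"
  shows "parallel x x' \<or> parallel y y'"
proof (rule ccontr)
  assume "\<not> ?thesis"
  then obtain i j k l where "x $ i * x' $ j - x $ j * x' $ i \<noteq> 0" "y $ k * y' $ l - y $ l * y' $ k \<noteq> 0"
    unfolding parallel_def by auto
  moreover have "\<alpha> * \<beta> * ((x $ i * x' $ j - x $ j * x' $ i) * (y $ k * y' $ l - y $ l * y' $ k)) = 0"
    using assms(1)[unfolded rank_le_one_def, rule_format, of i j k l]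
    by (simp add: minor_def mscale_def algebra_simps)
  ultimately show False using assms(2,3) by simp
qed

text \<open>
  The section is empty, or a single point, or a pair of points, or contains three points, which
  cannot be collinear: a combination of two independent rank one matrices with nonzero
  coefficients has rank two.
\<close>
lemma admissible_standardizable:
  assumes b: "admissible b"
  shows "standardizable b"
proof (cases "\<exists>v. v \<noteq> 0 \<and> rank_le_one (net b v)")
  case False
  have "\<not> rank_le_one (b k)" for k
    using False by (metis net_axis axis_eq_0_iff one_neq_zero)
  then have "standard (mat 1) Empty b" using False by (intro standardI) auto
  then show ?thesis by (rule standardizableI)
next
  case True
  then obtain v1 where v1: "v1 \<noteq> 0" "rank_le_one (net b v1)" by blast
  have back_line: "v \<in> line_through (axis k 1)"
    if g: "invertible g" and "g *v axis k 1 = w" "w \<noteq> 0" "parallel w (g *v v)" for g :: "complex^3^3" and v w k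
  proof -
    obtain c where "g *v v = c *s w" using parallel_multiple[OF \<open>parallel w (g *v v)\<close> \<open>w \<noteq> 0\<close>] .
    then have "g *v (v - c *s axis k 1) = 0"
      using that(2) by (simp add: matrix_vector_mult_diff_distrib vector_scalar_commute)
    then have "v - c *s axis k 1 = 0" using invertible_zero_iff[OF g] by blast
    then show ?thesis by (simp add: line_through_def)
  qed
  show ?thesis
  proof (cases "\<exists>v. v \<noteq> 0 \<and> rank_le_one (net b v) \<and> \<not> parallel v1 v")
    case False
    obtain y z where g: "invertible (columns v1 y z)" using ex_basis_one[OF v1(1)] .
    let ?g = "columns v1 y z"
    have "standardizable (reparametrize ?g b)"
    proof (rule one_point_standardizable)
      show "admissible (reparametrize ?g b)" by (rule admissible_reparametrize[OF g b])
      show "rank_le_one (reparametrize ?g b 1)" using v1 by (simp add: reparametrize_def)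
      show "only_points {1} (reparametrize ?g b)"
        unfolding only_points_def net_reparametrize
      proof (intro allI impI)
        fix v :: "complex^3" assume v: "v \<noteq> 0" "rank_le_one (net b (?g *v v))"
        have "?g *v v \<noteq> 0" using v(1) invertible_zero_iff[OF g] by blast
        then have "parallel v1 (?g *v v)" using False v(2) by blast
        then have "v \<in> line_through (axis 1 1)" by (intro back_line[OF g _ v1(1)]) simp
        then show "\<exists>k\<in>{1}. v \<in> line_through (axis k 1)" by blast
      qed
    qed
    then show ?thesis by (rule standardizable_reparametrize[OF g])
  next
    case True
    then obtain v2 where v2: "v2 \<noteq> 0" "rank_le_one (net b v2)" "\<not> parallel v1 v2" by blast
    obtain z where g: "invertible (columns v1 v2 z)" using ex_basis_two[OF v2(3)] .
    let ?g = "columns v1 v2 z" and ?b = "reparametrize (columns v1 v2 z) b"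
    have adm: "admissible ?b" by (rule admissible_reparametrize[OF g b])
    have r1: "rank_le_one (?b 1)" and r2: "rank_le_one (?b 2)" using v1 v2 by (simp_all add: reparametrize_def)
    show ?thesis
    proof (cases "\<exists>v. v \<noteq> 0 \<and> rank_le_one (net b v) \<and> \<not> parallel v1 v \<and> \<not> parallel v2 v")
      case False
      have "only_points {1, 2} ?b"
        unfolding only_points_def net_reparametrize
      proof (intro allI impI)
        fix v :: "complex^3" assume v: "v \<noteq> 0" "rank_le_one (net b (?g *v v))"
        have "?g *v v \<noteq> 0" using v(1) invertible_zero_iff[OF g] by blast
        then consider "parallel v1 (?g *v v)" | "parallel v2 (?g *v v)" using False v(2) by blast
        then show "\<exists>k\<in>{1, 2}. v \<in> line_through (axis k 1)"
        proof cases
          case 1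
          then have "v \<in> line_through (axis 1 1)" by (intro back_line[OF g _ v1(1)]) simp
          then show ?thesis by blast
        next
          case 2
          then have "v \<in> line_through (axis 2 1)" by (intro back_line[OF g _ v2(1)]) simp
          then show ?thesis by blast
        qed
      qed
      then have "standardizable ?b" by (rule two_points_standardizable[OF adm r1 r2])
      then show ?thesis by (rule standardizable_reparametrize[OF g])
    next
      case True
      then obtain v3 where v3: "v3 \<noteq> 0" "rank_le_one (net b v3)" "\<not> parallel v1 v3" "\<not> parallel v2 v3" by blast
      have g3: "invertible (columns v1 v2 v3)"
      proof (rule ccontr)
        assume "\<not> ?thesis"
        then obtain \<alpha> \<beta> where v3_eq: "v3 = \<alpha> *s v1 + \<beta> *s v2" using columns_dependent v2(3) by blast
        have \<alpha>\<beta>: "\<alpha> \<noteq> 0" "\<beta> \<noteq> 0" using v3(3,4) parallel_scale by (auto simp: v3_eq)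
        obtain x y where xy: "?b 1 = outer x y" using r1 by (rule rank_le_oneE)
        obtain x' y' where xy': "?b 2 = outer x' y'" using r2 by (rule rank_le_oneE)
        have "net b v1 = outer x y" "net b v2 = outer x' y'"
          using xy xy' by (simp_all add: reparametrize_def)
        then have "rank_le_one (mscale \<alpha> (outer x y) + mscale \<beta> (outer x' y'))"
          using v3(2) by (simp add: v3_eq net_add net_scale)
        then have "parallel x x' \<or> parallel y y'" using rank_le_one_parallel_combination \<alpha>\<beta> by blast
        then show False using points_independent[OF adm _ xy xy'] by simp
      qed
      let ?c = "reparametrize (columns v1 v2 v3) b"
      have "rank_le_one (?c k)" for k
        using exhaust_3[of k] v1 v2 v3 by (auto simp: reparametrize_def)
      then have "standardizable ?c" by (intro three_points_standardizable admissible_reparametrize g3 b)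
      then show ?thesis by (rule standardizable_reparametrize[OF g3])
    qed
  qed
qed

section \<open>Bases of a space of matrices\<close>

text \<open>
  Independence and span of the indexed family, in place of its range; injectivity of the
  indexing follows from independence.
\<close>
lemma coordinates_on_iff:
  "coordinates_on K b \<longleftrightarrow> (\<forall>v. net b v = 0 \<longrightarrow> v = 0) \<and> K = range (net b)"
proof -
  have inj: "inj b" if "\<forall>v. net b v = 0 \<longrightarrow> v = 0"
  proof (rule injI, rule ccontr)
    fix i j assume ij: "b i = b j" "i \<noteq> j"
    have "net b (axis i 1 + (- 1) *s axis j 1) = 0"
      by (simp only: net_add net_scale net_axis ij(1)) (simp add: vec_eq_iff mscale_def)
    then have "axis i 1 + (- 1) *s axis j 1 = (0 :: complex^3)" using that by blast
    then have "(axis i 1 + (- 1) *s axis j 1 :: complex^3) $ i = 0" by (simp only: zero_index)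
    then show False using ij(2) by (simp add: axis_def)
  qed
  have reindex: "(\<Sum>M\<in>range b. mscale (u M) M) = net b (\<chi> k. u (b k))" if "inj b" for u
    by (simp add: net_def sum.reindex[OF that])
  have lift: "\<exists>u. v = (\<chi> k. u (b k))" if "inj b" for v :: "complex^3"
    by (intro exI[of _ "\<lambda>M. v $ inv_into UNIV b M"]) (simp add: vec_eq_iff inv_f_f[OF that])
  have span: "mat3.span (range b) = range (net b)" if "inj b"
  proof -
    have "mat3.span (range b) = range (\<lambda>u. net b (\<chi> k. u (b k)))"
      by (subst mat3.span_finite) (simp_all add: reindex[OF that])
    also have "\<dots> = range (net b)"
      using lift[OF that] by (auto simp: image_iff) metis
    finally show ?thesis .
  qed
  have dependent: "mat3.dependent (range b) \<longleftrightarrow> \<not> (\<forall>v. net b v = 0 \<longrightarrow> v = 0)" if b: "inj b"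
  proof -
    have "mat3.dependent (range b) \<longleftrightarrow> (\<exists>u. (\<exists>k. u (b k) \<noteq> 0) \<and> net b (\<chi> k. u (b k)) = 0)"
      by (subst mat3.dependent_finite) (simp_all add: reindex[OF b])
    also have "\<dots> \<longleftrightarrow> (\<exists>v. v \<noteq> 0 \<and> net b v = 0)"
    proof
      assume "\<exists>u. (\<exists>k. u (b k) \<noteq> 0) \<and> net b (\<chi> k. u (b k)) = 0"
      then obtain u k where u: "u (b k) \<noteq> 0" "net b (\<chi> k. u (b k)) = 0" by blast
      then have "(\<chi> k. u (b k)) \<noteq> 0" by (auto simp: vec_eq_iff)
      with u(2) show "\<exists>v. v \<noteq> 0 \<and> net b v = 0" by blast
    next
      assume "\<exists>v. v \<noteq> 0 \<and> net b v = 0"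
      then obtain v where v: "v \<noteq> 0" "net b v = 0" by blast
      obtain u where "v = (\<chi> k. u (b k))" using lift[OF b] by blast
      with v show "\<exists>u. (\<exists>k. u (b k) \<noteq> 0) \<and> net b (\<chi> k. u (b k)) = 0"
        by (intro exI[of _ u]) (auto simp: vec_eq_iff)
    qed
    finally show ?thesis by blast
  qed
  show ?thesis
    unfolding coordinates_on_def using inj span dependent by blast
qed

lemma coordinates_on_reparametrize:
  assumes g: "invertible g" and b: "coordinates_on K b"
  shows "coordinates_on K (reparametrize g b)"
proof -
  obtain h where h: "g ** h = mat 1" using g by (auto simp: invertible_def)
  have "net b v = net b (g *v (h *v v))" for v by (simp add: matrix_vector_mul_assoc h)
  then have "range (net (reparametrize g b)) = range (net b)"
    unfolding net_reparametrize by (auto simp: image_iff)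
  then show ?thesis
    using b invertible_zero_iff[OF g] by (auto simp: coordinates_on_iff net_reparametrize)
qed

lemma coordinates_dim:
  assumes "coordinates_on K b"
  shows "mat3.subspace K" "mat3.dim K = 3"
proof -
  have K: "inj b" "\<not> mat3.dependent (range b)" "mat3.span (range b) = K"
    using assms by (simp_all add: coordinates_on_def)
  show "mat3.subspace K" using K(3) mat3.subspace_span by blast
  have "mat3.dim (range b) = card (range b)" by (rule mat3.dim_eq_card_independent) (rule K(2))
  then show "mat3.dim K = 3"
    unfolding K(3)[symmetric] mat3.dim_span using card_image[OF K(1)] by simp
qed

section \<open>Zero-dimensional closed subsets of the plane\<close>

lemma zariski_closed_empty: "zariski_closed {}"
proof -
  have "vanishes_at 1 p \<Longrightarrow> p \<notin> P2" for p
    by (auto simp: P2_iff vanishes_at_def line_through_def)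
  then show ?thesis
    unfolding zariski_closed_def by (intro exI[of _ "{1}"]) (auto intro: homogeneous_1)
qed

lemma zariski_closed_Un:
  assumes "zariski_closed A" "zariski_closed B"
  shows "zariski_closed (A \<union> B)"
proof -
  obtain F where F: "\<forall>f\<in>F. \<exists>d. homogeneous d f" "A = {p\<in>P2. \<forall>f\<in>F. vanishes_at f p}"
    using assms(1) unfolding zariski_closed_def by blast
  obtain G where G: "\<forall>f\<in>G. \<exists>d. homogeneous d f" "B = {p\<in>P2. \<forall>f\<in>G. vanishes_at f p}"
    using assms(2) unfolding zariski_closed_def by blast
  let ?H = "{f * g | f g. f \<in> F \<and> g \<in> G}"
  have mult: "vanishes_at (f * g) p \<longleftrightarrow> vanishes_at f p \<or> vanishes_at g p"
    if fgp: "f \<in> F" "g \<in> G" "p \<in> P2" for f g p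
  proof -
    obtain d where d1: "homogeneous d f" using F(1) fgp(1) by blast
    obtain e where d2: "homogeneous e g" using G(1) fgp(2) by blast
    obtain v where d3: "p = line_through v" using fgp(3) P2_iff by blast
    note d = d1 d2 d3
    show ?thesis
      unfolding d(3) vanishes_at_iff[OF d(1)] vanishes_at_iff[OF d(2)]
        vanishes_at_iff[OF homogeneous_mult[OF d(1,2)]] by simp
  qed
  have "\<forall>h\<in>?H. \<exists>d. homogeneous d h" using F(1) G(1) homogeneous_mult by blast
  moreover have "A \<union> B = {p\<in>P2. \<forall>h\<in>?H. vanishes_at h p}"
    unfolding F(2) G(2) using mult by blast
  ultimately show ?thesis unfolding zariski_closed_def by blast
qed

lemma zariski_closed_point:
  assumes "p \<in> P2"
  shows "zariski_closed {p}"
proof -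
  obtain v where v: "v \<noteq> 0" "p = line_through v" using assms by (auto simp: P2_iff)
  define l where "l i j = Const (v $ i) * Var j - Const (v $ j) * Var i" for i j
  let ?F = "{l i j | i j. True}"
  have hom: "homogeneous 1 (l i j)" for i j
    unfolding l_def by (intro homogeneous_diff homogeneous_mult_Const homogeneous_Var)
  have "q = p" if q: "q \<in> P2" "\<forall>f\<in>?F. vanishes_at f q" for q
  proof -
    obtain w where w: "w \<noteq> 0" "q = line_through w" using q(1) by (auto simp: P2_iff)
    have "poly3_eval (l i j) w = 0" for i j
      using q(2) w(2) vanishes_at_iff[OF hom] by blast
    then have "parallel v w" by (simp add: l_def parallel_def)
    then obtain c where "w = c *s v" using v(1) by (rule parallel_multiple)
    then show "q = p" using line_through_eq_iff[OF w(1) v(1)] w(2) v(2) by blast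
  qed
  moreover have "vanishes_at f p" if "f \<in> ?F" for f
  proof -
    obtain i j where "f = l i j" using \<open>f \<in> ?F\<close> by blast
    then show ?thesis using vanishes_at_iff[OF hom] v(2) by (simp add: l_def mult.commute)
  qed
  ultimately have "{p} = {q\<in>P2. \<forall>f\<in>?F. vanishes_at f q}" using assms by blast
  moreover have "\<forall>f\<in>?F. \<exists>d. homogeneous d f" using hom by blast
  ultimately show ?thesis unfolding zariski_closed_def by blast
qed

lemma zariski_closed_finite: "finite S \<Longrightarrow> S \<subseteq> P2 \<Longrightarrow> zariski_closed S"
proof (induction S rule: finite_induct)
  case (insert p S)
  then show ?case using zariski_closed_Un[OF zariski_closed_point[of p], of S] by simp
qed (rule zariski_closed_empty)

lemma irreducible_point: "p \<in> P2 \<Longrightarrow> irreducible_closed {p}"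
  unfolding irreducible_closed_def using zariski_closed_point by blast

text \<open>
  Finite sets of points are closed, so an irreducible closed set with finitely many points has
  just one.
\<close>
lemma finite_zero_dimensional:
  assumes "finite V" "V \<subseteq> P2"
  shows "zero_dimensional V"
  unfolding zero_dimensional_def
proof (intro allI impI, elim conjE)
  fix A B assume A: "irreducible_closed A" and B: "irreducible_closed B" and sub: "A \<subseteq> B" "B \<subseteq> V"
  obtain p where p: "p \<in> A" using A by (auto simp: irreducible_closed_def)
  have "p \<in> P2" "finite (B - {p})" "B - {p} \<subseteq> P2" using p sub assms by (auto intro: finite_subset)
  then have "zariski_closed {p}" "zariski_closed (B - {p})"
    by (simp_all only: zariski_closed_point zariski_closed_finite)
  moreover have "B \<subseteq> {p} \<union> (B - {p})" by blast
  ultimately have "B \<subseteq> {p} \<or> B \<subseteq> B - {p}" using B unfolding irreducible_closed_def by blast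
  then show "A = B" using p sub by blast
qed

text \<open>
  The closure \<open>B\<close> of the image of a parametrized curve is irreducible, because a product of two
  polynomials in the parameter vanishes identically only if one factor does. If the curve is not
  constant, a point of it together with \<open>B\<close> is a strict chain of irreducible closed subsets.
\<close>
lemma zero_dimensional_no_curve:
  assumes "zero_dimensional (scheme_support (segre_section b))"
  shows "no_curve b"
  unfolding no_curve_def
proof (intro allI impI)
  fix u v w :: "complex^3"
  define p where "p x = u + x *s v + x ^ 2 *s w" for x
  assume "\<forall>x. u + x *s v + x ^ 2 *s w \<noteq> 0 \<and> rank_le_one (net b (u + x *s v + x ^ 2 *s w))"
  then have nz: "p x \<noteq> 0" and rank: "rank_le_one (net b (p x))" for x by (simp_all add: p_def)
  define \<gamma> where "\<gamma> i = [:u $ i, v $ i, w $ i:]" for i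
  have "(\<chi> i. poly (\<gamma> i) x) = p x" for x
    by (simp add: \<gamma>_def p_def vec_eq_iff algebra_simps power2_eq_square)
  then have along: "poly (along \<gamma> f) x = poly3_eval f (p x)" for f x
    by (simp add: poly_along)
  define Z where "Z = {f. (\<exists>d. homogeneous d f) \<and> (\<forall>x. poly3_eval f (p x) = 0)}"
  define B where "B = {q\<in>P2. \<forall>f\<in>Z. vanishes_at f q}"
  have pB: "line_through (p x) \<in> B" for x
    unfolding B_def Z_def
  proof (intro CollectI conjI ballI line_through_in_P2 nz)
    fix f assume "f \<in> {f. (\<exists>d. homogeneous d f) \<and> (\<forall>x. poly3_eval f (p x) = 0)}"
    then obtain d where "homogeneous d f" "poly3_eval f (p x) = 0" by blast
    then show "vanishes_at f (line_through (p x))" by (simp add: vanishes_at_iff)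
  qed
  have closed: "zariski_closed B"
    unfolding zariski_closed_def B_def by (intro exI[of _ Z] conjI refl) (simp add: Z_def)
  have minimal: "B \<subseteq> A" if A: "A = {q\<in>P2. \<forall>f\<in>F. vanishes_at f q}" "\<forall>f\<in>F. \<exists>d. homogeneous d f"
    and all: "\<And>f x. f \<in> F \<Longrightarrow> poly3_eval f (p x) = 0" for A F
  proof -
    have "F \<subseteq> Z" using A(2) all by (auto simp: Z_def)
    then show ?thesis unfolding A(1) B_def by blast
  qed
  have "irreducible_closed B"
    unfolding irreducible_closed_def
  proof (intro conjI allI impI)
    show "zariski_closed B" by (rule closed)
    show "B \<noteq> {}" using pB by blast
    fix A1 A2 assume A: "zariski_closed A1 \<and> zariski_closed A2 \<and> B \<subseteq> A1 \<union> A2"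
    obtain F1 where F1: "\<forall>f\<in>F1. \<exists>d. homogeneous d f" "A1 = {q\<in>P2. \<forall>f\<in>F1. vanishes_at f q}"
      using A unfolding zariski_closed_def by blast
    obtain F2 where F2: "\<forall>f\<in>F2. \<exists>d. homogeneous d f" "A2 = {q\<in>P2. \<forall>f\<in>F2. vanishes_at f q}"
      using A unfolding zariski_closed_def by blast
    show "B \<subseteq> A1 \<or> B \<subseteq> A2"
    proof (rule ccontr)
      assume "\<not> ?thesis"
      then obtain f1 x1 f2 x2 where f: "f1 \<in> F1" "poly3_eval f1 (p x1) \<noteq> 0" "f2 \<in> F2" "poly3_eval f2 (p x2) \<noteq> 0"
        using minimal[OF F1(2,1)] minimal[OF F2(2,1)] by blast
      have "poly (along \<gamma> f1 * along \<gamma> f2) x = 0" for x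
      proof -
        have "line_through (p x) \<in> A1 \<union> A2" using A pB by blast
        then have "vanishes_at f1 (line_through (p x)) \<or> vanishes_at f2 (line_through (p x))"
          unfolding F1(2) F2(2) using f by blast
        then have "poly3_eval f1 (p x) = 0 \<or> poly3_eval f2 (p x) = 0"
          using f F1(1) F2(1) vanishes_at_iff by blast
        then show ?thesis by (auto simp: along)
      qed
      then have "along \<gamma> f1 * along \<gamma> f2 = 0" using poly_all_0_iff_0 by blast
      then have "along \<gamma> f1 = 0 \<or> along \<gamma> f2 = 0" by simp
      then show False using f(2,4) along by (metis poly_0)
    qed
  qed
  moreover have "B \<subseteq> scheme_support (segre_section b)"
  proof
    fix q assume q: "q \<in> B"
    then obtain r where r: "r \<noteq> 0" "q = line_through r" by (auto simp: B_def P2_iff)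
    have "minor (entry b) i j k l \<in> Z" for i j k l
      using homogeneous_minor rank segre_vanishes_iff minor_in_segre unfolding Z_def by blast
    then have "poly3_eval (minor (entry b) i j k l) r = 0" for i j k l
      using q r(2) vanishes_at_iff[OF homogeneous_minor] unfolding B_def by blast
    then have "rank_le_one (net b r)" by (simp add: rank_le_one_def minor_def)
    then show "q \<in> scheme_support (segre_section b)" using line_in_support_iff[OF r(1)] r(2) by simp
  qed
  moreover have "line_through (p 0) \<in> P2" using nz by (rule line_through_in_P2)
  then have "irreducible_closed {line_through (p 0)}" by (rule irreducible_point)
  ultimately have "{line_through (p 0)} = B"
    using assms pB unfolding zero_dimensional_def by blast
  then have "line_through (p 1) = line_through (p 0)" using pB by blast
  then obtain c where "p 1 = c *s p 0" using line_through_eq_iff[OF nz nz] by blast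
  then show "\<exists>c. u + v + w = c *s u" by (auto simp: p_def)
qed

lemma zero_dimensional_admissible:
  assumes "coordinates_on K b" "zero_dimensional (scheme_support (segre_section b))"
  shows "admissible b"
  using assms zero_dimensional_no_curve by (simp add: admissible_def coordinates_on_iff)

lemma only_points_zero_dimensional:
  assumes "only_points S b"
  shows "zero_dimensional (scheme_support (segre_section b))"
proof (rule finite_zero_dimensional)
  have "scheme_support (segre_section b) \<subseteq> (\<lambda>k. line_through (axis k 1)) ` S"
  proof
    fix q assume "q \<in> scheme_support (segre_section b)"
    then obtain v where v: "v \<noteq> 0" "q = line_through v" "rank_le_one (net b v)"
      unfolding support_segre by blast
    then obtain k c where k: "k \<in> S" "v = c *s axis k 1"
      using assms unfolding only_points_def line_through_def by blast
    moreover have "(axis k 1 :: complex^3) \<noteq> 0" by (simp add: axis_eq_0_iff)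
    ultimately show "q \<in> (\<lambda>k. line_through (axis k 1)) ` S"
      using v line_through_eq_iff[of v "axis k 1"] by blast
  qed
  then show "finite (scheme_support (segre_section b))" by (rule finite_subset) simp
  show "scheme_support (segre_section b) \<subseteq> P2" by (auto simp: scheme_support_def)
qed

section \<open>Every type occurs\<close>

definition matrix3 :: "complex list \<Rightarrow> complex list \<Rightarrow> complex list \<Rightarrow> complex^3^3" where
  "matrix3 x y z = vector [vector x, vector y, vector z]"

lemma matrix3_nth [simp]:
  "matrix3 [a, b, c] [a', b', c'] [a'', b'', c''] $ 1 = vector [a, b, c]"
  "matrix3 [a, b, c] [a', b', c'] [a'', b'', c''] $ 2 = vector [a', b', c']"
  "matrix3 [a, b, c] [a', b', c'] [a'', b'', c''] $ 3 = vector [a'', b'', c'']"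
  by (simp_all add: matrix3_def)

definition net_of :: "complex^3^3 \<Rightarrow> complex^3^3 \<Rightarrow> complex^3^3 \<Rightarrow> 3 \<Rightarrow> complex^3^3" where
  "net_of L M N k = (if k = 1 then L else if k = 2 then M else N)"

lemma net_of_simps [simp]: "net_of L M N 1 = L" "net_of L M N 2 = M" "net_of L M N 3 = N"
  by (simp_all add: net_of_def)

text \<open>
  In coordinates \<open>(s : t : u)\<close>: the skew-symmetric matrices, which have no member of rank one;
  for the three reduced points the diagonal matrices; in the remaining cases simple instances of
  the normal forms of the classification.
\<close>
fun example :: "scheme_type \<Rightarrow> 3 \<Rightarrow> complex^3^3" where
  "example Empty =
    net_of (matrix3 [0,1,0] [-1,0,0] [0,0,0]) (matrix3 [0,0,1] [0,0,0] [-1,0,0]) (matrix3 [0,0,0] [0,0,1] [0,-1,0])"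
| "example One_Reduced =
    net_of (matrix3 [1,0,0] [0,0,0] [0,0,0]) (matrix3 [0,0,0] [0,1,0] [0,0,1]) (matrix3 [0,0,0] [0,0,1] [1,0,0])"
| "example Two_Reduced =
    net_of (matrix3 [1,0,0] [0,0,0] [0,0,0]) (matrix3 [0,0,0] [0,1,0] [0,0,0]) (matrix3 [0,0,1] [0,0,0] [0,1,0])"
| "example Double =
    net_of (matrix3 [1,0,0] [0,0,0] [0,0,0]) (matrix3 [0,0,0] [0,1,0] [0,0,1]) (matrix3 [0,0,1] [1,0,0] [0,0,0])"
| "example Three_Reduced =
    net_of (matrix3 [1,0,0] [0,0,0] [0,0,0]) (matrix3 [0,0,0] [0,1,0] [0,0,0]) (matrix3 [0,0,0] [0,0,0] [0,0,1])"
| "example Double_Plus_Reduced =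
    net_of (matrix3 [1,0,0] [0,0,0] [0,0,0]) (matrix3 [0,0,0] [0,1,0] [0,0,0]) (matrix3 [0,0,1] [1,0,0] [0,0,0])"
| "example Curvilinear_Triple =
    net_of (matrix3 [1,0,0] [0,0,0] [0,0,0]) (matrix3 [0,0,1] [0,1,0] [0,0,0]) (matrix3 [0,1,0] [1,0,0] [0,0,0])"
| "example Fat_Point =
    net_of (matrix3 [1,0,0] [0,0,0] [0,0,0]) (matrix3 [0,1,0] [1,0,0] [0,0,0]) (matrix3 [0,0,1] [0,0,0] [1,0,0])"

lemma example_net_injective: "net (example \<tau>) v = 0 \<Longrightarrow> v = 0"
  by (cases \<tau>; simp add: vec_eq_iff forall_3 net_entries)

fun example_points :: "scheme_type \<Rightarrow> 3 set" where
  "example_points Empty = {}"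
| "example_points Two_Reduced = {1, 2}"
| "example_points Double_Plus_Reduced = {1, 2}"
| "example_points Three_Reduced = {1, 2, 3}"
| "example_points \<tau> = {1}"

lemma example_only_points: "only_points (example_points \<tau>) (example \<tau>)"
  unfolding only_points_def
proof (intro allI impI)
  fix v :: "complex^3" assume v: "v \<noteq> 0" "rank_le_one (net (example \<tau>) v)"
  have 1: "v \<in> line_through (axis 1 1)" if "v $ 2 = 0" "v $ 3 = 0"
    using on_axis_line[of 1 v] that exhaust_3 by metis
  have 2: "v \<in> line_through (axis 2 1)" if "v $ 1 = 0" "v $ 3 = 0"
    using on_axis_line[of 2 v] that exhaust_3 by metis
  have 3: "v \<in> line_through (axis 3 1)" if "v $ 1 = 0" "v $ 2 = 0"
    using on_axis_line[of 3 v] that exhaust_3 by metis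
  show "\<exists>k\<in>example_points \<tau>. v \<in> line_through (axis k 1)"
    using v unfolding rank_le_one_iff net_entries vec_eq_iff forall_3
    by (cases \<tau>; simp; use 1 2 3 in blast)
qed

text \<open>
  The examples have finite support by inspection, hence are admissible, so the lemmas of the
  classification apply to them.
\<close>
lemma example_standard: "standard (mat 1) \<tau> (example \<tau>)"
proof -
  note points = example_only_points[of \<tau>]
  have adm: "admissible (example \<tau>)"
    unfolding admissible_def
    using example_net_injective zero_dimensional_no_curve[OF only_points_zero_dimensional[OF points]] by blast
  have points2: "v \<in> line_through (axis 1 1) \<or> v \<in> line_through (axis 2 1)"
    if "example_points \<tau> = {1, 2}" "v \<noteq> 0" "rank_le_one (net (example \<tau>) v)" for v
    using points that unfolding only_points_def by auto
  have flat: "example \<tau> m $ i $ j = 0"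
    if "\<tau> = Double \<and> m = 3 \<or> \<tau> = Fat_Point \<and> m \<noteq> 1" "i \<noteq> 1" "j \<noteq> 1" for m i j
    using that exhaust_3[of m] exhaust_3[of i] exhaust_3[of j] by auto
  show ?thesis
  proof (cases \<tau>)
    case Empty
    have "\<not> rank_le_one (example \<tau> k)" for k
      using only_point_index[OF points, of k] Empty by auto
    moreover have "\<not> rank_le_one (net (example \<tau>) v)" if "v \<noteq> 0" for v
      using points that Empty by (auto simp: only_points_def)
    ultimately show ?thesis by (intro standardI) (auto simp: Empty)
  next
    case One_Reduced
    show ?thesis
      unfolding One_Reduced
      by (rule one_reduced_standard[of _ 2 2 2 3])
        (use points in \<open>simp_all add: One_Reduced normalized_def forall_3\<close>)
  next
    case Two_Reduced
    show ?thesis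
      unfolding Two_Reduced
      by (rule two_reduced_standard; (rule points2[unfolded Two_Reduced])?)
        (simp_all add: vec_eq_iff forall_3 axis_def)
  next
    case Three_Reduced
    show ?thesis
      using adm unfolding Three_Reduced
      by (rule diagonal_rows_standard[of _ "\<lambda>k. axis k 1"])
        (use exhaust_3 in \<open>force simp: vec_eq_iff forall_3 axis_def net_of_def\<close>)
  next
    case Double
    show ?thesis
      unfolding Double
      by (rule double_standard[of _ 2 2 2 3])
        (use points flat in \<open>simp_all add: Double normalized_def forall_3\<close>)
  next
    case Double_Plus_Reduced
    show ?thesis
      unfolding Double_Plus_Reduced
      by (rule double_plus_reduced_standard[OF adm[unfolded Double_Plus_Reduced]]; (rule points2[unfolded Double_Plus_Reduced])?)
        (simp_all add: vec_eq_iff forall_3 axis_def)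
  next
    case Curvilinear_Triple
    show ?thesis
      using adm unfolding Curvilinear_Triple
      by (rule triple_standard)
        (use points in \<open>simp_all add: Curvilinear_Triple normalized_def forall_3\<close>)
  next
    case Fat_Point
    show ?thesis
      using adm unfolding Fat_Point
      by (rule fat_standard)
        (use points flat in \<open>simp_all add: Fat_Point normalized_def forall_3\<close>)
  qed
qed

section \<open>Classification of the sections\<close>

lemma standard_net_of_standardizable:
  assumes "admissible b"
  obtains g h \<tau> where "invertible g" "standard (mat 1) \<tau> (reparametrize g b)" "standard_net g h \<tau> b"
proof -
  obtain g \<tau> where g: "invertible g" "standard (mat 1) \<tau> (reparametrize g b)"
    using admissible_standardizable[OF assms] by (auto simp: standardizable_def)
  obtain h where "g ** h = mat 1" using g(1) by (auto simp: invertible_def)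
  then have "standard_net g h \<tau> b"
    using standard_reparametrize[OF g] by unfold_locales
  then show thesis using that g by blast
qed

theorem theorem1p3:
  shows
    "(\<forall>K b. mat3.subspace K \<and> mat3.dim K = 3 \<and> coordinates_on K b \<and>
        zero_dimensional (scheme_support (segre_section b)) \<longrightarrow>
          scheme_length (segre_section b) \<le> 3 \<and> (\<exists>\<tau>. has_type \<tau> (segre_section b)))
   \<and> (\<forall>\<tau>. \<exists>K b. mat3.subspace K \<and> mat3.dim K = 3 \<and> coordinates_on K b \<and>
        zero_dimensional (scheme_support (segre_section b)) \<and> has_type \<tau> (segre_section b))
   \<and> (\<forall>\<tau> K K' b b'. mat3.subspace K \<and> mat3.dim K = 3 \<and> coordinates_on K b \<and>
        zero_dimensional (scheme_support (segre_section b)) \<and> has_type \<tau> (segre_section b) \<and>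
        mat3.subspace K' \<and> mat3.dim K' = 3 \<and> coordinates_on K' b' \<and>
        zero_dimensional (scheme_support (segre_section b')) \<and> has_type \<tau> (segre_section b') \<longrightarrow>
          (\<exists>c c'. coordinates_on K c \<and> coordinates_on K' c' \<and>
             same_scheme (segre_section c) (segre_section c')))"
proof (intro conjI allI impI)
  fix K b
  assume "mat3.subspace K \<and> mat3.dim K = 3 \<and> coordinates_on K b \<and>
    zero_dimensional (scheme_support (segre_section b))"
  then have "admissible b" using zero_dimensional_admissible by blast
  then obtain g h \<tau> where "standard_net g h \<tau> b" by (rule standard_net_of_standardizable)
  then show "scheme_length (segre_section b) \<le> 3" "\<exists>\<tau>. has_type \<tau> (segre_section b)"
    using standard_net.standard_length standard_net.standard_has_type by blast+
next
  fix \<tau>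
  have std: "standard_net (mat 1) (mat 1) \<tau> (example \<tau>)"
    using example_standard by unfold_locales simp_all
  have "coordinates_on (range (net (example \<tau>))) (example \<tau>)"
    using example_net_injective by (simp add: coordinates_on_iff)
  moreover have "zero_dimensional (scheme_support (segre_section (example \<tau>)))"
    using only_points_zero_dimensional[OF example_only_points] .
  moreover have "has_type \<tau> (segre_section (example \<tau>))"
    using standard_net.standard_has_type[OF std] .
  ultimately show "\<exists>K b. mat3.subspace K \<and> mat3.dim K = 3 \<and> coordinates_on K b \<and>
      zero_dimensional (scheme_support (segre_section b)) \<and> has_type \<tau> (segre_section b)"
    using coordinates_dim by blast
next
  fix \<tau> K K' b b'
  assume *: "mat3.subspace K \<and> mat3.dim K = 3 \<and> coordinates_on K b \<and>
        zero_dimensional (scheme_support (segre_section b)) \<and> has_type \<tau> (segre_section b) \<and>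
        mat3.subspace K' \<and> mat3.dim K' = 3 \<and> coordinates_on K' b' \<and>
        zero_dimensional (scheme_support (segre_section b')) \<and> has_type \<tau> (segre_section b')"
  have normal: "\<exists>c. coordinates_on K c \<and> standard (mat 1) \<tau> c"
    if b: "coordinates_on K b" "zero_dimensional (scheme_support (segre_section b))" "has_type \<tau> (segre_section b)"
    for K b
  proof -
    obtain g h \<sigma> where g: "invertible g" "standard (mat 1) \<sigma> (reparametrize g b)" "standard_net g h \<sigma> b"
      using standard_net_of_standardizable[OF zero_dimensional_admissible[OF b(1,2)]] .
    have "\<tau> = \<sigma>" using standard_net.type_unique[OF g(3) b(3)] .
    then show ?thesis using g(2) coordinates_on_reparametrize[OF g(1) b(1)] by blast
  qed
  obtain c where c: "coordinates_on K c" "standard (mat 1) \<tau> c" using normal * by blast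
  obtain c' where c': "coordinates_on K' c'" "standard (mat 1) \<tau> c'" using normal * by blast
  show "\<exists>c c'. coordinates_on K c \<and> coordinates_on K' c' \<and> same_scheme (segre_section c) (segre_section c')"
    using c c' standard_same_scheme by blast
qed

end
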